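(* Let $X$ be a Hausdorff space. The following are equivalent: (1) $X$ is homeomorphic to $\Omega(T)=\mathcal{R}(T)=\mathcal{B}(T)$ for a (pruned) graph-theoretic tree $T$; (2) $X$ is homeomorphic to a metrizable end space of a graph; (3) $X$ is homeomorphic to a metrizable ray space (of some tree); (4) $X$ is homeomorphic to a metrizable branch space (of some tree); (5) $X$ is an ultraparacompact, subcompact, metrizable space; (6) $X$ is completely ultrametrizable; (7) $X$ admits a nested, noetherian base that is complete and $\sigma$-discrete; (8) $X$ admits a nested base that is complete and $\sigma$-discrete; (9) $X$ admits a clopen base that is complete and $\sigma$-locally finite.
   Context: End spaces: In a graph $G$, a (graph) ray is a one-way infinite path. Two graph rays are equivalent if for every finite set $S$ of vertices they have tails in the same component of $G-S$. The equivalence classes are the ends of $G$, and $\Omega(G)$ is the set of ends. For a finite vertex set $S$ and an end $\omega$, let $C(S,\omega)$ be the component of $G-S$ containing a tail of every ray in $\omega$, and let $\Omega(S,\omega)$ be the set of ends $\omega'$ with $C(S,\omega')=C(S,\omega)$. The end space of $G$ is $\Omega(G)$ with the topology whose basis consists of all sets $\Omega(S,\omega)$. Trees: A tree is a partially ordered set $T$ with a unique minimal element (its root) such that the set of predecessors of any element is well-ordered (distinct limit nodes may have the same set of strict predecessors). A path in $T$ is a down-closed chain (thus a path is a non-splitting rooted subtree of $T$, where a rooted subtree contains the root of $T$); a ray is a path without maximal element; a branch is an inclusion-wise maximal path. Identifying paths with their characteristic functions, the ray space $\mathcal{R}(T)$ and the branch space $\mathcal{B}(T)$ are the sets of all rays,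 respectively branches, with the subspace topology from $2^T$ (product topology). The tree is pruned if every node has a successor (a successor of $t$ is a node $t'>t$ with no node strictly between). A graph-theoretic tree is a tree of height at most $\omega$ (the height being the supremum of the order types of the branches); it is regarded as a graph by joining each node to its successors. For a pruned graph-theoretic tree $T$, the spaces $\Omega(T)$, $\mathcal{R}(T)$ and $\mathcal{B}(T)$ are identified in the natural way (each end corresponding to the unique ray of the order tree representing it). Properties: A space is ultraparacompact if every open cover can be refined to a partition of the space into open sets. A space is subcompact if it has a base $\mathcal{B}$ of open sets such that every regular filter base $\mathcal{F}\subseteq\mathcal{B}$ has nonempty intersection, where a nonempty collection $\mathcal{F}$ of nonempty sets is a regular filter base if for all $F_1,F_2\in\mathcal{F}$ there is $F_3\in\mathcal{F}$ with $\overline{F_3}\subseteq F_1\cap F_2$. A space is completely ultrametrizable if its topology is induced by a complete ultrametric. A collection $\mathcal{A}$ of subsets of a space $X$ is nested if for all $A,B\in\mathcal{A}$ with $A\cap B\neq\emptyset$ we have $A\subseteq B$ or $B\subseteq A$; noetherian if every $\subseteq$-increasing sequence of elements of $\mathcal{A}$ is eventually constant; centered if any finite subfamily has nonempty intersection; complete if any centered subfamily of $\mathcal{A}$ has nonempty intersection; discrete (locally finite) if every $x\in X$ has an open neighbourhood meeting at most one (only finitely many) elements of $\mathcal{A}$; $\sigma$-discrete ($\sigma$-locally finite) if it is a countable union of discrete (locally finite) subcollections; a clopen base if it is a base for $X$ all of whose elements are clopen.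
   Formalization: Conditions (1) and (4) are asserted equivalent to the others only for nonempty X: the empty space satisfies (2), (3), (5)–(9), but every rooted tree has a branch and every pruned tree a ray, so (1) and (4) fail for it. Trees and graphs live on any sufficiently large node set. *)

theory Defs
  imports "HOL-Analysis.Analysis"
begin

section \<open>Graphs and their end spaces\<close>

definition simple_graph :: "'v set \<Rightarrow> 'v set set \<Rightarrow> bool" where
  "simple_graph V E \<longleftrightarrow> (\<forall>e\<in>E. \<exists>u\<in>V. \<exists>v\<in>V. u \<noteq> v \<and> e = {u, v})"

definition adj_avoiding :: "'v set \<Rightarrow> 'v set set \<Rightarrow> 'v set \<Rightarrow> ('v \<times> 'v) set" where
  "adj_avoiding V E S = {(u, v). u \<in> V - S \<and> v \<in> V - S \<and> {u, v} \<in> E}"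

text \<open>Vertex sets of the components of \<open>G - S\<close>.\<close>

definition graph_components :: "'v set \<Rightarrow> 'v set set \<Rightarrow> 'v set \<Rightarrow> 'v set set" where
  "graph_components V E S = {{v \<in> V - S. (u, v) \<in> (adj_avoiding V E S)\<^sup>*} | u. u \<in> V - S}"

text \<open>A one-way infinite path has a unique starting vertex, hence is the same thing as the
  injective sequence of its vertices.\<close>

definition graph_ray :: "'v set \<Rightarrow> 'v set set \<Rightarrow> (nat \<Rightarrow> 'v) \<Rightarrow> bool" where
  "graph_ray V E \<rho> \<longleftrightarrow> inj \<rho> \<and> range \<rho> \<subseteq> V \<and> (\<forall>n. {\<rho> n, \<rho> (Suc n)} \<in> E)"

definition has_tail_in :: "(nat \<Rightarrow> 'v) \<Rightarrow> 'v set \<Rightarrow> bool" where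
  "has_tail_in \<rho> C \<longleftrightarrow> (\<exists>m. \<forall>i\<ge>m. \<rho> i \<in> C)"

definition ray_equiv :: "'v set \<Rightarrow> 'v set set \<Rightarrow> ((nat \<Rightarrow> 'v) \<times> (nat \<Rightarrow> 'v)) set" where
  "ray_equiv V E = {(\<rho>, \<sigma>). graph_ray V E \<rho> \<and> graph_ray V E \<sigma> \<and>
     (\<forall>S. finite S \<and> S \<subseteq> V \<longrightarrow>
        (\<exists>C\<in>graph_components V E S. has_tail_in \<rho> C \<and> has_tail_in \<sigma> C))}"

definition graph_ends :: "'v set \<Rightarrow> 'v set set \<Rightarrow> (nat \<Rightarrow> 'v) set set" where
  "graph_ends V E = {\<rho>. graph_ray V E \<rho>} // ray_equiv V E"

text \<open>\<open>C(S, \<omega>)\<close>\<close>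

definition end_component ::
    "'v set \<Rightarrow> 'v set set \<Rightarrow> 'v set \<Rightarrow> (nat \<Rightarrow> 'v) set \<Rightarrow> 'v set" where
  "end_component V E S \<omega> =
     (THE C. C \<in> graph_components V E S \<and> (\<forall>\<rho>\<in>\<omega>. has_tail_in \<rho> C))"

text \<open>\<open>\<Omega>(S, \<omega>)\<close>\<close>

definition end_nbhd ::
    "'v set \<Rightarrow> 'v set set \<Rightarrow> 'v set \<Rightarrow> (nat \<Rightarrow> 'v) set \<Rightarrow> (nat \<Rightarrow> 'v) set set" where
  "end_nbhd V E S \<omega> = {\<omega>' \<in> graph_ends V E. end_component V E S \<omega>' = end_component V E S \<omega>}"

text \<open>The generating sets already form a base: if \<open>\<omega>\<close> lies in \<open>\<Omega>(S\<^sub>1, \<omega>\<^sub>1)\<close> and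
  \<open>\<Omega>(S\<^sub>2, \<omega>\<^sub>2)\<close>, then \<open>\<Omega>(S\<^sub>1 \<union> S\<^sub>2, \<omega>)\<close> is contained in both.\<close>

definition end_space :: "'v set \<Rightarrow> 'v set set \<Rightarrow> (nat \<Rightarrow> 'v) set topology" where
  "end_space V E = topology_generated_by
     {end_nbhd V E S \<omega> | S \<omega>. finite S \<and> S \<subseteq> V \<and> \<omega> \<in> graph_ends V E}"


section \<open>Order trees, ray spaces and branch spaces\<close>

text \<open>A tree is given by its reflexive order relation \<open>r\<close>; its nodes are \<open>Field r\<close>.\<close>

definition order_tree :: "'n rel \<Rightarrow> bool" where
  "order_tree r \<longleftrightarrow>
     Partial_order r \<and>
     (\<exists>!x. x \<in> Field r \<and> (\<forall>y. (y, x) \<in> r \<longrightarrow> y = x)) \<and>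
     (\<forall>t\<in>Field r. Well_order (Restr r (underS r t)))"

text \<open>Paths contain the root, i.e. (being down-closed) they are nonempty.\<close>

definition tree_path :: "'n rel \<Rightarrow> 'n set \<Rightarrow> bool" where
  "tree_path r P \<longleftrightarrow> P \<noteq> {} \<and> P \<in> Chains r \<and> (\<forall>x\<in>P. \<forall>y. (y, x) \<in> r \<longrightarrow> y \<in> P)"

definition tree_ray :: "'n rel \<Rightarrow> 'n set \<Rightarrow> bool" where
  "tree_ray r P \<longleftrightarrow> tree_path r P \<and> \<not> (\<exists>m\<in>P. \<forall>x\<in>P. (m, x) \<in> r \<longrightarrow> x = m)"

definition tree_branch :: "'n rel \<Rightarrow> 'n set \<Rightarrow> bool" where
  "tree_branch r P \<longleftrightarrow> tree_path r P \<and> (\<forall>Q. tree_path r Q \<and> P \<subseteq> Q \<longrightarrow> Q = P)"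

text \<open>\<open>2\<^sup>T\<close> and characteristic functions; functions on \<open>T\<close> are extensional, as always in
  \<^const>\<open>product_topology\<close>.\<close>

definition cantor_cube :: "'n set \<Rightarrow> ('n \<Rightarrow> bool) topology" where
  "cantor_cube T = product_topology (\<lambda>_. discrete_topology (UNIV :: bool set)) T"

definition char_fun :: "'n set \<Rightarrow> 'n set \<Rightarrow> 'n \<Rightarrow> bool" where
  "char_fun T P = (\<lambda>t\<in>T. t \<in> P)"

definition ray_space :: "'n rel \<Rightarrow> ('n \<Rightarrow> bool) topology" where
  "ray_space r = subtopology (cantor_cube (Field r)) (char_fun (Field r) ` {P. tree_ray r P})"

definition branch_space :: "'n rel \<Rightarrow> ('n \<Rightarrow> bool) topology" where
  "branch_space r = subtopology (cantor_cube (Field r)) (char_fun (Field r) ` {P. tree_branch r P})"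

definition tree_succ :: "'n rel \<Rightarrow> 'n \<Rightarrow> 'n \<Rightarrow> bool" where
  "tree_succ r t u \<longleftrightarrow> (t, u) \<in> r \<and> t \<noteq> u \<and>
     \<not> (\<exists>v. v \<noteq> t \<and> v \<noteq> u \<and> (t, v) \<in> r \<and> (v, u) \<in> r)"

definition pruned_tree :: "'n rel \<Rightarrow> bool" where
  "pruned_tree r \<longleftrightarrow> (\<forall>t\<in>Field r. \<exists>u. tree_succ r t u)"

text \<open>Height at most \<open>\<omega>\<close>: the order type of every branch is at most \<open>\<omega>\<close>, the order type of
  \<^const>\<open>natLeq\<close>.\<close>

definition graph_theoretic_tree :: "'n rel \<Rightarrow> bool" where
  "graph_theoretic_tree r \<longleftrightarrow>
     order_tree r \<and> (\<forall>B. tree_branch r B \<longrightarrow> (Restr r B, natLeq) \<in> ordLeq)"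

definition tree_edges :: "'n rel \<Rightarrow> 'n set set" where
  "tree_edges r = {{t, u} | t u. tree_succ r t u}"


section \<open>Topological properties and families of sets\<close>

definition base_for :: "'a topology \<Rightarrow> 'a set set \<Rightarrow> bool" where
  "base_for X \<B> \<longleftrightarrow>
     (\<forall>B\<in>\<B>. openin X B) \<and> (\<forall>U. openin X U \<longrightarrow> (\<exists>\<U>\<subseteq>\<B>. \<Union>\<U> = U))"

definition ultraparacompact_space :: "'a topology \<Rightarrow> bool" where
  "ultraparacompact_space X \<longleftrightarrow>
     (\<forall>\<U>. (\<forall>U\<in>\<U>. openin X U) \<and> \<Union>\<U> = topspace X \<longrightarrow>
        (\<exists>\<P>. partition_on (topspace X) \<P> \<and> (\<forall>P\<in>\<P>. openin X P) \<and>
             (\<forall>P\<in>\<P>. \<exists>U\<in>\<U>. P \<subseteq> U)))"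

definition regular_filter_base :: "'a topology \<Rightarrow> 'a set set \<Rightarrow> bool" where
  "regular_filter_base X \<F> \<longleftrightarrow> \<F> \<noteq> {} \<and> {} \<notin> \<F> \<and>
     (\<forall>F1\<in>\<F>. \<forall>F2\<in>\<F>. \<exists>F3\<in>\<F>. X closure_of F3 \<subseteq> F1 \<inter> F2)"

definition subcompact_space :: "'a topology \<Rightarrow> bool" where
  "subcompact_space X \<longleftrightarrow>
     (\<exists>\<B>. base_for X \<B> \<and> (\<forall>\<F>\<subseteq>\<B>. regular_filter_base X \<F> \<longrightarrow> \<Inter>\<F> \<noteq> {}))"

definition completely_ultrametrizable_space :: "'a topology \<Rightarrow> bool" where
  "completely_ultrametrizable_space X \<longleftrightarrow>
     (\<exists>M d. Metric_space M d \<and> (\<forall>x\<in>M. \<forall>y\<in>M. \<forall>z\<in>M. d x z \<le> max (d x y) (d y z)) \<and>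
            Metric_space.mcomplete M d \<and> X = Metric_space.mtopology M d)"

definition nested_family :: "'a set set \<Rightarrow> bool" where
  "nested_family \<A> \<longleftrightarrow> (\<forall>A\<in>\<A>. \<forall>B\<in>\<A>. A \<inter> B \<noteq> {} \<longrightarrow> A \<subseteq> B \<or> B \<subseteq> A)"

definition noetherian_family :: "'a set set \<Rightarrow> bool" where
  "noetherian_family \<A> \<longleftrightarrow>
     (\<forall>A :: nat \<Rightarrow> 'a set. range A \<subseteq> \<A> \<and> incseq A \<longrightarrow> (\<exists>N. \<forall>n\<ge>N. A n = A N))"

definition centered_family :: "'a set set \<Rightarrow> bool" where
  "centered_family \<C> \<longleftrightarrow> (\<forall>\<F>\<subseteq>\<C>. finite \<F> \<longrightarrow> \<Inter>\<F> \<noteq> {})"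

text \<open>As \<open>\<Inter>{} = UNIV\<close>, the empty subfamily imposes no condition here or in
  \<^const>\<open>centered_family\<close>.\<close>

definition complete_family :: "'a set set \<Rightarrow> bool" where
  "complete_family \<A> \<longleftrightarrow> (\<forall>\<C>\<subseteq>\<A>. centered_family \<C> \<longrightarrow> \<Inter>\<C> \<noteq> {})"

definition discrete_family :: "'a topology \<Rightarrow> 'a set set \<Rightarrow> bool" where
  "discrete_family X \<A> \<longleftrightarrow>
     (\<forall>x\<in>topspace X. \<exists>U. openin X U \<and> x \<in> U \<and>
        (\<forall>A\<in>\<A>. \<forall>B\<in>\<A>. A \<inter> U \<noteq> {} \<and> B \<inter> U \<noteq> {} \<longrightarrow> A = B))"

definition sigma_discrete_family :: "'a topology \<Rightarrow> 'a set set \<Rightarrow> bool" where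
  "sigma_discrete_family X \<A> \<longleftrightarrow>
     (\<exists>D :: nat \<Rightarrow> 'a set set. \<A> = (\<Union>n. D n) \<and> (\<forall>n. discrete_family X (D n)))"

definition sigma_locally_finite_family :: "'a topology \<Rightarrow> 'a set set \<Rightarrow> bool" where
  "sigma_locally_finite_family X \<A> \<longleftrightarrow>
     (\<exists>D :: nat \<Rightarrow> 'a set set. \<A> = (\<Union>n. D n) \<and> (\<forall>n. locally_finite_in X (D n)))"

definition clopen_base_for :: "'a topology \<Rightarrow> 'a set set \<Rightarrow> bool" where
  "clopen_base_for X \<B> \<longleftrightarrow> base_for X \<B> \<and> (\<forall>B\<in>\<B>. closedin X B)"

end

theory Submission
  imports Defs
begin

text \<open>Complete ultrametrizability amounts to a sequence of successively finer partitions into open sets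
  whose members form a base, such that every decreasing sequence of members has a common point.
  Metrizable spaces of each other kind carry such a sequence as soon as they are ultraparacompact and
  the second player wins a strong Choquet game with a stationary strategy.

  Ultraparacompactness is the heart of the matter. Branch spaces have a nested base of cones over
  nodes, and the least nodes of a branch whose cones lie in a member of the cover give a partition.
  For ray spaces, follow a maximal path of nodes whose cones cannot be partitioned: at its end, a basic
  neighbourhood of a ray is the cone of a node minus finitely many cones. For end spaces, call a
  connected vertex set with finite neighbourhood bad if its ends cannot be partitioned. Were there a
  bad set, then some bad component would survive the deletion of any finite set, and a maximal
  coherent chain of bad sets would have countable coinitiality, hence carry a ray; deleting a
  finite set that isolates a good neighbourhood of its end yields a bad set below the whole chain.

  Conversely, the cells of a complete scale, ordered by level and inclusion, form the required tree.\<close>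


section \<open>Ultrametric scales\<close>

text \<open>All conditions are compared with complete ultrametrizability. A scale stores its
  partitions as a function from points to cells, so cells never have to be chosen. Moves of the game
  carry labels because the limit of a play cannot be read off from open sets alone: a label is a
  node, a node with finitely many forbidden nodes, or a region with a base vertex, and consecutive
  labels are related so that these data assemble to a branch, a ray or a graph ray. Metrizability
  serves to shrink the chosen moves until the cells form a base. In an end space no tree order
  supplies a path of bad sets to follow, and nothing obvious lies below a decreasing chain of them;
  coherence is the invariant that keeps such a chain extendable. The type of nodes is fixed in
  advance, so the tree of cells has to be coded into \<open>'n\<close>: a scale has at most
  countably many cells per point, which fit into an infinite type at least as large as the space. A
  tree has a root and hence a branch, so the empty space is no branch space; this is why two of the
  clauses speak of nonempty spaces only.\<close>

definition ultra_scale :: "'a topology \<Rightarrow> (nat \<Rightarrow> 'a \<Rightarrow> 'a set) \<Rightarrow> bool" where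
  "ultra_scale X c \<longleftrightarrow>
     (\<forall>n. \<forall>x\<in>topspace X. x \<in> c n x \<and> openin X (c n x) \<and> c (Suc n) x \<subseteq> c n x \<and>
        (\<forall>y\<in>c n x. c n y = c n x)) \<and>
     (\<forall>U x. openin X U \<and> x \<in> U \<longrightarrow> (\<exists>n. c n x \<subseteq> U))"

text \<open>A decreasing sequence of cells is given by points:
  \<open>x (Suc n) \<in> c n (x n)\<close> says that \<open>x n\<close> and \<open>x (Suc n)\<close>
  share their cell of level \<open>n\<close>, so the cells \<open>c n (x n)\<close>
  decrease.\<close>

definition complete_scale :: "'a topology \<Rightarrow> (nat \<Rightarrow> 'a \<Rightarrow> 'a set) \<Rightarrow> bool" where
  "complete_scale X c \<longleftrightarrow>
     (\<forall>x. (\<forall>n. x n \<in> topspace X \<and> x (Suc n) \<in> c n (x n)) \<longrightarrow> (\<exists>z\<in>topspace X. \<forall>n. z \<in> c n (x n)))"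

text \<open>The exponent is the first level that separates the two points. Both memberships are
  tested so that symmetry holds by definition, also off the space.\<close>

definition scale_dist :: "(nat \<Rightarrow> 'a \<Rightarrow> 'a set) \<Rightarrow> 'a \<Rightarrow> 'a \<Rightarrow> real" where
  "scale_dist c x y = (if \<forall>n. y \<in> c n x \<and> x \<in> c n y then 0
     else (1/2) ^ (LEAST n. \<not> (y \<in> c n x \<and> x \<in> c n y)))"

lemma ultra_scaleD:
  assumes "ultra_scale X c" "x \<in> topspace X"
  shows "x \<in> c n x" "openin X (c n x)" "c (Suc n) x \<subseteq> c n x" "y \<in> c n x \<Longrightarrow> c n y = c n x"
    "y \<in> c n x \<Longrightarrow> y \<in> topspace X"
  using assms openin_subset unfolding ultra_scale_def by (blast, blast, blast, blast, fast)

lemma ultra_scale_base: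
  assumes "ultra_scale X c" "openin X U" "x \<in> U"
  obtains n where "c n x \<subseteq> U"
  using assms unfolding ultra_scale_def by blast

lemma ultra_scale_mono:
  assumes "ultra_scale X c" "x \<in> topspace X" "m \<le> n"
  shows "c n x \<subseteq> c m x"
  using assms(3)
proof (induction rule: dec_induct)
  case (step n)
  then show ?case using ultra_scaleD(3)[OF assms(1,2)] by blast
qed simp

lemma ultra_scale_sym:
  assumes "ultra_scale X c" "x \<in> topspace X" "y \<in> topspace X"
  shows "y \<in> c n x \<longleftrightarrow> x \<in> c n y"
  using assms ultra_scaleD(1,4) by metis

lemma ultra_scale_nested:
  assumes "ultra_scale X c" "x \<in> topspace X" "y \<in> topspace X" "m \<le> n" "c m x \<inter> c n y \<noteq> {}"
  shows "c n y \<subseteq> c m x"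
proof -
  obtain z where z: "z \<in> c m x" "z \<in> c n y" using assms(5) by blast
  have "z \<in> topspace X" using z ultra_scaleD(5)[OF assms(1,2)] by blast
  then have "c n z \<subseteq> c m z" using ultra_scale_mono assms(1,4) by metis
  then show ?thesis using ultra_scaleD(4)[OF assms(1,2) z(1)] ultra_scaleD(4)[OF assms(1,3) z(2)] by simp
qed

text \<open>Cells decrease with the level, so \<open>y\<close> lies in \<open>c n x\<close> exactly
  for the \<open>n\<close> below the first separating level. Hence open balls of radius
  \<open>(1/2) ^ n\<close> are the cells of level \<open>n\<close>.\<close>

lemma scale_dist_less_iff:
  assumes "ultra_scale X c" "x \<in> topspace X" "y \<in> topspace X"
  shows "scale_dist c x y < (1/2) ^ n \<longleftrightarrow> y \<in> c n x"
proof (cases "\<forall>n. y \<in> c n x")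
  case True
  then show ?thesis using ultra_scale_sym[OF assms] by (simp add: scale_dist_def)
next
  case False
  define k where "k = (LEAST n. y \<notin> c n x)"
  have k: "y \<notin> c k x" using False unfolding k_def by (metis (mono_tags, lifting) LeastI_ex)
  have "y \<in> c n x \<longleftrightarrow> n < k"
    using k ultra_scale_mono[OF assms(1,2), of k n] not_less_Least[of n "\<lambda>n. y \<notin> c n x"]
    unfolding k_def[symmetric] by (meson not_le subsetD)
  then show ?thesis
    using False ultra_scale_sym[OF assms] unfolding scale_dist_def k_def by auto
qed

lemma scale_dist_cases: "scale_dist c x y = 0 \<or> (\<exists>k. scale_dist c x y = (1/2) ^ k)"
  unfolding scale_dist_def by auto

text \<open>A positive distance is some \<open>(1/2) ^ k\<close>. If both other distances were
  smaller, all three points would share a cell of level \<open>k\<close>, which makes this distance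
  smaller than itself.\<close>

lemma scale_dist_ultra:
  assumes "ultra_scale X c" "x \<in> topspace X" "y \<in> topspace X" "z \<in> topspace X"
  shows "scale_dist c x z \<le> max (scale_dist c x y) (scale_dist c y z)"
proof (rule ccontr)
  assume *: "\<not> ?thesis"
  then have lt: "scale_dist c x y < scale_dist c x z" "scale_dist c y z < scale_dist c x z" by auto
  moreover have "scale_dist c x y \<ge> 0" unfolding scale_dist_def by simp
  ultimately obtain k where k: "scale_dist c x z = (1/2) ^ k"
    using scale_dist_cases[of c x z] by auto
  then have "y \<in> c k x" "z \<in> c k y"
    using lt scale_dist_less_iff[OF assms(1)] assms by metis+
  then have "z \<in> c k x" using ultra_scaleD(4)[OF assms(1,2)] by blast
  then show False using k scale_dist_less_iff[OF assms(1,2,4)] by (metis less_irrefl)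
qed

lemma scale_metric:
  assumes c: "ultra_scale X c" and H: "Hausdorff_space X"
  shows "Metric_space (topspace X) (scale_dist c)"
proof
  fix x y assume xy: "x \<in> topspace X" "y \<in> topspace X"
  have "x = y" if "\<forall>n. y \<in> c n x"
  proof (rule ccontr)
    assume "x \<noteq> y"
    then obtain U V where "openin X U" "openin X V" "x \<in> U" "y \<in> V" "disjnt U V"
      using H xy unfolding Hausdorff_space_def by blast
    then show False using that ultra_scale_base[OF c] by (metis disjnt_iff subsetD)
  qed
  then show "scale_dist c x y = 0 \<longleftrightarrow> x = y"
    using ultra_scaleD(1)[OF c] xy by (auto simp: scale_dist_def)
next
  fix x y z assume "x \<in> topspace X" "y \<in> topspace X" "z \<in> topspace X"
  then have "scale_dist c x z \<le> max (scale_dist c x y) (scale_dist c y z)"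
    using scale_dist_ultra[OF c] by blast
  moreover have "scale_dist c x y \<ge> 0" "scale_dist c y z \<ge> 0" by (auto simp: scale_dist_def)
  ultimately show "scale_dist c x z \<le> scale_dist c x y + scale_dist c y z" by linarith
qed (auto simp: scale_dist_def conj_commute)

lemma half_power_less:
  assumes "(e::real) > 0"
  obtains n where "(1/2) ^ n < e"
  using real_arch_pow_inv[of e "1/2"] assms by auto

lemma scale_mtopology:
  assumes c: "ultra_scale X c" and H: "Hausdorff_space X"
  shows "X = Metric_space.mtopology (topspace X) (scale_dist c)"
proof -
  interpret Metric_space "topspace X" "scale_dist c" by (rule scale_metric[OF assms])
  have ball: "mball x ((1/2)^n) = c n x" if "x \<in> topspace X" for x n
    using scale_dist_less_iff[OF c that] ultra_scaleD(5)[OF c that] that by (auto simp: in_mball)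
  show ?thesis
  proof (rule topology_eq[THEN iffD2], intro allI)
    fix U
    show "openin X U \<longleftrightarrow> openin mtopology U"
    proof
      assume U: "openin X U"
      have "\<exists>r>0. mball x r \<subseteq> U" if x: "x \<in> U" for x
      proof -
        obtain n where "c n x \<subseteq> U" using ultra_scale_base[OF c U x] .
        then have "mball x ((1/2)^n) \<subseteq> U" using ball openin_subset[OF U] x by blast
        then show ?thesis by (intro exI[of _ "(1/2)^n"]) simp
      qed
      then show "openin mtopology U" using openin_subset[OF U] by (auto simp: openin_mtopology)
    next
      assume U: "openin mtopology U"
      have "\<exists>T. openin X T \<and> x \<in> T \<and> T \<subseteq> U" if x: "x \<in> U" for x
      proof -
        obtain r where r: "r > 0" "mball x r \<subseteq> U" "x \<in> topspace X"
          using U x unfolding openin_mtopology by blast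
        obtain n where "(1/2)^n < r" using half_power_less r(1) .
        then have "c n x \<subseteq> U"
          using r ball[OF r(3), of n] mball_subset_concentric[of "(1/2)^n" r x] by auto
        then show ?thesis using ultra_scaleD(1,2)[OF c r(3)] by blast
      qed
      then show "openin X U" by (subst openin_subopen) blast
    qed
  qed
qed

lemma scale_imp_metrizable:
  assumes "ultra_scale X c" "Hausdorff_space X"
  shows "metrizable_space X"
  using scale_metric[OF assms] scale_mtopology[OF assms] unfolding metrizable_space_def by blast

lemma complete_scale_imp_completely_ultrametrizable:
  assumes c: "ultra_scale X c" and H: "Hausdorff_space X" and comp: "complete_scale X c"
  shows "completely_ultrametrizable_space X"
proof -
  interpret Metric_space "topspace X" "scale_dist c" by (rule scale_metric[OF c H])
  have "\<exists>z. limitin mtopology s z sequentially" if s: "MCauchy s" for s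
  proof -
    have sX: "s i \<in> topspace X" for i using s unfolding MCauchy_def by blast
    have "\<exists>N. \<forall>i\<ge>N. \<forall>j\<ge>N. s j \<in> c n (s i)" for n
    proof -
      have "(1/2)^n > (0::real)" by simp
      then obtain N where "\<forall>i j. N \<le> i \<longrightarrow> N \<le> j \<longrightarrow> scale_dist c (s i) (s j) < (1/2)^n"
        using s unfolding MCauchy_def by blast
      then show ?thesis using scale_dist_less_iff[OF c sX sX] by blast
    qed
    then obtain N where N: "\<And>n i j. i \<ge> N n \<Longrightarrow> j \<ge> N n \<Longrightarrow> s j \<in> c n (s i)" by metis
    \<comment> \<open>The running maximum of \<open>N\<close> puts both \<open>s (k n)\<close> and
      \<open>s (k (Suc n))\<close> beyond \<open>N n\<close>, which is what completeness of the
      scale asks for.\<close>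
    define k where "k n = Max (N ` {..n})" for n
    have k: "N m \<le> k n" if "m \<le> n" for m n unfolding k_def using that by simp
    have "s (k (Suc n)) \<in> c n (s (k n))" for n using N k by simp
    then obtain z where z: "z \<in> topspace X" "\<And>n. z \<in> c n (s (k n))"
      using comp[unfolded complete_scale_def, rule_format, of "\<lambda>n. s (k n)"] sX by blast
    have "\<exists>N. \<forall>i\<ge>N. s i \<in> topspace X \<and> scale_dist c (s i) z < e" if "e > 0" for e
    proof -
      obtain n where n: "(1/2)^n < e" using half_power_less[OF \<open>e > 0\<close>] by blast
      have "scale_dist c (s i) z < e" if "i \<ge> k n" for i
      proof -
        have "s i \<in> c n (s (k n))" using N[of n "k n" i] k[of n n] that by simp
        then have "z \<in> c n (s i)" using z(2) ultra_scaleD(4)[OF c sX] by metis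
        then show ?thesis using scale_dist_less_iff[OF c sX z(1), of i n] n by simp
      qed
      then show ?thesis using sX by blast
    qed
    then show ?thesis using z(1) unfolding limit_metric_sequentially by blast
  qed
  then have "mcomplete" unfolding mcomplete_def by blast
  then show ?thesis
    unfolding completely_ultrametrizable_space_def
    using Metric_space_axioms scale_mtopology[OF c H] scale_dist_ultra[OF c] by blast
qed

lemma completely_ultrametrizable_imp_complete_scale:
  assumes "completely_ultrametrizable_space X"
  obtains c where "ultra_scale X c" "complete_scale X c" "Hausdorff_space X"
    "\<And>x. x \<in> topspace X \<Longrightarrow> c 0 x = topspace X"
proof -
  obtain M d where M: "Metric_space M d" "\<forall>x\<in>M. \<forall>y\<in>M. \<forall>z\<in>M. d x z \<le> max (d x y) (d y z)"
    "Metric_space.mcomplete M d" "X = Metric_space.mtopology M d"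
    using assms unfolding completely_ultrametrizable_space_def by blast
  interpret Metric_space M d by fact
  \<comment> \<open>Level 0 is replaced by the whole space; this cell becomes the root of the tree
    built later.\<close>
  define c where "c n x = (if n = 0 then M else mball x ((1/2)^n))" for n x
  have tX: "topspace X = M" using M(4) by simp
  have eq: "mball y r = mball x r" if "y \<in> mball x r" for x y r
  proof -
    have xy: "x \<in> M" "y \<in> M" "d x y < r" "d y x < r" using that commute by (auto simp: in_mball)
    have "d y z < r \<longleftrightarrow> d x z < r" if "z \<in> M" for z
      using M(2)[rule_format, of x y z] M(2)[rule_format, of y x z] xy that by auto
    then show ?thesis using xy by (auto simp: in_mball)
  qed
  have s: "ultra_scale X c"
    unfolding ultra_scale_def
  proof (intro conjI allI ballI impI)
    fix n x assume x: "x \<in> topspace X"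
    show "x \<in> c n x" using x by (simp add: c_def tX)
    show "openin X (c n x)" unfolding c_def M(4) by auto
    show "c (Suc n) x \<subseteq> c n x"
      unfolding c_def using mball_subset_concentric[of "(1/2)^Suc n" "(1/2)^n" x] by auto
    fix y assume "y \<in> c n x"
    then show "c n y = c n x" using eq[of y x "(1/2)^n"] by (simp add: c_def split: if_splits)
  next
    fix U x assume U: "openin X U \<and> x \<in> U"
    then obtain r where r: "r > 0" "mball x r \<subseteq> U" unfolding M(4) openin_mtopology by blast
    obtain n where n: "(1/2)^n < r" using half_power_less r(1) .
    \<comment> \<open>Passing to \<open>Suc n\<close> avoids level 0, which is not a ball.\<close>
    have "(1/2::real)^Suc n \<le> (1/2)^n" by simp
    then have "c (Suc n) x \<subseteq> U"
      using r n mball_subset_concentric[of "(1/2)^Suc n" r x] by (auto simp: c_def)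
    then show "\<exists>n. c n x \<subseteq> U" by blast
  qed
  moreover have "complete_scale X c" unfolding complete_scale_def
  proof (intro allI impI)
    fix x assume x: "\<forall>n. x n \<in> topspace X \<and> x (Suc n) \<in> c n (x n)"
    have ceq: "x j \<in> c i (x i) \<and> c i (x j) = c i (x i)" if "i \<le> j" for i j
      using that
    proof (induction rule: dec_induct)
      case base
      then show ?case using x ultra_scaleD(1)[OF s] by blast
    next
      case (step n)
      have "x (Suc n) \<in> c i (x n)" using x ultra_scale_mono[OF s _ step(1), of "x n"] by blast
      then show ?case using step.IH ultra_scaleD(4)[OF s, of "x i" "x (Suc n)" i] x by auto
    qed
    have "MCauchy x" unfolding MCauchy_def
    proof (intro conjI allI impI)
      show "range x \<subseteq> M" using x tX by blast
      fix e :: real assume "e > 0"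
      then obtain n where n: "(1/2)^n < e" using half_power_less by blast
      have "d (x i) (x j) < e" if ij: "Suc n \<le> i" "Suc n \<le> j" for i j
      proof -
        have "x j \<in> c (Suc n) (x i)" using ceq[OF ij(1)] ceq[OF ij(2)] by simp
        then have "d (x i) (x j) < (1/2)^Suc n" by (simp add: c_def in_mball)
        moreover have "(1/2::real)^Suc n \<le> (1/2)^n" by simp
        ultimately show ?thesis using n by linarith
      qed
      then show "\<exists>N. \<forall>n n'. N \<le> n \<longrightarrow> N \<le> n' \<longrightarrow> d (x n) (x n') < e" by blast
    qed
    then obtain z where z: "limitin mtopology x z sequentially" using M(3) unfolding mcomplete_def by blast
    have zX: "z \<in> topspace X" using limitin_topspace[OF z] tX by simp
    \<comment> \<open>The sequence eventually enters \<open>c n z\<close>, and from index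
      \<open>n\<close> on all its points have the same cell of level \<open>n\<close>.\<close>
    have "z \<in> c n (x n)" for n
    proof -
      have "openin mtopology (c n z)" "z \<in> c n z" using ultra_scaleD(1,2)[OF s zX] unfolding M(4) by blast+
      then have "\<forall>\<^sub>F i in sequentially. x i \<in> c n z" using z unfolding limitin_def by blast
      then obtain N where "\<forall>i\<ge>N. x i \<in> c n z" by (auto simp: eventually_sequentially)
      then have "x (max N n) \<in> c n z" by simp
      then have "z \<in> c n (x (max N n))" using ultra_scale_sym[OF s zX] x by blast
      then show ?thesis using ceq[of n "max N n"] by simp
    qed
    then show "\<exists>z\<in>topspace X. \<forall>n. z \<in> c n (x n)" using zX by blast
  qed
  moreover have "Hausdorff_space X" using Hausdorff_space_mtopology unfolding M(4) .
  moreover have "c 0 x = topspace X" for x by (simp add: c_def tX)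
  ultimately show thesis using that by blast
qed

text \<open>The definition demands equality of topologies, so invariance is obtained by pulling a
  complete scale back along the homeomorphism.\<close>

lemma homeomorphic_completely_ultrametrizable:
  assumes "X homeomorphic_space Y" "completely_ultrametrizable_space Y"
  shows "completely_ultrametrizable_space X"
proof -
  obtain c where c: "ultra_scale Y c" "complete_scale Y c" "Hausdorff_space Y"
    using completely_ultrametrizable_imp_complete_scale[OF assms(2)] by metis
  obtain f g where fg: "homeomorphic_maps X Y f g" using assms(1) unfolding homeomorphic_space_def by blast
  have f: "f x \<in> topspace Y" "g (f x) = x" if "x \<in> topspace X" for x
    using fg that unfolding homeomorphic_maps_def continuous_map_def by auto
  have g: "g y \<in> topspace X" "f (g y) = y" if "y \<in> topspace Y" for y
    using fg that unfolding homeomorphic_maps_def continuous_map_def by auto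
  define b where "b n x = {z \<in> topspace X. f z \<in> c n (f x)}" for n x
  have "ultra_scale X b"
    unfolding ultra_scale_def
  proof (intro conjI allI ballI impI)
    fix n x assume x: "x \<in> topspace X"
    note D = ultra_scaleD[OF c(1) f(1)[OF x]]
    show "x \<in> b n x" using x D(1) by (simp add: b_def)
    have "continuous_map X Y f" using fg unfolding homeomorphic_maps_def by blast
    then show "openin X (b n x)" unfolding b_def using D(2) by (rule openin_continuous_map_preimage)
    show "b (Suc n) x \<subseteq> b n x" unfolding b_def using D(3) by blast
    fix y assume "y \<in> b n x"
    then have "c n (f y) = c n (f x)" using D(4) by (auto simp: b_def)
    then show "b n y = b n x" by (simp add: b_def)
  next
    fix U x assume U: "openin X U \<and> x \<in> U"
    then have xX: "x \<in> topspace X" using openin_subset by blast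
    have "continuous_map Y X g" using fg unfolding homeomorphic_maps_def by blast
    then have "openin Y {y \<in> topspace Y. g y \<in> U}" using U openin_continuous_map_preimage by blast
    moreover have "f x \<in> {y \<in> topspace Y. g y \<in> U}" using f[OF xX] U by simp
    ultimately obtain n where n: "c n (f x) \<subseteq> {y \<in> topspace Y. g y \<in> U}"
      using ultra_scale_base[OF c(1)] by blast
    have "b n x \<subseteq> U"
    proof
      fix z assume "z \<in> b n x"
      then have "z \<in> topspace X" "g (f z) \<in> U" using n by (auto simp: b_def)
      then show "z \<in> U" using f by simp
    qed
    then show "\<exists>n. b n x \<subseteq> U" by blast
  qed
  moreover have "complete_scale X b"
    unfolding complete_scale_def
  proof (intro allI impI)
    fix x assume x: "\<forall>n. x n \<in> topspace X \<and> x (Suc n) \<in> b n (x n)"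
    then have "\<forall>n. f (x n) \<in> topspace Y \<and> f (x (Suc n)) \<in> c n (f (x n))" using f by (auto simp: b_def)
    then obtain z where "z \<in> topspace Y" "\<forall>n. z \<in> c n (f (x n))"
      using c(2)[unfolded complete_scale_def, rule_format, of "\<lambda>n. f (x n)"] by blast
    then show "\<exists>z\<in>topspace X. \<forall>n. z \<in> b n (x n)" using g by (auto simp: b_def intro!: bexI[of _ "g z"])
  qed
  moreover have "Hausdorff_space X" using assms(1) c(3) homeomorphic_Hausdorff_space by blast
  ultimately show ?thesis using complete_scale_imp_completely_ultrametrizable by blast
qed

text \<open>Take for each point its first cell that fits into a member of the cover. If two such
  cells meet, the coarser one is also a cell of the other point, so minimality of the level makes
  them equal.\<close>

lemma scale_imp_ultraparacompact:
  assumes c: "ultra_scale X c"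
  shows "ultraparacompact_space X"
  unfolding ultraparacompact_space_def
proof (intro allI impI)
  fix UU assume UU: "(\<forall>U\<in>UU. openin X U) \<and> \<Union>UU = topspace X"
  have ex: "\<exists>n. \<exists>U\<in>UU. c n x \<subseteq> U" if "x \<in> topspace X" for x
    using that UU ultra_scale_base[OF c] by (metis UnionE)
  define n where "n x = (LEAST n. \<exists>U\<in>UU. c n x \<subseteq> U)" for x
  have n: "\<exists>U\<in>UU. c (n x) x \<subseteq> U" if "x \<in> topspace X" for x
    unfolding n_def using ex[OF that] by (rule LeastI_ex)
  have n_le: "n x \<le> k" if "\<exists>U\<in>UU. c k x \<subseteq> U" for x k
    unfolding n_def using that by (rule Least_le)
  have n_eq: "c (n y) y = c (n x) x"
    if x: "x \<in> topspace X" and y: "y \<in> topspace X" and z: "z \<in> c (n x) x" "z \<in> c (n y) y" and le: "n x \<le> n y" for x y z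
  proof -
    have "c (n x) y = c (n x) x"
      using ultra_scale_mono[OF c y le] z ultra_scaleD(4)[OF c x] ultra_scaleD(4)[OF c y] by blast
    then have "n y \<le> n x" using n_le[of "n x" y] n[OF x] by simp
    then show ?thesis using le \<open>c (n x) y = c (n x) x\<close> by simp
  qed
  define PP where "PP = (\<lambda>x. c (n x) x) ` topspace X"
  have "partition_on (topspace X) PP"
    unfolding PP_def
  proof (rule partition_onI)
    show "\<Union> ((\<lambda>x. c (n x) x) ` topspace X) = topspace X"
      using ultra_scaleD(1,5)[OF c] by blast
    fix p q assume pq: "p \<in> (\<lambda>x. c (n x) x) ` topspace X" "q \<in> (\<lambda>x. c (n x) x) ` topspace X" "p \<noteq> q"
    then obtain x y where xy: "x \<in> topspace X" "y \<in> topspace X" "p = c (n x) x" "q = c (n y) y"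
      by blast
    show "disjnt p q" using n_eq[OF xy(1,2)] n_eq[OF xy(2,1)] pq(3) nle_le[of "n x" "n y"]
      unfolding xy(3,4) disjnt_iff by metis
  next
    show "{} \<notin> (\<lambda>x. c (n x) x) ` topspace X" using ultra_scaleD(1)[OF c] by blast
  qed
  moreover have "\<forall>P\<in>PP. openin X P" using ultra_scaleD(2)[OF c] by (auto simp: PP_def)
  moreover have "\<forall>P\<in>PP. \<exists>U\<in>UU. P \<subseteq> U" using n by (auto simp: PP_def)
  ultimately show "\<exists>PP. partition_on (topspace X) PP \<and> (\<forall>P\<in>PP. openin X P) \<and> (\<forall>P\<in>PP. \<exists>U\<in>UU. P \<subseteq> U)"
    by blast
qed


section \<open>Criteria for complete ultrametrizability\<close>

text \<open>\<open>g x\<close> pairs the partition cell of \<open>x\<close> with a label whose set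
  contains this cell. The label is admissible for some \<open>x0\<close>, which need not lie in the
  cell.\<close>

lemma ultraparacompact_choice:
  assumes upc: "ultraparacompact_space X"
    and ex: "\<And>x. x \<in> topspace X \<Longrightarrow> \<exists>q. Q x q \<and> x \<in> N q \<and> openin X (N q)"
  obtains g where
    "\<And>x. x \<in> topspace X \<Longrightarrow> x \<in> snd (g x) \<and> openin X (snd (g x)) \<and> snd (g x) \<subseteq> N (fst (g x)) \<and>
       (\<forall>y\<in>snd (g x). g y = g x) \<and> (\<exists>x0\<in>topspace X. Q x0 (fst (g x)))"
proof -
  define UU where "UU = {N q | x q. x \<in> topspace X \<and> Q x q \<and> openin X (N q)}"
  have "(\<forall>U\<in>UU. openin X U) \<and> \<Union>UU = topspace X"
  proof (intro conjI equalityI)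
    show "topspace X \<subseteq> \<Union>UU" using ex unfolding UU_def by blast
    show "\<Union>UU \<subseteq> topspace X" unfolding UU_def using openin_subset by blast
  qed (auto simp: UU_def)
  then obtain PP where PP: "partition_on (topspace X) PP" "\<forall>P\<in>PP. openin X P"
    "\<forall>P\<in>PP. \<exists>U\<in>UU. P \<subseteq> U"
    using upc unfolding ultraparacompact_space_def by meson
  have "\<forall>P\<in>PP. \<exists>q. P \<subseteq> N q \<and> (\<exists>x0\<in>topspace X. Q x0 q)" using PP(3) unfolding UU_def by blast
  then obtain l where l: "\<And>P. P \<in> PP \<Longrightarrow> P \<subseteq> N (l P) \<and> (\<exists>x0\<in>topspace X. Q x0 (l P))" by metis
  have ex1: "\<exists>!P. P \<in> PP \<and> x \<in> P" if "x \<in> topspace X" for x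
  proof -
    have "\<exists>P\<in>PP. x \<in> P" using that partition_onD1[OF PP(1)] by blast
    moreover have "P = P'" if "P \<in> PP" "P' \<in> PP" "x \<in> P" "x \<in> P'" for P P'
      using disjointD[OF partition_onD2[OF PP(1)] that(1,2)] that(3,4) by blast
    ultimately show ?thesis by blast
  qed
  define cell where "cell x = (THE P. P \<in> PP \<and> x \<in> P)" for x
  have cell: "cell x \<in> PP \<and> x \<in> cell x" if "x \<in> topspace X" for x
    unfolding cell_def using theI'[OF ex1[OF that]] .
  have cell_eq: "cell y = cell x" if x: "x \<in> topspace X" and y: "y \<in> cell x" for x y
  proof -
    have "y \<in> topspace X" using cell[OF x] y PP(2) openin_subset by blast
    then show ?thesis using ex1[of y] cell[of y] cell[OF x] y by blast
  qed
  show thesis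
  proof (rule that[of "\<lambda>x. (l (cell x), cell x)"])
    fix x assume x: "x \<in> topspace X"
    have "\<forall>y\<in>cell x. (l (cell y), cell y) = (l (cell x), cell x)"
      using cell_eq[OF x] by (metis (no_types))
    then show "x \<in> snd (l (cell x), cell x) \<and> openin X (snd (l (cell x), cell x)) \<and>
        snd (l (cell x), cell x) \<subseteq> N (fst (l (cell x), cell x)) \<and>
        (\<forall>y\<in>snd (l (cell x), cell x). (l (cell y), cell y) = (l (cell x), cell x)) \<and>
        (\<exists>x0\<in>topspace X. Q x0 (fst (l (cell x), cell x)))"
      unfolding fst_conv snd_conv using cell[OF x] PP(2) l by blast
  qed
qed

text \<open>A stationary winning strategy in the strong Choquet game, played with labelled open sets.\<close>

lemma ultraparacompact_labels_imp_completely_ultrametrizable: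
  fixes N :: "'l \<Rightarrow> 'a set"
  assumes met: "metrizable_space X" and upc: "ultraparacompact_space X"
    and init: "\<And>x. x \<in> topspace X \<Longrightarrow> \<exists>p\<in>L. x \<in> N p"
    and op: "\<And>p. p \<in> L \<Longrightarrow> openin X (N p)"
    and step: "\<And>p x V. \<lbrakk>p \<in> L; x \<in> N p; openin X V; x \<in> V\<rbrakk> \<Longrightarrow>
      \<exists>q\<in>L. R p q \<and> x \<in> N q \<and> N q \<subseteq> V"
    and lim: "\<And>p :: nat \<Rightarrow> 'l. (\<And>n. p n \<in> L \<and> N (p n) \<noteq> {} \<and> N (p (Suc n)) \<subseteq> N (p n) \<and> R (p n) (p (Suc n)))
      \<Longrightarrow> \<exists>z. \<forall>n. z \<in> N (p n)"
  shows "completely_ultrametrizable_space X"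
proof -
  obtain M d where M: "Metric_space M d" "X = Metric_space.mtopology M d"
    using met unfolding metrizable_space_def by blast
  interpret Metric_space M d by fact
  have tX: "topspace X = M" using M(2) by simp
  \<comment> \<open>\<open>f x\<close> is the state of the game at \<open>x\<close>: the label of
    the last move and the current cell. It is constant on cells, and the next moves depend on this
    state only.\<close>
  define good where "good f \<longleftrightarrow> (\<forall>x\<in>topspace X. fst (f x) \<in> L \<and> x \<in> snd (f x) \<and> openin X (snd (f x)) \<and>
     snd (f x) \<subseteq> N (fst (f x)) \<and> (\<forall>y\<in>snd (f x). f y = f x))" for f :: "'a \<Rightarrow> 'l \<times> 'a set"
  define finer where "finer n f f' \<longleftrightarrow> (\<forall>x\<in>topspace X. R (fst (f x)) (fst (f' x)) \<and>
     N (fst (f' x)) \<subseteq> snd (f x) \<and> (\<forall>y\<in>N (fst (f' x)). d x y < (1/2) ^ n))"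
    for n and f f' :: "'a \<Rightarrow> 'l \<times> 'a set"
  have "\<exists>f. good f"
  proof -
    have "\<exists>q. q \<in> L \<and> x \<in> N q \<and> openin X (N q)" if "x \<in> topspace X" for x
      using init[OF that] op by blast
    then obtain f where
      "\<And>x. x \<in> topspace X \<Longrightarrow> x \<in> snd (f x) \<and> openin X (snd (f x)) \<and> snd (f x) \<subseteq> N (fst (f x)) \<and>
         (\<forall>y\<in>snd (f x). f y = f x) \<and> (\<exists>x0\<in>topspace X. fst (f x) \<in> L)"
      using ultraparacompact_choice[OF upc, where N=N and Q="\<lambda>x q. q \<in> L"] by blast
    then show ?thesis unfolding good_def by blast
  qed
  moreover have "\<exists>f'. good f' \<and> finer n f f'" if f: "good f" for n f
  proof -
    \<comment> \<open>The label of a cell is chosen for a point \<open>x0\<close> other than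
      \<open>x\<close> in general. Half the radius around \<open>x0\<close> keeps distances from
      \<open>x\<close> below \<open>(1/2) ^ n\<close> by the triangle inequality.\<close>
    let ?Q = "\<lambda>x q. q \<in> L \<and> R (fst (f x)) q \<and> N q \<subseteq> snd (f x) \<inter> mball x ((1/2) ^ Suc n)"
    have "\<exists>q. ?Q x q \<and> x \<in> N q \<and> openin X (N q)" if x: "x \<in> topspace X" for x
    proof -
      have fx: "fst (f x) \<in> L" "x \<in> snd (f x)" "openin X (snd (f x))" "snd (f x) \<subseteq> N (fst (f x))"
        using f x unfolding good_def by blast+
      have "openin X (snd (f x) \<inter> mball x ((1/2) ^ Suc n))" "x \<in> snd (f x) \<inter> mball x ((1/2) ^ Suc n)"
        using fx(3) openin_mball[of x "(1/2) ^ Suc n"] fx(2) x tX unfolding M(2)[symmetric] by auto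
      then have "\<exists>q\<in>L. R (fst (f x)) q \<and> x \<in> N q \<and> N q \<subseteq> snd (f x) \<inter> mball x ((1/2) ^ Suc n)"
        using step[OF fx(1), of x] fx(2,4) by blast
      then show ?thesis using op by blast
    qed
    then obtain f' where f':
      "\<And>x. x \<in> topspace X \<Longrightarrow> x \<in> snd (f' x) \<and> openin X (snd (f' x)) \<and> snd (f' x) \<subseteq> N (fst (f' x)) \<and>
         (\<forall>y\<in>snd (f' x). f' y = f' x) \<and> (\<exists>x0\<in>topspace X. ?Q x0 (fst (f' x)))"
      using ultraparacompact_choice[OF upc, where N=N and Q="?Q"] by blast
    have "good f'" using f' unfolding good_def by blast
    moreover have "finer n f f'"
      unfolding finer_def
    proof
      fix x assume x: "x \<in> topspace X"
      obtain x0 where x0: "x0 \<in> topspace X" "?Q x0 (fst (f' x))" using f' x by blast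
      have "x \<in> N (fst (f' x))" using f' x by blast
      then have xx0: "x \<in> snd (f x0)" "x \<in> mball x0 ((1/2) ^ Suc n)" using x0(2) by auto
      \<comment> \<open>The set of the new label lies inside the old cell of \<open>x0\<close>, so
        \<open>x\<close> and \<open>x0\<close> had the same old state; thus \<open>R\<close>, known
        for the label of \<open>x0\<close>, holds for that of \<open>x\<close>.\<close>
      then have "f x = f x0" using f x0(1) unfolding good_def by blast
      moreover have "d x y < (1/2) ^ n" if "y \<in> N (fst (f' x))" for y
      proof -
        have "y \<in> mball x0 ((1/2) ^ Suc n)" using x0(2) that by auto
        then show ?thesis using xx0(2) triangle[of x x0 y] commute[of x x0] by (auto simp: in_mball)
      qed
      ultimately show "R (fst (f x)) (fst (f' x)) \<and>
         N (fst (f' x)) \<subseteq> snd (f x) \<and> (\<forall>y\<in>N (fst (f' x)). d x y < (1/2) ^ n)"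
        using x0(2) by auto
    qed
    ultimately show ?thesis by blast
  qed
  ultimately obtain F where F: "\<And>n. good (F n)" "\<And>n. finer n (F n) (F (Suc n))"
    using dependent_nat_choice[of "\<lambda>n. good" finer] by blast
  define c where "c n x = snd (F n x)" for n x
  have FL: "fst (F n x) \<in> L" "x \<in> c n x" "openin X (c n x)" "c n x \<subseteq> N (fst (F n x))"
    "y \<in> c n x \<Longrightarrow> F n y = F n x" if "x \<in> topspace X" for n x y
    using F(1)[of n] that unfolding good_def c_def by blast+
  have FF: "R (fst (F n x)) (fst (F (Suc n) x))" "N (fst (F (Suc n) x)) \<subseteq> c n x"
    "y \<in> N (fst (F (Suc n) x)) \<Longrightarrow> d x y < (1/2) ^ n" if "x \<in> topspace X" for n x y
    using F(2)[of n] that unfolding finer_def c_def by blast+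
  have "ultra_scale X c"
    unfolding ultra_scale_def
  proof (intro conjI allI ballI impI)
    fix n x assume x: "x \<in> topspace X"
    show "x \<in> c n x" "openin X (c n x)" using FL(2,3)[OF x] by blast+
    show "c (Suc n) x \<subseteq> c n x" using FL(4)[OF x] FF(2)[OF x] by blast
    show "c n y = c n x" if "y \<in> c n x" for y using FL(5)[OF x that] by (simp add: c_def)
  next
    fix U x assume U: "openin X U \<and> x \<in> U"
    then have x: "x \<in> topspace X" using openin_subset by blast
    obtain r where r: "r > 0" "mball x r \<subseteq> U" using U unfolding M(2) openin_mtopology by blast
    obtain n where n: "(1/2) ^ n < r" using half_power_less[OF r(1)] .
    have "c (Suc n) x \<subseteq> mball x r"
    proof
      fix y assume y: "y \<in> c (Suc n) x"
      then have "y \<in> M" using FL(3)[OF x] openin_subset tX by blast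
      moreover have "d x y < r" using y FL(4)[OF x] FF(3)[OF x, of y n] n by fastforce
      ultimately show "y \<in> mball x r" using x tX by (simp add: in_mball)
    qed
    then show "\<exists>n. c n x \<subseteq> U" using r(2) by blast
  qed
  moreover have "complete_scale X c"
    unfolding complete_scale_def
  proof (intro allI impI)
    fix x assume x: "\<forall>n. x n \<in> topspace X \<and> x (Suc n) \<in> c n (x n)"
    \<comment> \<open>These labels form a play: \<open>x (Suc n)\<close> has the state of
      \<open>x n\<close> at level \<open>n\<close>, so the passage from \<open>p n\<close> to
      \<open>p (Suc n)\<close> is the passage between two levels at the single point
      \<open>x (Suc n)\<close>.\<close>
    define p where "p n = fst (F n (x n))" for n
    have eq: "F n (x (Suc n)) = F n (x n)" for n using FL(5) x by blast
    have sub: "N (p (Suc n)) \<subseteq> c n (x n)" for n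
      using FF(2)[of "x (Suc n)" n] x eq[of n] by (simp add: p_def c_def)
    have "\<exists>z. \<forall>n. z \<in> N (p n)"
    proof (rule lim)
      fix n
      have "p n \<in> L" "N (p n) \<noteq> {}" "c n (x n) \<subseteq> N (p n)" using FL(1,2,4)[of "x n"] x unfolding p_def by blast+
      moreover have "R (p n) (p (Suc n))" using FF(1)[of "x (Suc n)" n] x eq[of n] by (simp add: p_def)
      ultimately show "p n \<in> L \<and> N (p n) \<noteq> {} \<and> N (p (Suc n)) \<subseteq> N (p n) \<and> R (p n) (p (Suc n))"
        using sub[of n] by blast
    qed
    then obtain z where z: "\<And>n. z \<in> N (p n)" by blast
    then have "z \<in> c n (x n)" for n using sub by blast
    moreover from this have "z \<in> topspace X" using FL(3)[of "x 0"] x openin_subset by blast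
    ultimately show "\<exists>z\<in>topspace X. \<forall>n. z \<in> c n (x n)" by blast
  qed
  ultimately show ?thesis
    using complete_scale_imp_completely_ultrametrizable metrizable_imp_Hausdorff_space[OF met] by blast
qed

lemma base_forD:
  assumes "base_for X \<B>"
  shows "B \<in> \<B> \<Longrightarrow> openin X B"
    and "openin X U \<Longrightarrow> x \<in> U \<Longrightarrow> \<exists>B\<in>\<B>. x \<in> B \<and> B \<subseteq> U"
proof -
  show "B \<in> \<B> \<Longrightarrow> openin X B" using assms unfolding base_for_def by blast
  assume "openin X U" "x \<in> U"
  then obtain \<U> where "\<U> \<subseteq> \<B>" "\<Union>\<U> = U" using assms unfolding base_for_def by blast
  then show "\<exists>B\<in>\<B>. x \<in> B \<and> B \<subseteq> U" using \<open>x \<in> U\<close> by blast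
qed

text \<open>Demanding \<open>X closure_of B' \<subseteq> B\<close> of consecutive moves, possible by
  regularity, turns the range of a play into a regular filter base.\<close>

lemma subcompact_imp_completely_ultrametrizable:
  assumes upc: "ultraparacompact_space X" and sub: "subcompact_space X" and met: "metrizable_space X"
  shows "completely_ultrametrizable_space X"
proof -
  obtain \<B> where B: "base_for X \<B>" "\<And>\<F>. \<F> \<subseteq> \<B> \<Longrightarrow> regular_filter_base X \<F> \<Longrightarrow> \<Inter>\<F> \<noteq> {}"
    using sub unfolding subcompact_space_def by blast
  show ?thesis
  proof (rule ultraparacompact_labels_imp_completely_ultrametrizable[OF met upc, where L=\<B> and N="\<lambda>B. B" and R="\<lambda>B B'. X closure_of B' \<subseteq> B"])
    show "\<exists>B\<in>\<B>. x \<in> B" if "x \<in> topspace X" for x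
      using base_forD(2)[OF B(1) openin_topspace that] by blast
    show "openin X B" if "B \<in> \<B>" for B using base_forD(1)[OF B(1) that] .
    show "\<exists>B'\<in>\<B>. X closure_of B' \<subseteq> B \<and> x \<in> B' \<and> B' \<subseteq> V"
      if "B \<in> \<B>" "x \<in> B" "openin X V" "x \<in> V" for B x V
    proof -
      have "openin X (B \<inter> V)" using that base_forD(1)[OF B(1)] by blast
      then obtain U W where UW: "openin X U" "closedin X W" "x \<in> U" "U \<subseteq> W" "W \<subseteq> B \<inter> V"
        using metrizable_imp_regular_space[OF met] \<open>x \<in> B\<close> \<open>x \<in> V\<close>
        unfolding neighbourhood_base_of_closedin[symmetric] neighbourhood_base_of by (metis IntI)
      then obtain B' where B': "B' \<in> \<B>" "x \<in> B'" "B' \<subseteq> U" using base_forD(2)[OF B(1)] by blast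
      have "X closure_of B' \<subseteq> W" using closure_of_minimal[of B' W X] B'(3) UW(2,4) by blast
      then show ?thesis using B' UW(4,5) by blast
    qed
  next
    fix p :: "nat \<Rightarrow> 'a set"
    assume p: "\<And>n. p n \<in> \<B> \<and> p n \<noteq> {} \<and> p (Suc n) \<subseteq> p n \<and> X closure_of p (Suc n) \<subseteq> p n"
    have mono: "p n \<subseteq> p m" if "m \<le> n" for m n using that p by (induction rule: dec_induct) blast+
    have "regular_filter_base X (range p)"
      unfolding regular_filter_base_def
    proof (intro conjI ballI)
      show "{} \<notin> range p" using p by (metis imageE)
      fix F1 F2 assume "F1 \<in> range p" "F2 \<in> range p"
      then obtain i j where "F1 = p i" "F2 = p j" by blast
      then have "X closure_of p (Suc (max i j)) \<subseteq> F1 \<inter> F2"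
        using p mono[of i "max i j"] mono[of j "max i j"] by fastforce
      then show "\<exists>F3\<in>range p. X closure_of F3 \<subseteq> F1 \<inter> F2" by blast
    qed simp
    moreover have "range p \<subseteq> \<B>" using p by (simp add: image_subset_iff)
    ultimately have "\<Inter>(range p) \<noteq> {}" using B(2) by simp
    then show "\<exists>z. \<forall>n. z \<in> p n" by auto
  qed
qed

text \<open>Cells of level \<open>n\<close> collect the points that no member of the first
  \<open>n + 1\<close> families separates. They are open: near a point only finitely many members of
  a family matter, and each of these is clopen.\<close>

lemma sigma_locally_finite_imp_scale:
  assumes base: "clopen_base_for X \<B>" and slf: "sigma_locally_finite_family X \<B>"
  obtains c where "ultra_scale X c"
proof -
  obtain D :: "nat \<Rightarrow> 'a set set" where D: "\<B> = (\<Union>n. D n)" "\<And>n. locally_finite_in X (D n)"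
    using slf unfolding sigma_locally_finite_family_def by blast
  define cl where "cl i x = {y \<in> topspace X. \<forall>B\<in>D i. x \<in> B \<longleftrightarrow> y \<in> B}" for i x
  define c where "c n x = (\<Inter>i\<in>{..n}. cl i x)" for n x
  have clo: "openin X B" "openin X (topspace X - B)" if "B \<in> D i" for B i
  proof -
    have "B \<in> \<B>" unfolding D(1) using that by (rule UN_I[OF UNIV_I])
    then show "openin X B" "openin X (topspace X - B)"
      using base unfolding clopen_base_for_def base_for_def closedin_def by simp_all
  qed
  have "openin X (cl i x)" for i x
  proof (subst openin_subopen, intro ballI)
    fix y assume y: "y \<in> cl i x"
    then obtain V where V: "openin X V" "y \<in> V" "finite {B \<in> D i. B \<inter> V \<noteq> {}}"
      using D(2)[of i] unfolding locally_finite_in_def cl_def by blast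
    define T where "T = V \<inter> topspace X \<inter> (\<Inter>B\<in>{B \<in> D i. B \<inter> V \<noteq> {}}. if y \<in> B then B else topspace X - B)"
    have "openin X (topspace X \<inter> (\<Inter>B\<in>{B \<in> D i. B \<inter> V \<noteq> {}}. if y \<in> B then B else topspace X - B))"
      using V(3) clo by (intro openin_Int_Inter) auto
    then have "openin X T" unfolding T_def Int_assoc by (rule openin_Int[OF V(1)])
    moreover have "y \<in> T" using y V(2) unfolding T_def cl_def by auto
    moreover have "T \<subseteq> cl i x"
    proof
      fix z assume z: "z \<in> T"
      have "x \<in> B \<longleftrightarrow> z \<in> B" if B: "B \<in> D i" for B
      proof -
        have "y \<in> B \<longleftrightarrow> z \<in> B"
        proof (cases "B \<inter> V = {}")
          case True
          then show ?thesis using z V(2) unfolding T_def by blast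
        next
          case False
          then have "z \<in> (if y \<in> B then B else topspace X - B)" using z B unfolding T_def by blast
          then show ?thesis by (auto split: if_splits)
        qed
        then show ?thesis using y B unfolding cl_def by blast
      qed
      then show "z \<in> cl i x" using z unfolding cl_def T_def by blast
    qed
    ultimately show "\<exists>T. openin X T \<and> y \<in> T \<and> T \<subseteq> cl i x" by blast
  qed
  then have op: "openin X (c n x)" for n x unfolding c_def by (intro openin_INT2) auto
  have "ultra_scale X c"
    unfolding ultra_scale_def
  proof (intro conjI allI ballI impI)
    fix n x assume x: "x \<in> topspace X"
    show "x \<in> c n x" using x by (simp add: c_def cl_def)
    show "c (Suc n) x \<subseteq> c n x" unfolding c_def by (intro INF_superset_mono) auto
    show "c n y = c n x" if "y \<in> c n x" for y using that unfolding c_def cl_def by simp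
  next
    fix U x assume "openin X U \<and> x \<in> U"
    then obtain B where B: "B \<in> \<B>" "x \<in> B" "B \<subseteq> U"
      using base base_forD(2) unfolding clopen_base_for_def by metis
    then obtain n where "B \<in> D n" using D(1) by blast
    then have "c n x \<subseteq> B" using B(2) unfolding c_def cl_def by blast
    then show "\<exists>n. c n x \<subseteq> U" using B(3) by blast
  qed (rule op)
  then show thesis using that by blast
qed

lemma sigma_locally_finite_imp_completely_ultrametrizable:
  assumes H: "Hausdorff_space X"
    and base: "clopen_base_for X \<B>" and comp: "complete_family \<B>" and slf: "sigma_locally_finite_family X \<B>"
  shows "completely_ultrametrizable_space X"
proof -
  obtain c where c: "ultra_scale X c" using sigma_locally_finite_imp_scale[OF base slf] .
  have B: "base_for X \<B>" using base unfolding clopen_base_for_def by blast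
  show ?thesis
  proof (rule ultraparacompact_labels_imp_completely_ultrametrizable[OF scale_imp_metrizable[OF c H] scale_imp_ultraparacompact[OF c],
        where L=\<B> and N="\<lambda>B. B" and R="\<lambda>B B'. True"])
    show "\<exists>B\<in>\<B>. x \<in> B" if "x \<in> topspace X" for x
      using base_forD(2)[OF B openin_topspace that] by blast
    show "openin X B" if "B \<in> \<B>" for B using base_forD(1)[OF B that] .
    show "\<exists>B'\<in>\<B>. True \<and> x \<in> B' \<and> B' \<subseteq> V"
      if "B \<in> \<B>" "x \<in> B" "openin X V" "x \<in> V" for B x V
      using base_forD(2)[OF B that(3,4)] by simp
  next
    fix p :: "nat \<Rightarrow> 'a set"
    assume p: "\<And>n. p n \<in> \<B> \<and> p n \<noteq> {} \<and> p (Suc n) \<subseteq> p n \<and> True"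
    have mono: "p n \<subseteq> p m" if "m \<le> n" for m n using that p by (induction rule: dec_induct) blast+
    have "centered_family (range p)"
      unfolding centered_family_def
    proof (intro allI impI)
      fix \<F> assume F: "\<F> \<subseteq> range p" "finite \<F>"
      then obtain I where I: "finite I" "\<F> = p ` I" by (meson finite_subset_image)
      \<comment> \<open>Inserting 0 gives \<open>Max\<close> a nonempty argument when the subfamily
        is empty.\<close>
      have "p (Max (insert 0 I)) \<subseteq> p i" if "i \<in> I" for i using mono I(1) that by simp
      then have "p (Max (insert 0 I)) \<subseteq> \<Inter>\<F>" unfolding I(2) by blast
      then show "\<Inter>\<F> \<noteq> {}" using p by blast
    qed
    then have "\<Inter>(range p) \<noteq> {}" using comp p unfolding complete_family_def by blast
    then show "\<exists>z. \<forall>n. z \<in> p n" by blast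
  qed
qed

text \<open>For \<open>x\<close> outside of \<open>B\<close> and \<open>y\<close> in
  \<open>B\<close>, a base set around \<open>x\<close> that misses \<open>y\<close> neither contains
  \<open>B\<close> nor lies in it, so nestedness makes it disjoint from \<open>B\<close>.\<close>

lemma nested_base_closed:
  assumes H: "Hausdorff_space X" and base: "base_for X \<B>" and nest: "nested_family \<B>" and B: "B \<in> \<B>"
  shows "closedin X B"
proof -
  have BX: "B \<subseteq> topspace X" using base_forD(1)[OF base B] openin_subset by blast
  have "\<exists>T. openin X T \<and> x \<in> T \<and> T \<subseteq> topspace X - B" if x: "x \<in> topspace X - B" for x
  proof (cases "B = {}")
    case False
    then obtain y where y: "y \<in> B" by blast
    then obtain U where U: "openin X U" "x \<in> U" "y \<notin> U"
      using H x BX unfolding Hausdorff_space_def by (metis Diff_iff disjnt_iff subsetD)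
    then obtain B' where B': "B' \<in> \<B>" "x \<in> B'" "B' \<subseteq> U" using base_forD(2)[OF base] by blast
    then have "B' \<inter> B = {}" using nest B x y U(3) unfolding nested_family_def by blast
    moreover have "openin X B'" using base_forD(1)[OF base B'(1)] .
    moreover have "B' \<subseteq> topspace X - B" using calculation openin_subset by blast
    ultimately show ?thesis using B'(2) by blast
  next
    case True
    then show ?thesis using x by blast
  qed
  then have "openin X (topspace X - B)" using openin_subopen by blast
  then show ?thesis using BX unfolding closedin_def by blast
qed

lemma sigma_discrete_imp_sigma_locally_finite:
  assumes "base_for X \<B>" and "sigma_discrete_family X \<B>"
  shows "sigma_locally_finite_family X \<B>"
proof -
  obtain D :: "nat \<Rightarrow> 'a set set" where D: "\<B> = (\<Union>n. D n)" "\<And>n. discrete_family X (D n)"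
    using assms(2) unfolding sigma_discrete_family_def by blast
  have "locally_finite_in X (D n)" for n
    unfolding locally_finite_in_def
  proof (intro conjI ballI)
    show "\<Union> (D n) \<subseteq> topspace X"
    proof (rule Sup_least)
      fix B assume "B \<in> D n"
      then have "B \<in> \<B>" unfolding D(1) by (rule UN_I[OF UNIV_I])
      then show "B \<subseteq> topspace X" using base_forD(1)[OF assms(1)] openin_subset by metis
    qed
    fix x assume x: "x \<in> topspace X"
    obtain U where U: "openin X U" "x \<in> U" "\<forall>A\<in>D n. \<forall>B\<in>D n. A \<inter> U \<noteq> {} \<and> B \<inter> U \<noteq> {} \<longrightarrow> A = B"
      using bspec[OF D(2)[of n, unfolded discrete_family_def] x] by metis
    have "finite {A \<in> D n. A \<inter> U \<noteq> {}}"
    proof (cases "{A \<in> D n. A \<inter> U \<noteq> {}} = {}")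
      case False
      then obtain A where "A \<in> D n" "A \<inter> U \<noteq> {}" by blast
      then have "{A \<in> D n. A \<inter> U \<noteq> {}} \<subseteq> {A}" using U(3) by blast
      then show ?thesis by (rule finite_subset) simp
    next
      case True
      then show ?thesis by (simp only: finite.emptyI)
    qed
    then show "\<exists>V. openin X V \<and> x \<in> V \<and> finite {A \<in> D n. A \<inter> V \<noteq> {}}" using U(1,2) by blast
  qed
  then show ?thesis using D(1) unfolding sigma_locally_finite_family_def by blast
qed

lemma nested_complete_imp_completely_ultrametrizable:
  assumes "Hausdorff_space X" "base_for X \<B>" "nested_family \<B>" "complete_family \<B>" "sigma_discrete_family X \<B>"
  shows "completely_ultrametrizable_space X"
proof (rule sigma_locally_finite_imp_completely_ultrametrizable[OF assms(1) _ assms(4)])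
  show "clopen_base_for X \<B>"
    using nested_base_closed[OF assms(1-3)] assms(2) unfolding clopen_base_for_def by metis
qed (rule sigma_discrete_imp_sigma_locally_finite[OF assms(2,5)])

section \<open>The cells of a scale as a base\<close>

definition cells :: "'a topology \<Rightarrow> (nat \<Rightarrow> 'a \<Rightarrow> 'a set) \<Rightarrow> 'a set set" where
  "cells X c = {c n x | n x. x \<in> topspace X}"

lemma cells_base:
  assumes "ultra_scale X c"
  shows "base_for X (cells X c)"
  unfolding base_for_def
proof (intro conjI allI impI)
  show "\<forall>B\<in>cells X c. openin X B" using ultra_scaleD(2)[OF assms] by (auto simp: cells_def)
  fix U assume U: "openin X U"
  have "x \<in> \<Union>{B \<in> cells X c. B \<subseteq> U}" if "x \<in> U" for x
  proof -
    have "x \<in> topspace X" using that U openin_subset by blast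
    obtain n where "c n x \<subseteq> U" using ultra_scale_base[OF assms U \<open>x \<in> U\<close>] .
    moreover have "x \<in> c n x" using ultra_scaleD(1)[OF assms \<open>x \<in> topspace X\<close>] .
    moreover have "c n x \<in> cells X c" using \<open>x \<in> topspace X\<close> unfolding cells_def by blast
    ultimately show ?thesis by blast
  qed
  then have "\<Union>{B \<in> cells X c. B \<subseteq> U} = U" by blast
  then show "\<exists>\<U>\<subseteq>cells X c. \<Union>\<U> = U" by (intro exI[of _ "{B \<in> cells X c. B \<subseteq> U}"]) blast
qed

lemma cells_nested:
  assumes "ultra_scale X c"
  shows "nested_family (cells X c)"
  unfolding nested_family_def cells_def
  using ultra_scale_nested[OF assms] by (smt (verit) Int_commute linear mem_Collect_eq)

text \<open>A cell that contains \<open>c k x\<close> is among \<open>c 0 x, ..., c k x\<close>, so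
  an increasing sequence of cells has a finite range.\<close>

lemma cells_noetherian:
  assumes c: "ultra_scale X c"
  shows "noetherian_family (cells X c)"
  unfolding noetherian_family_def
proof (intro allI impI)
  fix A :: "nat \<Rightarrow> 'a set" assume A: "range A \<subseteq> cells X c \<and> incseq A"
  then obtain k x where x: "x \<in> topspace X" "A 0 = c k x" unfolding cells_def by blast
  have "A n \<in> (\<lambda>j. c j x) ` {..k}" for n
  proof -
    obtain j y where y: "y \<in> topspace X" "A n = c j y" using A unfolding cells_def by blast
    have "A 0 \<subseteq> A n" using A incseqD by blast
    then have xn: "x \<in> c j y" using ultra_scaleD(1)[OF c x(1), of k] x y by auto
    then have eq: "A n = c j x" using ultra_scaleD(4)[OF c y(1)] y(2) by simp
    show ?thesis
    proof (cases "j \<le> k")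
      case False
      then have "c j x \<subseteq> c k x" using ultra_scale_mono[OF c x(1)] by simp
      then have "A n = c k x" using \<open>A 0 \<subseteq> A n\<close> eq x(2) by blast
      then show ?thesis by blast
    qed (use eq in blast)
  qed
  then have "finite (range A)" by (meson finite_atMost finite_imageI finite_subset image_subset_iff)
  then obtain N where N: "\<And>n. A n \<subseteq> A N"
  proof -
    assume *: "\<And>N. (\<And>n. A n \<subseteq> A N) \<Longrightarrow> thesis"
    obtain I where I: "finite I" "range A = A ` I"
      using \<open>finite (range A)\<close> finite_subset_image[of "range A" A UNIV] by blast
    have "A n \<subseteq> A (Max (insert 0 I))" for n
    proof -
      obtain i where "i \<in> I" "A n = A i" using I(2) by (metis image_iff rangeI)
      then show ?thesis using A I(1) incseqD[of A i "Max (insert 0 I)"] by simp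
    qed
    then show thesis by (rule *)
  qed
  then show "\<exists>N. \<forall>n\<ge>N. A n = A N" using A by (metis incseqD subset_antisym)
qed

lemma cells_complete:
  assumes c: "ultra_scale X c" and comp: "complete_scale X c"
  shows "complete_family (cells X c)"
  unfolding complete_family_def
proof (intro allI impI)
  fix \<C> assume C: "\<C> \<subseteq> cells X c" "centered_family \<C>"
  show "\<Inter>\<C> \<noteq> {}"
  proof (cases "finite \<C>")
    case True
    then show ?thesis using C(2) unfolding centered_family_def by blast
  next
    case False
    have meet: "\<exists>z. z \<in> A \<and> z \<in> B" if "A \<in> \<C>" "B \<in> \<C>" for A B
    proof -
      have "\<Inter>{A, B} \<noteq> {}" using C(2)[unfolded centered_family_def, rule_format, of "{A, B}"] that by simp
      then show ?thesis by auto
    qed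
    \<comment> \<open>Distinct cells of one level are disjoint, so pairwise meeting cells are
      determined by their level. Bounded levels would make the family finite.\<close>
    have "\<exists>m x. m \<ge> n \<and> x \<in> topspace X \<and> c m x \<in> \<C>" for n
    proof (rule ccontr)
      assume *: "\<not> ?thesis"
      obtain A0 where A0: "A0 \<in> \<C>" using False by (metis finite.emptyI ex_in_conv)
      have "\<exists>j<n. \<exists>x\<in>topspace X. A = c j x" if "A \<in> \<C>" for A
        using C(1) that * unfolding cells_def by (smt (verit) mem_Collect_eq not_le subsetD)
      then obtain j where j: "\<And>A. A \<in> \<C> \<Longrightarrow> j A < n \<and> (\<exists>x\<in>topspace X. A = c (j A) x)" by metis
      have "inj_on j \<C>"
      proof
        fix A B assume AB: "A \<in> \<C>" "B \<in> \<C>" "j A = j B"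
        obtain z where z: "z \<in> A" "z \<in> B" using meet[OF AB(1,2)] by blast
        obtain x y where xy: "x \<in> topspace X" "A = c (j A) x" "y \<in> topspace X" "B = c (j A) y"
          using conjunct2[OF j[OF AB(1)]] conjunct2[OF j[OF AB(2)]] unfolding AB(3) by blast
        then show "A = B" using ultra_scaleD(4)[OF c xy(1), of z "j A"] ultra_scaleD(4)[OF c xy(3), of z "j A"] z by simp
      qed
      moreover have "j ` \<C> \<subseteq> {..<n}" using j by auto
      ultimately show False using False by (meson finite_imageD finite_lessThan finite_subset)
    qed
    then obtain m x where mx: "\<And>n. m n \<ge> n \<and> x n \<in> topspace X \<and> c (m n) (x n) \<in> \<C>" by metis
    \<comment> \<open>A member of the family meets \<open>c (m n) (x n)\<close>, which lies in
      \<open>c n (x n)\<close>. So its only possible cell of level \<open>n\<close> is that of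
      \<open>x n\<close>, and a point common to these cells is common to the family.\<close>
    have same: "y \<in> c n (x n)" if "B \<in> \<C>" "B = c n y" "y \<in> topspace X" for B n y
    proof -
      obtain z where z: "z \<in> c (m n) (x n)" "z \<in> c n y" using meet[of "c (m n) (x n)" B] mx[of n] \<open>B \<in> \<C>\<close> \<open>B = c n y\<close> by blast
      then have "z \<in> c n (x n)" using ultra_scale_mono[OF c, of "x n" n "m n"] mx by blast
      then show ?thesis using z(2) ultra_scaleD(1,4)[OF c] that(3) mx by metis
    qed
    have "x (Suc n) \<in> c n (x n)" for n
    proof -
      obtain z where z: "z \<in> c (m n) (x n)" "z \<in> c (m (Suc n)) (x (Suc n))"
        using meet mx by meson
      then have "z \<in> c n (x n)" "z \<in> c n (x (Suc n))"
        using ultra_scale_mono[OF c, of "x n" n "m n"] ultra_scale_mono[OF c, of "x (Suc n)" n "m (Suc n)"]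
          mx[of n] mx[of "Suc n"] by auto
      then show ?thesis using ultra_scaleD(1,4)[OF c] mx by metis
    qed
    then obtain z where z: "\<And>n. z \<in> c n (x n)" "z \<in> topspace X"
      using comp[unfolded complete_scale_def, rule_format, of x] mx by blast
    have "z \<in> A" if A: "A \<in> \<C>" for A
    proof -
      obtain n y where y: "A = c n y" "y \<in> topspace X" using C(1) A unfolding cells_def by blast
      then have "c n y = c n (x n)" using same[OF A] ultra_scaleD(4)[OF c] mx by metis
      then show ?thesis using z(1) y(1) by simp
    qed
    then show ?thesis by blast
  qed
qed

lemma cells_sigma_discrete:
  assumes c: "ultra_scale X c"
  shows "sigma_discrete_family X (cells X c)"
  unfolding sigma_discrete_family_def
proof (intro exI[of _ "\<lambda>n. c n ` topspace X"] conjI allI)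
  show "cells X c = (\<Union>n. c n ` topspace X)" unfolding cells_def by blast
  fix n
  have "A = c n x" if "x \<in> topspace X" "A \<in> c n ` topspace X" "A \<inter> c n x \<noteq> {}" for A x
    using that ultra_scaleD(4)[OF c] by (metis disjoint_iff imageE)
  then show "discrete_family X (c n ` topspace X)"
    unfolding discrete_family_def using ultra_scaleD(1,2)[OF c] by metis
qed

text \<open>Iterating the defining property puts a member of the regular filter base, which is
  nonempty, inside any finite intersection; so the filter base is centered.\<close>

lemma complete_base_imp_subcompact:
  assumes "base_for X \<B>" "complete_family \<B>"
  shows "subcompact_space X"
  unfolding subcompact_space_def
proof (intro exI[of _ \<B>] conjI allI impI)
  fix \<F> assume F: "\<F> \<subseteq> \<B>" "regular_filter_base X \<F>"
  have "\<exists>B\<in>\<F>. B \<subseteq> \<Inter>\<G>" if "finite \<G>" "\<G> \<subseteq> \<F>" for \<G>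
    using that
  proof (induction rule: finite_induct)
    case empty
    then show ?case using F(2) unfolding regular_filter_base_def by blast
  next
    case (insert A \<G>)
    then obtain B where B: "B \<in> \<F>" "B \<subseteq> \<Inter>\<G>" by blast
    then obtain F3 where F3: "F3 \<in> \<F>" "X closure_of F3 \<subseteq> A \<inter> B"
      using F(2) insert unfolding regular_filter_base_def by blast
    have "F3 \<subseteq> topspace X" using F3 F(1) base_forD(1)[OF assms(1)] openin_subset by blast
    then have "F3 \<subseteq> A \<inter> B" using F3(2) closure_of_subset by blast
    then show ?case using F3(1) B(2) by (intro bexI[of _ F3]) auto
  qed
  then have "centered_family \<F>"
    unfolding centered_family_def using F(2) unfolding regular_filter_base_def by (metis subset_empty)
  then show "\<Inter>\<F> \<noteq> {}" using assms(2) F(1) unfolding complete_family_def by blast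
qed (rule assms)

lemma completely_ultrametrizable_imp_metrizable:
  assumes "completely_ultrametrizable_space X"
  shows "metrizable_space X"
  using assms unfolding completely_ultrametrizable_space_def metrizable_space_def by blast


section \<open>Spaces of sets and order trees\<close>

lemma homeomorphic_space_openness:
  assumes bij: "bij_betw f (topspace X) (topspace Y)"
    and op: "\<And>W. W \<subseteq> topspace X \<Longrightarrow> openin X W \<longleftrightarrow> openin Y (f ` W)"
  shows "X homeomorphic_space Y"
proof -
  have inj: "inj_on f (topspace X)" and img: "f ` topspace X = topspace Y"
    using bij unfolding bij_betw_def by auto
  have "quotient_map X Y f"
    unfolding quotient_map_def
  proof (intro conjI allI impI)
    fix U assume U: "U \<subseteq> topspace Y"
    have "f ` {x \<in> topspace X. f x \<in> U} = U" using U unfolding img[symmetric] by blast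
    then show "openin X {x \<in> topspace X. f x \<in> U} = openin Y U"
      using op[of "{x \<in> topspace X. f x \<in> U}"] by simp
  qed (rule img)
  then have "homeomorphic_map X Y f" using inj unfolding homeomorphic_map_def by blast
  then show ?thesis using homeomorphic_map_imp_homeomorphic_space by blast
qed

text \<open>The basic open sets of the cube, read on sets instead of characteristic functions:
  finitely many elements are prescribed and finitely many are forbidden. This frees the later
  arguments from extensional functions.\<close>

definition set_nbhd :: "'n set set \<Rightarrow> 'n set \<Rightarrow> 'n set \<Rightarrow> 'n set set" where
  "set_nbhd PP A F = {Q \<in> PP. A \<subseteq> Q \<and> F \<inter> Q = {}}"

definition set_space :: "'n set set \<Rightarrow> 'n set topology" where
  "set_space PP = topology (\<lambda>W. W \<subseteq> PP \<and>
     (\<forall>P\<in>W. \<exists>A F. finite A \<and> finite F \<and> P \<in> set_nbhd PP A F \<and> set_nbhd PP A F \<subseteq> W))"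

lemma openin_set_space:
  "openin (set_space PP) W \<longleftrightarrow> W \<subseteq> PP \<and>
     (\<forall>P\<in>W. \<exists>A F. finite A \<and> finite F \<and> P \<in> set_nbhd PP A F \<and> set_nbhd PP A F \<subseteq> W)"
proof -
  have "istopology (\<lambda>W. W \<subseteq> PP \<and>
     (\<forall>P\<in>W. \<exists>A F. finite A \<and> finite F \<and> P \<in> set_nbhd PP A F \<and> set_nbhd PP A F \<subseteq> W))"
    unfolding istopology_def
  proof (intro conjI allI impI ballI)
    fix S T P
    assume S: "S \<subseteq> PP \<and> (\<forall>P\<in>S. \<exists>A F. finite A \<and> finite F \<and> P \<in> set_nbhd PP A F \<and> set_nbhd PP A F \<subseteq> S)"
      and T: "T \<subseteq> PP \<and> (\<forall>P\<in>T. \<exists>A F. finite A \<and> finite F \<and> P \<in> set_nbhd PP A F \<and> set_nbhd PP A F \<subseteq> T)"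
    show "S \<inter> T \<subseteq> PP" using S by blast
    assume P: "P \<in> S \<inter> T"
    obtain A F where 1: "finite A" "finite F" "P \<in> set_nbhd PP A F" "set_nbhd PP A F \<subseteq> S"
      using S P by blast
    obtain A' F' where 2: "finite A'" "finite F'" "P \<in> set_nbhd PP A' F'" "set_nbhd PP A' F' \<subseteq> T"
      using T P by blast
    have "set_nbhd PP (A \<union> A') (F \<union> F') = set_nbhd PP A F \<inter> set_nbhd PP A' F'"
      unfolding set_nbhd_def by blast
    then show "\<exists>A F. finite A \<and> finite F \<and> P \<in> set_nbhd PP A F \<and> set_nbhd PP A F \<subseteq> S \<inter> T"
      using 1 2 by (intro exI[of _ "A \<union> A'"] exI[of _ "F \<union> F'"]) auto
  next
    fix K
    assume K: "\<forall>W\<in>K. W \<subseteq> PP \<and> (\<forall>P\<in>W. \<exists>A F. finite A \<and> finite F \<and> P \<in> set_nbhd PP A F \<and> set_nbhd PP A F \<subseteq> W)"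
    show "\<Union>K \<subseteq> PP" using K by blast
    fix P assume "P \<in> \<Union>K"
    then obtain W where "W \<in> K" "P \<in> W" by blast
    then show "\<exists>A F. finite A \<and> finite F \<and> P \<in> set_nbhd PP A F \<and> set_nbhd PP A F \<subseteq> \<Union>K"
      using K by (meson Sup_upper order_trans)
  qed
  then show ?thesis unfolding set_space_def by (simp add: topology_inverse')
qed

lemma topspace_set_space [simp]: "topspace (set_space PP) = PP"
proof
  show "topspace (set_space PP) \<subseteq> PP" using openin_set_space openin_topspace by metis
  have "openin (set_space PP) PP"
    unfolding openin_set_space
    by (intro conjI ballI exI[of _ "{}"]) (auto simp: set_nbhd_def)
  then show "PP \<subseteq> topspace (set_space PP)" by (rule openin_subset)
qed

lemma openin_set_nbhd:
  assumes "finite A" "finite F"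
  shows "openin (set_space PP) (set_nbhd PP A F)"
  unfolding openin_set_space using assms by (auto simp: set_nbhd_def)

lemma char_fun_subspace_homeomorphic:
  assumes PP: "\<Union>PP \<subseteq> T"
  shows "subtopology (cantor_cube T) (char_fun T ` PP) homeomorphic_space set_space PP"
proof -
  let ?C = "cantor_cube T"
  have top: "char_fun T P \<in> topspace ?C" for P
    by (simp add: cantor_cube_def char_fun_def)
  have tsub: "topspace (subtopology ?C (char_fun T ` PP)) = char_fun T ` PP" using top by auto
  have app: "char_fun T P t \<longleftrightarrow> t \<in> P" if "t \<in> T" for P t using that by (simp add: char_fun_def)
  have inj: "P = Q" if "P \<in> PP" "Q \<in> PP" "char_fun T P = char_fun T Q" for P Q
  proof -
    have "t \<in> P \<longleftrightarrow> t \<in> Q" for t using PP that app[of t P] app[of t Q] by (cases "t \<in> T") auto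
    then show ?thesis by blast
  qed
  have "set_space PP homeomorphic_space subtopology ?C (char_fun T ` PP)"
  proof (rule homeomorphic_space_openness[of "char_fun T"])
    show "bij_betw (char_fun T) (topspace (set_space PP)) (topspace (subtopology ?C (char_fun T ` PP)))"
      unfolding tsub bij_betw_def using inj by (simp add: inj_on_def)
    fix W assume "W \<subseteq> topspace (set_space PP)"
    then have W: "W \<subseteq> PP" by simp
    show "openin (set_space PP) W \<longleftrightarrow> openin (subtopology ?C (char_fun T ` PP)) (char_fun T ` W)"
    proof
      assume op: "openin (set_space PP) W"
      have "\<exists>V. openin (subtopology ?C (char_fun T ` PP)) V \<and> f \<in> V \<and> V \<subseteq> char_fun T ` W"
        if f: "f \<in> char_fun T ` W" for f
      proof -
        obtain P where P: "P \<in> W" "f = char_fun T P" using f by blast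
        then obtain A F where AF: "finite A" "finite F" "P \<in> set_nbhd PP A F" "set_nbhd PP A F \<subseteq> W"
          using op unfolding openin_set_space by blast
        define U where "U t = (if t \<in> A then {True} else if t \<in> F then {False} else UNIV)" for t
        define V where "V = (\<Pi>\<^sub>E t\<in>T. U t)"
        have "{t \<in> T. U t \<noteq> UNIV} \<subseteq> A \<union> F"
          by (auto simp: U_def)
        then have "finite {t \<in> T. U t \<noteq> UNIV}" using AF(1,2) finite_subset finite_UnI by metis
        then have "openin ?C V" unfolding V_def cantor_cube_def openin_PiE_gen by simp
        moreover have "f \<in> V" using AF(3) P PP unfolding V_def U_def char_fun_def set_nbhd_def by auto
        moreover have "V \<inter> char_fun T ` PP \<subseteq> char_fun T ` W"
        proof
          fix g assume g: "g \<in> V \<inter> char_fun T ` PP"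
          then obtain Q where Q: "Q \<in> PP" "g = char_fun T Q" by blast
          have v: "g t \<in> (if t \<in> A then {True} else if t \<in> F then {False} else UNIV)" if "t \<in> T" for t
            using g that unfolding V_def U_def by blast
          have "A \<subseteq> T" "A \<inter> F = {}" using AF(3) PP unfolding set_nbhd_def by auto
          then have "A \<subseteq> Q" using v app[of _ Q] Q(2) by fastforce
          moreover have "F \<inter> Q = {}"
          proof (rule ccontr)
            assume "F \<inter> Q \<noteq> {}"
            then obtain t where t: "t \<in> F" "t \<in> Q" by blast
            then have "t \<in> T" "t \<notin> A" using Q(1) PP \<open>A \<inter> F = {}\<close> by blast+
            then show False using v[of t] app[of t Q] Q(2) t by auto
          qed
          ultimately have "Q \<in> W" using AF(4) Q(1) unfolding set_nbhd_def by blast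
          then show "g \<in> char_fun T ` W" using Q(2) by blast
        qed
        ultimately show ?thesis
          using f W by (intro exI[of _ "V \<inter> char_fun T ` PP"]) (auto simp: openin_subtopology)
      qed
      then show "openin (subtopology ?C (char_fun T ` PP)) (char_fun T ` W)"
        by (subst openin_subopen) blast
    next
      assume "openin (subtopology ?C (char_fun T ` PP)) (char_fun T ` W)"
      then obtain V where V: "openin ?C V" "char_fun T ` W = V \<inter> char_fun T ` PP"
        unfolding openin_subtopology by blast
      have "\<exists>A F. finite A \<and> finite F \<and> P \<in> set_nbhd PP A F \<and> set_nbhd PP A F \<subseteq> W" if P: "P \<in> W" for P
      proof -
        have PV: "char_fun T P \<in> V" using V(2) P by blast
        have "\<forall>x\<in>V. \<exists>U. finite {i \<in> T. U i \<noteq> topspace (discrete_topology (UNIV :: bool set))} \<and>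
            (\<forall>i\<in>T. openin (discrete_topology UNIV) (U i)) \<and> x \<in> Pi\<^sub>E T U \<and> Pi\<^sub>E T U \<subseteq> V"
          using V(1) unfolding cantor_cube_def openin_product_topology_alt .
        from bspec[OF this PV] obtain U :: "'a \<Rightarrow> bool set"
          where U: "finite {i \<in> T. U i \<noteq> topspace (discrete_topology (UNIV :: bool set))}"
            "char_fun T P \<in> Pi\<^sub>E T U" "Pi\<^sub>E T U \<subseteq> V"
          by (elim exE conjE)
        \<comment> \<open>The finitely many coordinates that the box restricts; those in
          \<open>P\<close> become prescribed elements and the others forbidden ones.\<close>
        define D where "D = {i \<in> T. U i \<noteq> UNIV}"
        have D: "finite D" using U(1) unfolding D_def by simp
        have "set_nbhd PP (D \<inter> P) (D - P) \<subseteq> W"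
        proof
          fix Q assume Q: "Q \<in> set_nbhd PP (D \<inter> P) (D - P)"
          have "char_fun T Q t \<in> U t" if t: "t \<in> T" for t
          proof (cases "t \<in> D")
            case True
            then have "t \<in> Q \<longleftrightarrow> t \<in> P" using Q unfolding set_nbhd_def by blast
            then have "char_fun T Q t = char_fun T P t" using app[OF t] by simp
            then show ?thesis using U(2) t by auto
          qed (use t in \<open>simp add: D_def\<close>)
          then have "char_fun T Q \<in> Pi\<^sub>E T U" by (auto simp: char_fun_def)
          then have "char_fun T Q \<in> char_fun T ` W" using U(3) V(2) Q unfolding set_nbhd_def by blast
          then show "Q \<in> W" using inj W Q unfolding set_nbhd_def by auto
        qed
        then show ?thesis using D P W
          by (intro exI[of _ "D \<inter> P"] exI[of _ "D - P"]) (auto simp: set_nbhd_def)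
      qed
      then show "openin (set_space PP) W" unfolding openin_set_space using W by blast
    qed
  qed
  then show ?thesis by (rule homeomorphic_space_sym[THEN iffD1])
qed

section \<open>Order trees and their paths\<close>

lemma
  assumes "order_tree r"
  shows order_tree_refl: "t \<in> Field r \<Longrightarrow> (t, t) \<in> r"
    and order_tree_trans: "(x, y) \<in> r \<Longrightarrow> (y, z) \<in> r \<Longrightarrow> (x, z) \<in> r"
    and order_tree_antisym: "(x, y) \<in> r \<Longrightarrow> (y, x) \<in> r \<Longrightarrow> x = y"
proof -
  have "refl_on (Field r) r" "trans r" "antisym r"
    using assms unfolding order_tree_def partial_order_on_def preorder_on_def by simp_all
  then show "t \<in> Field r \<Longrightarrow> (t, t) \<in> r" "(x, y) \<in> r \<Longrightarrow> (y, z) \<in> r \<Longrightarrow> (x, z) \<in> r"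
    "(x, y) \<in> r \<Longrightarrow> (y, x) \<in> r \<Longrightarrow> x = y"
    by (blast intro: refl_onD, blast intro: transD, blast intro: antisymD)
qed

lemma order_tree_Field: "(x, y) \<in> r \<Longrightarrow> x \<in> Field r" "(x, y) \<in> r \<Longrightarrow> y \<in> Field r"
  by (auto intro: FieldI1 FieldI2)

text \<open>\<open>order_tree\<close> well-orders the strict predecessors of \<open>t\<close> only.
  So \<open>t\<close> is removed from \<open>A\<close>, after the case in which nothing else is
  there.\<close>

lemma order_tree_least:
  assumes r: "order_tree r" and A: "A \<noteq> {}" "\<And>a. a \<in> A \<Longrightarrow> (a, t) \<in> r"
  obtains m where "m \<in> A" "\<And>a. a \<in> A \<Longrightarrow> (m, a) \<in> r"
proof (cases "A \<subseteq> {t}")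
  case True
  then have "A = {t}" using A(1) by blast
  then show ?thesis using that[of t] A(2) by blast
next
  case False
  have tF: "t \<in> Field r" using A order_tree_Field(2)[of _ t r] by blast
  let ?R = "Restr r (underS r t)"
  define B where "B = A - {t}"
  have B: "B \<noteq> {}" "B \<subseteq> underS r t" using False A(2) by (auto simp: B_def underS_def)
  have W: "Well_order ?R" using r tF unfolding order_tree_def by blast
  then have "wf (?R - Id)" by (simp add: well_order_on_def)
  then obtain m where m: "m \<in> B" "\<And>y. (y, m) \<in> ?R - Id \<Longrightarrow> y \<notin> B" using B(1) wfE_min by (metis ex_in_conv)
  have F: "x \<in> Field ?R" if "x \<in> underS r t" for x
  proof -
    have "(x, x) \<in> ?R" using that order_tree_refl[OF r, of x] order_tree_Field(1)[of x t r] by (auto simp: underS_def)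
    then show ?thesis by (rule FieldI1)
  qed
  have "(m, a) \<in> r" if a: "a \<in> A" for a
  proof (cases "a = t \<or> a = m")
    case True
    then show ?thesis using A(2) m(1) order_tree_refl[OF r] order_tree_Field(1)[of m t r] unfolding B_def by auto
  next
    case False
    then have "a \<in> B" using a by (simp add: B_def)
    then have "(a, m) \<in> ?R \<or> (m, a) \<in> ?R"
      using W F[of a] F[of m] m(1) B(2) False
      unfolding well_order_on_def linear_order_on_def total_on_def by blast
    then show ?thesis using m(2)[of a] False \<open>a \<in> B\<close> by blast
  qed
  then show ?thesis using that[of m] m(1) unfolding B_def by blast
qed

lemma order_tree_chain:
  assumes r: "order_tree r" and xy: "(x, t) \<in> r" "(y, t) \<in> r"
  shows "(x, y) \<in> r \<or> (y, x) \<in> r"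
proof -
  obtain m where "m \<in> {x, y}" "\<And>a. a \<in> {x, y} \<Longrightarrow> (m, a) \<in> r"
    using order_tree_least[OF r, of "{x, y}" t] xy by auto
  then show ?thesis by blast
qed

text \<open>The least node below a given node is minimal in the whole tree, hence it is the unique
  minimal node.\<close>

lemma order_tree_root:
  assumes r: "order_tree r"
  obtains \<rho> where "\<rho> \<in> Field r" "\<And>t. t \<in> Field r \<Longrightarrow> (\<rho>, t) \<in> r"
proof -
  obtain \<rho> where \<rho>: "\<rho> \<in> Field r" "\<And>x. x \<in> Field r \<Longrightarrow> (\<forall>y. (y, x) \<in> r \<longrightarrow> y = x) \<Longrightarrow> x = \<rho>"
    using r unfolding order_tree_def by blast
  have "(\<rho>, t) \<in> r" if t: "t \<in> Field r" for t
  proof -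
    obtain m where "m \<in> {x. (x, t) \<in> r}" "\<And>a. a \<in> {x. (x, t) \<in> r} \<Longrightarrow> (m, a) \<in> r"
      by (rule order_tree_least[OF r, of "{x. (x, t) \<in> r}" t]) (use order_tree_refl[OF r t] in auto)
    then have m: "(m, t) \<in> r" "\<And>a. (a, t) \<in> r \<Longrightarrow> (m, a) \<in> r" by simp_all
    have "y = m" if "(y, m) \<in> r" for y
      using m(2)[of y] order_tree_trans[OF r that m(1)] order_tree_antisym[OF r that] by blast
    then have "m = \<rho>" using \<rho>(2)[of m] order_tree_Field(1)[OF m(1)] by blast
    then show ?thesis using m(1) by simp
  qed
  then show thesis using that \<rho>(1) by blast
qed

lemma tree_pathD:
  assumes "tree_path r P"
  shows "P \<noteq> {}" "x \<in> P \<Longrightarrow> y \<in> P \<Longrightarrow> (x, y) \<in> r \<or> (y, x) \<in> r" "x \<in> P \<Longrightarrow> (y, x) \<in> r \<Longrightarrow> y \<in> P"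
  using assms unfolding tree_path_def Chains_def by blast+

lemma tree_path_Field:
  assumes "tree_path r P" "x \<in> P"
  shows "x \<in> Field r"
  using tree_pathD(2)[OF assms(1) assms(2) assms(2)] by (auto intro: FieldI1)

lemma tree_pathI:
  assumes "P \<noteq> {}" "\<And>x y. x \<in> P \<Longrightarrow> y \<in> P \<Longrightarrow> (x, y) \<in> r \<or> (y, x) \<in> r"
    "\<And>x y. x \<in> P \<Longrightarrow> (y, x) \<in> r \<Longrightarrow> y \<in> P"
  shows "tree_path r P"
  using assms unfolding tree_path_def Chains_def by blast

lemma tree_path_finite_bound:
  assumes r: "order_tree r" and P: "tree_path r P" and S: "finite S" "S \<subseteq> P"
  shows "\<exists>m\<in>P. \<forall>s\<in>S. (s, m) \<in> r"
  using S
proof (induction rule: finite_induct)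
  case empty
  then show ?case using tree_pathD(1)[OF P] by blast
next
  case (insert a S)
  then obtain m where m: "m \<in> P" "\<forall>s\<in>S. (s, m) \<in> r" by blast
  have a: "a \<in> P" using insert by blast
  from tree_pathD(2)[OF P a m(1)] show ?case
  proof
    assume "(a, m) \<in> r"
    then show ?thesis using m by blast
  next
    assume "(m, a) \<in> r"
    then show ?thesis using m(2) a order_tree_trans[OF r] tree_pathD(2)[OF P a a] by blast
  qed
qed

text \<open>A path may have no upper bound in the tree, so the well-order is applied to the part of
  \<open>A\<close> below one of its elements; the rest of \<open>A\<close> lies higher.\<close>

lemma tree_path_least:
  assumes r: "order_tree r" and P: "tree_path r P" and A: "A \<noteq> {}" "A \<subseteq> P"
  obtains m where "m \<in> A" "\<And>a. a \<in> A \<Longrightarrow> (m, a) \<in> r"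
proof -
  obtain t where t: "t \<in> A" using A by blast
  then have ne: "t \<in> {a \<in> A. (a, t) \<in> r}" using tree_pathD(2)[OF P, of t t] A(2) by blast
  obtain m where "m \<in> {a \<in> A. (a, t) \<in> r}" "\<And>a. a \<in> {a \<in> A. (a, t) \<in> r} \<Longrightarrow> (m, a) \<in> r"
    by (rule order_tree_least[OF r, of "{a \<in> A. (a, t) \<in> r}" t]) (use ne in auto)
  then have m: "m \<in> A" "(m, t) \<in> r" "\<And>a. a \<in> A \<Longrightarrow> (a, t) \<in> r \<Longrightarrow> (m, a) \<in> r"
    by simp_all
  have "(m, a) \<in> r" if "a \<in> A" for a
    using m(3)[OF that] tree_pathD(2)[OF P, of a t] A(2) that t order_tree_trans[OF r m(2)] by blast
  then show thesis using that m(1) by blast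
qed

lemma tree_path_under:
  assumes r: "order_tree r" and t: "t \<in> Field r"
  shows "tree_path r {x. (x, t) \<in> r}"
proof (rule tree_pathI)
  show "{x. (x, t) \<in> r} \<noteq> {}" using order_tree_refl[OF r t] by blast
qed (use order_tree_chain[OF r] order_tree_trans[OF r] in blast)+

lemma tree_path_Union_chain:
  assumes C: "C \<noteq> {}" "\<And>P. P \<in> C \<Longrightarrow> tree_path r P" "\<And>P Q. P \<in> C \<Longrightarrow> Q \<in> C \<Longrightarrow> P \<subseteq> Q \<or> Q \<subseteq> P"
  shows "tree_path r (\<Union>C)"
proof (rule tree_pathI)
  show "\<Union>C \<noteq> {}" using C(1,2) tree_pathD(1) by fast
  show "(x, y) \<in> r \<or> (y, x) \<in> r" if "x \<in> \<Union>C" "y \<in> \<Union>C" for x y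
    using that C(2,3) tree_pathD(2) by (metis UnionE subsetD)
  show "y \<in> \<Union>C" if "x \<in> \<Union>C" "(y, x) \<in> r" for x y
    using that C(2) tree_pathD(3) by (metis UnionE UnionI)
qed

lemma tree_path_extends_to_branch:
  assumes P: "tree_path r P"
  obtains B where "tree_branch r B" "P \<subseteq> B"
proof -
  let ?Z = "{Q. tree_path r Q \<and> P \<subseteq> Q}"
  have "\<exists>M\<in>?Z. \<forall>X\<in>?Z. M \<subseteq> X \<longrightarrow> X = M"
  proof (rule subset_Zorn_nonempty)
    show "?Z \<noteq> {}" using P by blast
    fix C assume C: "C \<noteq> {}" "subset.chain ?Z C"
    have "tree_path r (\<Union>C)"
      by (rule tree_path_Union_chain) (use C in \<open>auto simp: subset_chain_def\<close>)
    moreover have "P \<subseteq> \<Union>C" using C unfolding subset_chain_def by blast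
    ultimately show "\<Union>C \<in> ?Z" by blast
  qed
  then obtain B where "tree_path r B" "P \<subseteq> B" "\<forall>X\<in>?Z. B \<subseteq> X \<longrightarrow> X = B" by blast
  then show thesis using that[of B] unfolding tree_branch_def by blast
qed

lemma tree_path_chain_union:
  fixes t :: "nat \<Rightarrow> 'n"
  assumes r: "order_tree r" and t: "\<And>n. (t n, t (Suc n)) \<in> r"
  shows "tree_path r {x. \<exists>n. (x, t n) \<in> r}"
proof -
  have mono: "(t m, t n) \<in> r" if "m \<le> n" for m n
    using that
  proof (induction rule: dec_induct)
    case base
    show ?case using order_tree_refl[OF r order_tree_Field(1)[OF t]] .
  next
    case (step n)
    then show ?case using order_tree_trans[OF r _ t] by blast
  qed
  show ?thesis
  proof (rule tree_pathI)
    show "{x. \<exists>n. (x, t n) \<in> r} \<noteq> {}" using mono by blast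
    fix x y assume "x \<in> {x. \<exists>n. (x, t n) \<in> r}" "y \<in> {x. \<exists>n. (x, t n) \<in> r}"
    then obtain m n where "(x, t m) \<in> r" "(y, t n) \<in> r" by blast
    then have "(x, t (max m n)) \<in> r" "(y, t (max m n)) \<in> r"
      using order_tree_trans[OF r] mono[of m "max m n"] mono[of n "max m n"] by (meson max.cobounded1 max.cobounded2)+
    then show "(x, y) \<in> r \<or> (y, x) \<in> r" by (rule order_tree_chain[OF r])
  qed (use order_tree_trans[OF r] in blast)
qed


section \<open>Branch spaces and ray spaces\<close>

text \<open>The conclusion of ultraparacompactness for a part \<open>W\<close> of the space. In this
  local form it passes to disjoint unions, which is how failure is traced down to smaller
  sets.\<close>

definition splits :: "'a topology \<Rightarrow> 'a set set \<Rightarrow> 'a set \<Rightarrow> bool" where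
  "splits X UU W \<longleftrightarrow> (\<exists>\<P>. partition_on W \<P> \<and> (\<forall>P\<in>\<P>. openin X P) \<and> (\<forall>P\<in>\<P>. \<exists>U\<in>UU. P \<subseteq> U))"

lemma splits_base:
  assumes "openin X W" "U \<in> UU" "W \<subseteq> U"
  shows "splits X UU W"
proof (cases "W = {}")
  case True
  then show ?thesis unfolding splits_def by (intro exI[of _ "{}"]) (simp add: partition_on_def)
next
  case False
  then show ?thesis using assms unfolding splits_def
    by (intro exI[of _ "{W}"]) (auto simp: partition_on_def)
qed

lemma splits_Union:
  assumes disj: "\<And>V W. V \<in> K \<Longrightarrow> W \<in> K \<Longrightarrow> V \<noteq> W \<Longrightarrow> V \<inter> W = {}"
    and sp: "\<And>W. W \<in> K \<Longrightarrow> splits X UU W"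
  shows "splits X UU (\<Union>K)"
proof -
  have "\<forall>W\<in>K. \<exists>\<P>. partition_on W \<P> \<and> (\<forall>P\<in>\<P>. openin X P) \<and> (\<forall>P\<in>\<P>. \<exists>U\<in>UU. P \<subseteq> U)"
    using sp unfolding splits_def by blast
  then obtain p where p: "\<And>W. W \<in> K \<Longrightarrow> partition_on W (p W)"
    "\<And>W. W \<in> K \<Longrightarrow> (\<forall>P\<in>p W. openin X P) \<and> (\<forall>P\<in>p W. \<exists>U\<in>UU. P \<subseteq> U)" by metis
  have U: "\<Union>(p W) = W" if "W \<in> K" for W using partition_onD1[OF p(1)[OF that]] by simp
  have "partition_on (\<Union>K) (\<Union>W\<in>K. p W)"
  proof (rule partition_onI)
    show "\<Union> (\<Union>W\<in>K. p W) = \<Union>K" using U by fastforce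
    show "{} \<notin> (\<Union>W\<in>K. p W)" using partition_onD3[OF p(1)] by blast
    fix A B assume AB: "A \<in> (\<Union>W\<in>K. p W)" "B \<in> (\<Union>W\<in>K. p W)" "A \<noteq> B"
    then obtain V W where VW: "V \<in> K" "A \<in> p V" "W \<in> K" "B \<in> p W" by blast
    show "disjnt A B"
    proof (cases "V = W")
      case True
      then show ?thesis using partition_onD2[OF p(1)[OF VW(1)]] VW AB(3) by (auto simp: disjoint_def disjnt_def)
    next
      case False
      then have "V \<inter> W = {}" using disj VW by blast
      moreover have "A \<subseteq> V" "B \<subseteq> W" using U VW by blast+
      ultimately show ?thesis by (auto simp: disjnt_def)
    qed
  qed
  then show ?thesis unfolding splits_def using p(2) by blast
qed

lemma ultraparacompact_iff_splits:
  "ultraparacompact_space X \<longleftrightarrow>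
     (\<forall>UU. (\<forall>U\<in>UU. openin X U) \<and> \<Union>UU = topspace X \<longrightarrow> splits X UU (topspace X))"
  unfolding ultraparacompact_space_def splits_def by blast

abbreviation branches :: "'n rel \<Rightarrow> 'n set set" where
  "branches r \<equiv> {P. tree_branch r P}"

abbreviation rays :: "'n rel \<Rightarrow> 'n set set" where
  "rays r \<equiv> {P. tree_ray r P}"

lemma branch_space_homeomorphic: "branch_space r homeomorphic_space set_space (branches r)"
  unfolding branch_space_def
  by (rule char_fun_subspace_homeomorphic) (use tree_path_Field in \<open>auto simp: tree_branch_def\<close>)

lemma ray_space_homeomorphic: "ray_space r homeomorphic_space set_space (rays r)"
  unfolding ray_space_def
  by (rule char_fun_subspace_homeomorphic) (use tree_path_Field in \<open>auto simp: tree_ray_def\<close>)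

lemma branchD:
  assumes "tree_branch r B"
  shows "tree_path r B" "tree_path r Q \<Longrightarrow> B \<subseteq> Q \<Longrightarrow> Q = B"
  using assms unfolding tree_branch_def by blast+

text \<open>A branch \<open>B\<close> missing \<open>f\<close> contains an element not below \<open>f\<close>, so the negative part of a basic
  neighbourhood is redundant.\<close>

lemma branch_nbhd:
  assumes r: "order_tree r" and W: "openin (set_space (branches r)) W" "B \<in> W"
  obtains t where "t \<in> B" "{Q. tree_branch r Q \<and> t \<in> Q} \<subseteq> W"
proof -
  obtain A F where AF: "finite A" "finite F" "B \<in> set_nbhd (branches r) A F" "set_nbhd (branches r) A F \<subseteq> W"
    using W unfolding openin_set_space by blast
  have B: "tree_branch r B" "A \<subseteq> B" "F \<inter> B = {}" using AF(3) unfolding set_nbhd_def by auto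
  note path = branchD(1)[OF B(1)]
  \<comment> \<open>Otherwise the chain below \<open>f\<close> contains \<open>B\<close>, equals it
    by maximality, and puts \<open>f\<close> into \<open>B\<close>.\<close>
  have "\<exists>x\<in>B. (x, f) \<notin> r" if f: "f \<in> F" for f
  proof (rule ccontr)
    assume *: "\<not> ?thesis"
    obtain x where "x \<in> B" using tree_pathD(1)[OF path] by blast
    then have ff: "f \<in> Field r" using * order_tree_Field(2) by fastforce
    then have "{x. (x, f) \<in> r} = B" using branchD(2)[OF B(1) tree_path_under[OF r ff]] * by blast
    then show False using order_tree_refl[OF r ff] B(3) f by blast
  qed
  then obtain h where h: "\<And>f. f \<in> F \<Longrightarrow> h f \<in> B \<and> (h f, f) \<notin> r" by metis
  have "finite (A \<union> h ` F)" "A \<union> h ` F \<subseteq> B" using AF(1,2) B(2) h by auto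
  then obtain t where t: "t \<in> B" "\<forall>s\<in>A \<union> h ` F. (s, t) \<in> r"
    using tree_path_finite_bound[OF r path] by metis
  have "Q \<in> set_nbhd (branches r) A F" if Q: "tree_branch r Q" "t \<in> Q" for Q
  proof -
    note Qp = branchD(1)[OF Q(1)]
    have sub: "A \<subseteq> Q" "h ` F \<subseteq> Q" using t(2) tree_pathD(3)[OF Qp Q(2)] by blast+
    \<comment> \<open>\<open>f\<close> and \<open>h f\<close> would be comparable on
      \<open>Q\<close>. Since \<open>h f\<close> is not below \<open>f\<close>, the node
      \<open>f\<close> would lie below \<open>h f\<close> and thus on \<open>B\<close>.\<close>
    have "f \<notin> Q" if f: "f \<in> F" for f
    proof
      assume "f \<in> Q"
      moreover have "h f \<in> Q" using sub(2) f by blast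
      ultimately have "(f, h f) \<in> r" using tree_pathD(2)[OF Qp, of f "h f"] h[OF f] by blast
      then have "f \<in> B" using tree_pathD(3)[OF path] h[OF f] by blast
      then show False using B(3) f by blast
    qed
    then show ?thesis using Q sub unfolding set_nbhd_def by blast
  qed
  then show thesis using that[OF t(1)] AF(4) by blast
qed

lemma openin_branch_cone: "openin (set_space (branches r)) {Q. tree_branch r Q \<and> t \<in> Q}"
  using openin_set_nbhd[of "{t}" "{}" "branches r"] by (simp add: set_nbhd_def)

lemma branch_space_ultraparacompact:
  assumes r: "order_tree r"
  shows "ultraparacompact_space (set_space (branches r))"
  unfolding ultraparacompact_iff_splits topspace_set_space
proof (intro allI impI)
  fix UU assume UU: "(\<forall>U\<in>UU. openin (set_space (branches r)) U) \<and> \<Union> UU = branches r"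
  let ?cone = "\<lambda>t. {Q. tree_branch r Q \<and> t \<in> Q}"
  define G where "G = {t. \<exists>U\<in>UU. ?cone t \<subseteq> U}"
  \<comment> \<open>Every branch meets \<open>G\<close>, and its least such node is minimal in
    \<open>G\<close>. Two minimal nodes on one branch are comparable, hence equal, so the cones over
    \<open>M\<close> are disjoint.\<close>
  define M where "M = {t \<in> G. \<forall>s\<in>G. (s, t) \<in> r \<longrightarrow> s = t}"
  have "B \<in> \<Union> (?cone ` M)" if B: "tree_branch r B" for B
  proof -
    note path = branchD(1)[OF B]
    obtain U where U: "U \<in> UU" "B \<in> U" using UU B by blast
    then obtain t where t: "t \<in> B" "?cone t \<subseteq> U" using branch_nbhd[OF r] UU by metis
    then have "G \<inter> B \<noteq> {}" using U(1) unfolding G_def by blast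
    then obtain m where m: "m \<in> G \<inter> B" "\<And>a. a \<in> G \<inter> B \<Longrightarrow> (m, a) \<in> r"
      by (rule tree_path_least[OF r path]) auto
    have "s = m" if "s \<in> G" "(s, m) \<in> r" for s
      using m that tree_pathD(3)[OF path, of m s] order_tree_antisym[OF r, of s m] by blast
    then have "m \<in> M" using m(1) unfolding M_def by blast
    then show ?thesis using m(1) B by blast
  qed
  then have "\<Union> (?cone ` M) = branches r" by blast
  moreover have "splits (set_space (branches r)) UU (\<Union> (?cone ` M))"
  proof (rule splits_Union)
    fix W assume "W \<in> ?cone ` M"
    then obtain t where t: "t \<in> M" "W = ?cone t" by blast
    then obtain U where "U \<in> UU" "W \<subseteq> U" unfolding M_def G_def by blast
    then show "splits (set_space (branches r)) UU W"
      using splits_base openin_branch_cone t(2) by metis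
  next
    fix V W assume VW: "V \<in> ?cone ` M" "W \<in> ?cone ` M" "V \<noteq> W"
    then obtain s t where st: "s \<in> M" "t \<in> M" "V = ?cone s" "W = ?cone t" by blast
    show "V \<inter> W = {}"
    proof (rule ccontr)
      assume "V \<inter> W \<noteq> {}"
      then obtain Q where "tree_branch r Q" "s \<in> Q" "t \<in> Q" unfolding st(3,4) by blast
      then have "(s, t) \<in> r \<or> (t, s) \<in> r" using tree_pathD(2)[OF branchD(1)] by metis
      then have "s = t" using st(1,2) unfolding M_def by blast
      then show False using VW(3) st(3,4) by simp
    qed
  qed
  ultimately show "splits (set_space (branches r)) UU (branches r)" by simp
qed

text \<open>Moves are labelled by nodes that climb the tree. The path below the nodes of a play
  extends to a branch, which lies in every cone played.\<close>

lemma metrizable_branch_space_imp_completely_ultrametrizable: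
  assumes r: "order_tree r" and met: "metrizable_space (branch_space r)"
  shows "completely_ultrametrizable_space (branch_space r)"
proof (rule homeomorphic_completely_ultrametrizable[OF branch_space_homeomorphic])
  let ?cone = "\<lambda>t. {Q. tree_branch r Q \<and> t \<in> Q}"
  have met': "metrizable_space (set_space (branches r))"
    using met homeomorphic_metrizable_space[OF branch_space_homeomorphic] by blast
  show "completely_ultrametrizable_space (set_space (branches r))"
  proof (rule ultraparacompact_labels_imp_completely_ultrametrizable[OF met' branch_space_ultraparacompact[OF r],
        where L = "Field r" and N = ?cone and R = "\<lambda>s t. (s, t) \<in> r"])
    show "\<exists>p\<in>Field r. B \<in> ?cone p" if "B \<in> topspace (set_space (branches r))" for B
      using that tree_pathD(1)[OF branchD(1)] tree_path_Field[OF branchD(1)] by fastforce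
    show "openin (set_space (branches r)) (?cone p)" for p by (rule openin_branch_cone)
  next
    fix p B V assume *: "p \<in> Field r" "B \<in> ?cone p" "openin (set_space (branches r)) V" "B \<in> V"
    obtain t where t: "t \<in> B" "?cone t \<subseteq> V" using branch_nbhd[OF r *(3,4)] .
    have path: "tree_path r B" using *(2) branchD(1) by blast
    obtain m where m: "m \<in> B" "(p, m) \<in> r" "(t, m) \<in> r"
      using tree_path_finite_bound[OF r path, of "{p, t}"] t(1) *(2) by auto
    have "t \<in> Q" if "tree_branch r Q" "m \<in> Q" for Q
      using tree_pathD(3)[OF branchD(1)[OF that(1)] that(2) m(3)] .
    then have "?cone m \<subseteq> ?cone t" by (simp add: subset_iff)
    then have "?cone m \<subseteq> V" using t(2) by (rule order_trans)
    moreover have "B \<in> ?cone m" "m \<in> Field r" using *(2) m(1) tree_path_Field[OF path] by simp_all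
    ultimately show "\<exists>q\<in>Field r. (p, q) \<in> r \<and> B \<in> ?cone q \<and> ?cone q \<subseteq> V"
      using m(2) by (intro bexI[of _ m] conjI)
  next
    fix p :: "nat \<Rightarrow> 'a"
    assume p: "\<And>n. p n \<in> Field r \<and> ?cone (p n) \<noteq> {} \<and> ?cone (p (Suc n)) \<subseteq> ?cone (p n) \<and> (p n, p (Suc n)) \<in> r"
    obtain B where B: "tree_branch r B" "{x. \<exists>n. (x, p n) \<in> r} \<subseteq> B"
      using tree_path_extends_to_branch[OF tree_path_chain_union[OF r]] p by blast
    have "p n \<in> B" for n using B(2) order_tree_refl[OF r, of "p n"] p by blast
    then show "\<exists>B. \<forall>n. B \<in> ?cone (p n)" using B(1) by blast
  qed
qed

section \<open>Ray spaces\<close>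

abbreviation ray_nbhd :: "'n rel \<Rightarrow> 'n \<Rightarrow> 'n set \<Rightarrow> 'n set set" where
  "ray_nbhd r t F \<equiv> {Q. tree_ray r Q \<and> t \<in> Q \<and> F \<inter> Q = {}}"

lemma openin_ray_nbhd:
  assumes "finite F"
  shows "openin (set_space (rays r)) (ray_nbhd r t F)"
  using openin_set_nbhd[of "{t}" F "rays r"] assms by (simp add: set_nbhd_def)

lemma rayD:
  assumes "tree_ray r P"
  shows "tree_path r P" "m \<in> P \<Longrightarrow> \<exists>x\<in>P. (m, x) \<in> r \<and> x \<noteq> m"
  using assms unfolding tree_ray_def by blast+

text \<open>A forbidden node that is not above all of \<open>P\<close> is excluded by a sufficiently
  high \<open>t\<close> in \<open>P\<close>, as for branches. Those above all of \<open>P\<close>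
  cannot be replaced in this way and remain in \<open>F\<close>. The strict step from
  \<open>s\<close> to \<open>t\<close> later keeps the limit of a play from having a maximal
  element.\<close>

lemma ray_basic_nbhd:
  assumes r: "order_tree r" and W: "openin (set_space (rays r)) W" "P \<in> W" and s: "s \<in> P"
  obtains t F where "t \<in> P" "(s, t) \<in> r" "s \<noteq> t" "finite F" "F \<inter> P = {}" "ray_nbhd r t F \<subseteq> W"
    "\<And>f x. f \<in> F \<Longrightarrow> x \<in> P \<Longrightarrow> (x, f) \<in> r"
proof -
  obtain A F where AF: "finite A" "finite F" "P \<in> set_nbhd (rays r) A F" "set_nbhd (rays r) A F \<subseteq> W"
    using W unfolding openin_set_space by blast
  have P: "tree_ray r P" "A \<subseteq> P" "F \<inter> P = {}" using AF(3) unfolding set_nbhd_def by auto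
  note path = rayD(1)[OF P(1)]
  define F1 where "F1 = {f \<in> F. \<forall>x\<in>P. (x, f) \<in> r}"
  have "\<forall>f\<in>F - F1. \<exists>x\<in>P. (x, f) \<notin> r" unfolding F1_def by blast
  then obtain h where h: "\<And>f. f \<in> F - F1 \<Longrightarrow> h f \<in> P \<and> (h f, f) \<notin> r" by metis
  obtain s' where s': "s' \<in> P" "(s, s') \<in> r" "s' \<noteq> s" using rayD(2)[OF P(1) s] by blast
  have "finite (insert s' (A \<union> h ` (F - F1)))" "insert s' (A \<union> h ` (F - F1)) \<subseteq> P"
    using AF(1,2) P(2) h s'(1) by auto
  then obtain t where t: "t \<in> P" "\<forall>x\<in>insert s' (A \<union> h ` (F - F1)). (x, t) \<in> r"
    using tree_path_finite_bound[OF r path] by metis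
  have "(s, t) \<in> r" using t(2) s'(2) order_tree_trans[OF r] by blast
  moreover have "s \<noteq> t" using t(2) s'(2,3) order_tree_antisym[OF r] by blast
  moreover have "ray_nbhd r t F1 \<subseteq> W"
  proof
    fix Q assume Q: "Q \<in> ray_nbhd r t F1"
    then have Qr: "tree_ray r Q" by blast
    note Qp = rayD(1)[OF Qr]
    have sub: "A \<subseteq> Q" "h ` (F - F1) \<subseteq> Q" using t(2) Q tree_pathD(3)[OF Qp, of t] by blast+
    have "f \<notin> Q" if f: "f \<in> F" for f
    proof
      assume fQ: "f \<in> Q"
      then have f': "f \<in> F - F1" using Q f by blast
      then have "h f \<in> Q" using sub(2) by blast
      then have "(f, h f) \<in> r" using tree_pathD(2)[OF Qp fQ] h[OF f'] by blast
      then have "f \<in> P" using tree_pathD(3)[OF path] h[OF f'] by blast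
      then show False using P(3) f by blast
    qed
    then have "Q \<in> set_nbhd (rays r) A F" using Qr sub unfolding set_nbhd_def by blast
    then show "Q \<in> W" using AF(4) by blast
  qed
  moreover have "finite F1" "F1 \<inter> P = {}" using AF(2) P(3) unfolding F1_def by auto
  moreover have "\<And>f x. f \<in> F1 \<Longrightarrow> x \<in> P \<Longrightarrow> (x, f) \<in> r" unfolding F1_def by blast
  ultimately show thesis using that[of t F1] t(1) by blast
qed

text \<open>The least element of the chain below \<open>f\<close> that lies outside of the ray \<open>P\<close>.\<close>

lemma ray_top:
  assumes r: "order_tree r" and P: "tree_path r P" and f: "f \<notin> P" "\<And>x. x \<in> P \<Longrightarrow> (x, f) \<in> r"
  obtains g where "g \<notin> P" "(g, f) \<in> r" "tree_path r (insert g P)"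
proof -
  obtain x where "x \<in> P" using tree_pathD(1)[OF P] by blast
  then have ff: "(f, f) \<in> r" using f(2) order_tree_refl[OF r] order_tree_Field(2) by metis
  obtain g where "g \<in> {x. (x, f) \<in> r \<and> x \<notin> P}" "\<And>a. a \<in> {x. (x, f) \<in> r \<and> x \<notin> P} \<Longrightarrow> (g, a) \<in> r"
    by (rule order_tree_least[OF r, of "{x. (x, f) \<in> r \<and> x \<notin> P}" f]) (use ff f(1) in auto)
  then have g: "g \<notin> P" "(g, f) \<in> r" "\<And>a. (a, f) \<in> r \<Longrightarrow> a \<notin> P \<Longrightarrow> (g, a) \<in> r" by simp_all
  have gg: "(g, g) \<in> r" using order_tree_refl[OF r order_tree_Field(1)[OF g(2)]] .
  have Pg: "(x, g) \<in> r" if "x \<in> P" for x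
    using order_tree_chain[OF r f(2)[OF that] g(2)] tree_pathD(3)[OF P that] g(1) by blast
  have "tree_path r (insert g P)"
  proof (rule tree_pathI)
    show "(x, y) \<in> r \<or> (y, x) \<in> r" if "x \<in> insert g P" "y \<in> insert g P" for x y
      using that Pg gg tree_pathD(2)[OF P] by blast
    show "y \<in> insert g P" if x: "x \<in> insert g P" and y: "(y, x) \<in> r" for x y
    proof (cases "x = g")
      case True
      show ?thesis
      proof (rule ccontr)
        assume n: "y \<notin> insert g P"
        then have "(g, y) \<in> r" using g(3) order_tree_trans[OF r _ g(2)] y True by blast
        then show False using order_tree_antisym[OF r] y True n by blast
      qed
    qed (use x y tree_pathD(3)[OF P] in blast)
  qed simp
  then show thesis using that g(1,2) by blast
qed

lemma ray_space_ultraparacompact: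
  assumes r: "order_tree r"
  shows "ultraparacompact_space (set_space (rays r))"
  unfolding ultraparacompact_iff_splits topspace_set_space
proof (intro allI impI)
  fix UU assume UU: "(\<forall>U\<in>UU. openin (set_space (rays r)) U) \<and> \<Union> UU = rays r"
  let ?N = "\<lambda>t. ray_nbhd r t {}"
  let ?ok = "splits (set_space (rays r)) UU"
  obtain \<rho> where \<rho>: "\<rho> \<in> Field r" "\<And>t. t \<in> Field r \<Longrightarrow> (\<rho>, t) \<in> r" by (rule order_tree_root[OF r]) (rule that)
  have root_in: "\<rho> \<in> P" if "tree_path r P" for P
    using tree_pathD(1,3)[OF that] \<rho>(2) tree_path_Field[OF that] by blast
  have N\<rho>: "?N \<rho> = rays r" using root_in rayD(1) by blast
  show "?ok (rays r)"
  proof (rule ccontr)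
    assume bad: "\<not> ?ok (rays r)"
    let ?Z = "{P. tree_path r P \<and> (\<forall>t\<in>P. \<not> ?ok (?N t))}"
    have "\<exists>M\<in>?Z. \<forall>X\<in>?Z. M \<subseteq> X \<longrightarrow> X = M"
    proof (rule subset_Zorn_nonempty)
      have "x = \<rho>" if "(x, \<rho>) \<in> r" for x
        using order_tree_antisym[OF r that] \<rho>(2) order_tree_Field(1)[OF that] by blast
      then have "{x. (x, \<rho>) \<in> r} = {\<rho>}" using order_tree_refl[OF r \<rho>(1)] by blast
      then have "{\<rho>} \<in> ?Z" using tree_path_under[OF r \<rho>(1)] bad N\<rho> by simp
      then show "?Z \<noteq> {}" by blast
      fix C assume C: "C \<noteq> {}" "subset.chain ?Z C"
      have "tree_path r (\<Union>C)"
        by (rule tree_path_Union_chain) (use C in \<open>auto simp: subset_chain_def\<close>)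
      moreover have "\<forall>t\<in>\<Union>C. \<not> ?ok (?N t)" using C(2) unfolding subset_chain_def by blast
      ultimately show "\<Union>C \<in> ?Z" by blast
    qed
    then obtain P where "P \<in> ?Z" and mx: "\<forall>X\<in>?Z. P \<subseteq> X \<longrightarrow> X = P" by (rule bexE)
    then have P: "tree_path r P" "\<And>t. t \<in> P \<Longrightarrow> \<not> ?ok (?N t)" by simp_all
    \<comment> \<open>All nodes of \<open>P\<close> have bad cones, so in a proper extension by the
      single node \<open>g\<close> only the cone of \<open>g\<close> can be the good one.\<close>
    have max: "?ok (?N g)" if "tree_path r (insert g P)" "g \<notin> P" for g
    proof (rule ccontr)
      assume "\<not> ?ok (?N g)"
      then have "insert g P \<in> ?Z" using that(1) P(2) by simp
      then show False using mx that(2) by blast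
    qed
    have disj: "?N s \<inter> ?N t = {}" if "(s, t) \<notin> r" "(t, s) \<notin> r" for s t
    proof (rule ccontr)
      assume "?N s \<inter> ?N t \<noteq> {}"
      then obtain Q where "tree_ray r Q" "s \<in> Q" "t \<in> Q" by blast
      then show False using that tree_pathD(2)[OF rayD(1), of r Q s t] by blast
    qed
    show False
    proof (cases "tree_ray r P")
      case False
      then obtain m where m: "m \<in> P" "\<forall>x\<in>P. (m, x) \<in> r \<longrightarrow> x = m"
        using P(1) unfolding tree_ray_def by blast
      have below: "(x, m) \<in> r" if "x \<in> P" for x
        using tree_pathD(2)[OF P(1) that m(1)] m(2) that by blast
      \<comment> \<open>A ray through the maximum \<open>m\<close> of \<open>P\<close> goes on, and
        its least node after \<open>m\<close> is a successor of \<open>m\<close>. So the bad cone of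
        \<open>m\<close> is a disjoint union of good cones.\<close>
      have eq: "?N m = \<Union> (?N ` {s. tree_succ r m s})"
      proof (intro equalityI subsetI)
        fix Q assume "Q \<in> ?N m"
        then have Q: "tree_ray r Q" "m \<in> Q" by auto
        note Qp = rayD(1)[OF Q(1)]
        have "{x \<in> Q. (m, x) \<in> r \<and> x \<noteq> m} \<noteq> {}" using rayD(2)[OF Q] by blast
        then obtain s where s: "s \<in> {x \<in> Q. (m, x) \<in> r \<and> x \<noteq> m}"
          "\<And>a. a \<in> {x \<in> Q. (m, x) \<in> r \<and> x \<noteq> m} \<Longrightarrow> (s, a) \<in> r"
          by (rule tree_path_least[OF r Qp]) auto
        have "\<not> (\<exists>v. v \<noteq> m \<and> v \<noteq> s \<and> (m, v) \<in> r \<and> (v, s) \<in> r)"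
        proof
          assume "\<exists>v. v \<noteq> m \<and> v \<noteq> s \<and> (m, v) \<in> r \<and> (v, s) \<in> r"
          then obtain v where v: "v \<noteq> m" "v \<noteq> s" "(m, v) \<in> r" "(v, s) \<in> r" by blast
          then have "v \<in> Q" using tree_pathD(3)[OF Qp] s(1) by blast
          then have "(s, v) \<in> r" using s(2) v by blast
          then show False using order_tree_antisym[OF r] v by blast
        qed
        then have "tree_succ r m s" using s(1) unfolding tree_succ_def by blast
        then show "Q \<in> \<Union> (?N ` {s. tree_succ r m s})" using s(1) Q(1) by blast
      next
        fix Q assume "Q \<in> \<Union> (?N ` {s. tree_succ r m s})"
        then obtain s where s: "tree_succ r m s" "tree_ray r Q" "s \<in> Q" by blast
        then have "m \<in> Q" using tree_pathD(3)[OF rayD(1)[OF s(2)], of s m] unfolding tree_succ_def by blast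
        then show "Q \<in> ?N m" using s(2) by blast
      qed
      have "?ok (\<Union> (?N ` {s. tree_succ r m s}))"
      proof (rule splits_Union)
        fix W assume "W \<in> ?N ` {s. tree_succ r m s}"
        then obtain s where s: "tree_succ r m s" "W = ?N s" by blast
        have ms: "(m, s) \<in> r" "s \<noteq> m" "\<And>v. (m, v) \<in> r \<Longrightarrow> (v, s) \<in> r \<Longrightarrow> v = m \<or> v = s"
          using s(1) unfolding tree_succ_def by blast+
        have "insert s P = {x. (x, s) \<in> r}"
        proof (intro equalityI subsetI)
          fix x assume "x \<in> insert s P"
          then show "x \<in> {x. (x, s) \<in> r}"
            using below ms(1) order_tree_trans[OF r] order_tree_refl[OF r order_tree_Field(2)[OF ms(1)]] by blast
        next
          fix x assume x: "x \<in> {x. (x, s) \<in> r}"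
          then have "(x, m) \<in> r \<or> (m, x) \<in> r" using order_tree_chain[OF r _ ms(1)] by blast
          then show "x \<in> insert s P" using tree_pathD(3)[OF P(1) m(1)] ms(3)[of x] x m(1) by blast
        qed
        moreover have "s \<notin> P" using m(2) ms by blast
        ultimately show "?ok W"
          using max[of s] tree_path_under[OF r order_tree_Field(2)[OF ms(1)]] s(2) by simp
      next
        fix V W assume VW: "V \<in> ?N ` {s. tree_succ r m s}" "W \<in> ?N ` {s. tree_succ r m s}" "V \<noteq> W"
        then obtain s t where st: "tree_succ r m s" "tree_succ r m t" "V = ?N s" "W = ?N t" by blast
        have "s \<noteq> t" using VW(3) st(3,4) by blast
        then have "(s, t) \<notin> r" "(t, s) \<notin> r" using st(1,2) unfolding tree_succ_def by metis+
        then show "V \<inter> W = {}" unfolding st(3,4) by (rule disj)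
      qed
      then show False using P(2)[OF m(1)] eq by simp
    next
      case True
      then obtain U where U: "U \<in> UU" "P \<in> U" using UU by blast
      then have oU: "openin (set_space (rays r)) U" using UU by blast
      obtain t F where t: "t \<in> P" "finite F" "F \<inter> P = {}" "ray_nbhd r t F \<subseteq> U"
        "\<And>f x. f \<in> F \<Longrightarrow> x \<in> P \<Longrightarrow> (x, f) \<in> r"
        by (rule ray_basic_nbhd[OF r oU U(2) root_in[OF P(1)]]) (rule that)
      have "\<exists>g. g \<notin> P \<and> (g, f) \<in> r \<and> tree_path r (insert g P)" if f: "f \<in> F" for f
      proof -
        have "f \<notin> P" using t(3) f by blast
        then show ?thesis using ray_top[OF r P(1) _ t(5)[OF f]] by metis
      qed
      then obtain g where g: "\<And>f. f \<in> F \<Longrightarrow> g f \<notin> P \<and> (g f, f) \<in> r \<and> tree_path r (insert (g f) P)" by metis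
      have Pg: "(x, g f) \<in> r" if "x \<in> P" "f \<in> F" for x f
        using tree_pathD(2)[of r "insert (g f) P" x "g f"] tree_pathD(3)[OF P(1) that(1)] g[OF that(2)] that(1) by blast
      \<comment> \<open>The cone of \<open>t\<close> is cut along the nodes \<open>g f\<close> that
        sit directly on top of \<open>P\<close>. The remainder lies in one member of the cover, and
        the finitely many cones cut off are good by maximality of \<open>P\<close>.\<close>
      define K where "K = insert (ray_nbhd r t (g ` F)) ((\<lambda>f. ?N (g f)) ` F)"
      have tQ: "t \<in> Q" if "tree_ray r Q" "f \<in> F" "g f \<in> Q" for Q f
        using tree_pathD(3)[OF rayD(1)[OF that(1)] that(3) Pg[OF t(1) that(2)]] .
      have "?N t = \<Union>K"
      proof (intro equalityI subsetI)
        fix Q assume Q: "Q \<in> ?N t"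
        show "Q \<in> \<Union>K"
        proof (cases "g ` F \<inter> Q = {}")
          case True
          then show ?thesis using Q unfolding K_def by simp
        next
          case False
          then obtain f where "f \<in> F" "g f \<in> Q" by blast
          then show ?thesis using Q unfolding K_def by auto
        qed
      next
        fix Q assume "Q \<in> \<Union>K"
        then obtain W where W: "W \<in> K" "Q \<in> W" by (rule UnionE)
        from W(1)[unfolded K_def] show "Q \<in> ?N t"
        proof (elim insertE imageE)
          assume "W = ray_nbhd r t (g ` F)"
          then show ?thesis using W(2) by simp
        next
          fix f assume "W = ?N (g f)" "f \<in> F"
          then show ?thesis using W(2) tQ by simp
        qed
      qed
      moreover have "?ok (\<Union>K)"
      proof (rule splits_Union)
        fix W assume "W \<in> K"
        then show "?ok W"
        proof (unfold K_def, elim insertE imageE)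
          assume W: "W = ray_nbhd r t (g ` F)"
          \<comment> \<open>Avoiding \<open>g f\<close> implies avoiding \<open>f\<close>, which
            lies above it.\<close>
          have "W \<subseteq> ray_nbhd r t F"
          proof
            fix Q assume Q: "Q \<in> W"
            have "f \<notin> Q" if f: "f \<in> F" for f
            proof
              assume "f \<in> Q"
              then have "g f \<in> Q" using Q tree_pathD(3)[OF rayD(1), of r Q f "g f"] g[OF f] unfolding W by simp
              then show False using Q f unfolding W by blast
            qed
            then show "Q \<in> ray_nbhd r t F" using Q unfolding W by blast
          qed
          then have "W \<subseteq> U" using t(4) by simp
          moreover have "openin (set_space (rays r)) W" unfolding W using t(2) by (intro openin_ray_nbhd) simp
          ultimately show ?thesis using splits_base U(1) by metis
        next
          fix f assume "W = ?N (g f)" "f \<in> F"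
          then show ?thesis using max[of "g f"] g[of f] by simp
        qed
      next
        have gg: "?N (g f) \<inter> ?N (g f') = {}" if "f \<in> F" "f' \<in> F" "g f \<noteq> g f'" for f f'
        proof (rule disj)
          \<comment> \<open>Whatever lies below \<open>g b\<close> belongs to
            \<open>insert (g b) P\<close>, whereas \<open>g a\<close> is neither \<open>g b\<close>
            nor in \<open>P\<close>.\<close>
          have no: "(g a, g b) \<notin> r" if "a \<in> F" "b \<in> F" "g a \<noteq> g b" for a b
            using tree_pathD(3)[of r "insert (g b) P" "g b" "g a"] g[OF that(1)] g[OF that(2)] that(3) by blast
          show "(g f, g f') \<notin> r" by (rule no[OF that])
          show "(g f', g f) \<notin> r" by (rule no[OF that(2,1) that(3)[symmetric]])
        qed
        fix V W assume "V \<in> K" "W \<in> K" "V \<noteq> W"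
        then show "V \<inter> W = {}"
          unfolding K_def
        proof (elim insertE imageE)
          fix f f' assume VW: "V = ?N (g f)" "W = ?N (g f')" "f \<in> F" "f' \<in> F" "V \<noteq> W"
          then have "g f \<noteq> g f'" by metis
          then show ?thesis unfolding VW(1,2) by (rule gg[OF VW(3,4)])
        next
          fix f assume "V = ray_nbhd r t (g ` F)" "W = ?N (g f)" "f \<in> F"
          then show ?thesis by auto
        next
          fix f assume "W = ray_nbhd r t (g ` F)" "V = ?N (g f)" "f \<in> F"
          then show ?thesis by auto
        qed simp
      qed
      ultimately show False using P(2)[OF t(1)] by simp
    qed
  qed
qed

text \<open>Strictly increasing nodes make the path below a play a ray. It remains to see that this
  ray respects the forbidden nodes, and for that the nonemptiness of the sets played
  suffices.\<close>

lemma metrizable_ray_space_imp_completely_ultrametrizable: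
  assumes r: "order_tree r" and met: "metrizable_space (ray_space r)"
  shows "completely_ultrametrizable_space (ray_space r)"
proof (rule homeomorphic_completely_ultrametrizable[OF ray_space_homeomorphic])
  have met': "metrizable_space (set_space (rays r))"
    using met homeomorphic_metrizable_space[OF ray_space_homeomorphic] by blast
  let ?N = "\<lambda>(t, F). ray_nbhd r t F"
  show "completely_ultrametrizable_space (set_space (rays r))"
  proof (rule ultraparacompact_labels_imp_completely_ultrametrizable[OF met' ray_space_ultraparacompact[OF r],
        where L = "{(t, F). finite F}" and N = ?N and R = "\<lambda>p q. (fst p, fst q) \<in> r \<and> fst p \<noteq> fst q"])
    fix P assume "P \<in> topspace (set_space (rays r))"
    then have P: "tree_ray r P" by simp
    obtain x where "x \<in> P" using tree_pathD(1)[OF rayD(1)[OF P]] by blast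
    then show "\<exists>p\<in>{(t, F). finite F}. P \<in> ?N p" using P by (intro bexI[of _ "(x, {})"]) auto
  next
    show "openin (set_space (rays r)) (?N p)" if "p \<in> {(t, F). finite F}" for p
      using that openin_ray_nbhd by auto
  next
    fix p P V assume *: "p \<in> {(t, F). finite F}" "P \<in> ?N p" "openin (set_space (rays r)) V" "P \<in> V"
    have s: "fst p \<in> P" using *(2) by auto
    obtain t F where t: "t \<in> P" "(fst p, t) \<in> r" "fst p \<noteq> t" "finite F" "F \<inter> P = {}" "ray_nbhd r t F \<subseteq> V"
      by (rule ray_basic_nbhd[OF r *(3,4) s]) (rule that)
    moreover have "tree_ray r P" using *(2) by auto
    ultimately show "\<exists>q\<in>{(t, F). finite F}. ((fst p, fst q) \<in> r \<and> fst p \<noteq> fst q) \<and> P \<in> ?N q \<and> ?N q \<subseteq> V"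
      by (intro bexI[of _ "(t, F)"]) auto
  next
    fix p :: "nat \<Rightarrow> 'a \<times> 'a set"
    assume p: "\<And>n. p n \<in> {(t, F). finite F} \<and> ?N (p n) \<noteq> {} \<and> ?N (p (Suc n)) \<subseteq> ?N (p n) \<and>
      (fst (p n), fst (p (Suc n))) \<in> r \<and> fst (p n) \<noteq> fst (p (Suc n))"
    have N: "?N (p n) = ray_nbhd r (fst (p n)) (snd (p n))" for n by (simp add: case_prod_beta)
    have dec: "?N (p (Suc n)) \<subseteq> ?N (p n)" for n using p[of n] by (elim conjE)
    have mono: "?N (p n) \<subseteq> ?N (p m)" if "m \<le> n" for m n
      by (rule lift_Suc_antimono_le[of "\<lambda>n. ?N (p n)", OF dec that])
    have p': "?N (p n) \<noteq> {}" "(fst (p n), fst (p (Suc n))) \<in> r" "fst (p n) \<noteq> fst (p (Suc n))" for n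
      using p[of n] by - (elim conjE, assumption)+
    define P where "P = {x. \<exists>n. (x, fst (p n)) \<in> r}"
    have path: "tree_path r P" unfolding P_def using tree_path_chain_union[OF r, of "\<lambda>n. fst (p n)"] p'(2) .
    have fP: "fst (p n) \<in> P" for n
      using order_tree_refl[OF r order_tree_Field(1)[OF p'(2)]] unfolding P_def by blast
    have "\<exists>x\<in>P. (m, x) \<in> r \<and> x \<noteq> m" if m: "m \<in> P" for m
    proof -
      obtain n where n: "(m, fst (p n)) \<in> r" using m unfolding P_def by blast
      have "(m, fst (p (Suc n))) \<in> r" using order_tree_trans[OF r n p'(2)] .
      moreover have "fst (p (Suc n)) \<noteq> m" using n p'(2,3)[of n] order_tree_antisym[OF r] by metis
      ultimately show ?thesis using fP by blast
    qed
    then have ray: "tree_ray r P" using path unfolding tree_ray_def by blast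
    have "snd (p m) \<inter> P = {}" for m
    proof (rule ccontr)
      assume "snd (p m) \<inter> P \<noteq> {}"
      then obtain f k where f: "f \<in> snd (p m)" "(f, fst (p k)) \<in> r" unfolding P_def by blast
      \<comment> \<open>A ray in a late set of the play contains the node of stage \<open>k\<close>,
        hence also \<open>f\<close> below it, and yet avoids the nodes forbidden at stage
        \<open>m\<close>.\<close>
      have "\<exists>Q. Q \<in> ?N (p (max m k))" using p'(1)[of "max m k"] by (simp only: ex_in_conv simp_thms)
      then obtain Q where Q: "Q \<in> ?N (p (max m k))" by (elim exE)
      have "Q \<in> ?N (p m)" by (rule subsetD[OF mono[OF max.cobounded1] Q])
      moreover have "Q \<in> ?N (p k)" by (rule subsetD[OF mono[OF max.cobounded2] Q])
      ultimately have "tree_ray r Q" "snd (p m) \<inter> Q = {}" "fst (p k) \<in> Q" unfolding N by auto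
      then show False using f tree_pathD(3)[OF rayD(1), of r Q "fst (p k)" f] by blast
    qed
    then show "\<exists>P. \<forall>n. P \<in> ?N (p n)" unfolding N using ray fP by blast
  qed
qed


section \<open>Connectivity and rays in graphs\<close>

definition gadj :: "'v set set \<Rightarrow> 'v set \<Rightarrow> ('v \<times> 'v) set" where
  "gadj E A = {(u, v). u \<in> A \<and> v \<in> A \<and> {u, v} \<in> E}"

lemma gadj_iff [simp]: "(u, v) \<in> gadj E A \<longleftrightarrow> u \<in> A \<and> v \<in> A \<and> {u, v} \<in> E"
  by (simp add: gadj_def)

definition graph_comp :: "'v set set \<Rightarrow> 'v set \<Rightarrow> 'v \<Rightarrow> 'v set" where
  "graph_comp E A u = {v \<in> A. (u, v) \<in> (gadj E A)\<^sup>*}"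

definition graph_conn :: "'v set set \<Rightarrow> 'v set \<Rightarrow> bool" where
  "graph_conn E A \<longleftrightarrow> (\<forall>u\<in>A. \<forall>v\<in>A. (u, v) \<in> (gadj E A)\<^sup>*)"

definition graph_nb :: "'v set \<Rightarrow> 'v set set \<Rightarrow> 'v set \<Rightarrow> 'v set" where
  "graph_nb V E C = {v \<in> V - C. \<exists>u\<in>C. {u, v} \<in> E}"

text \<open>Regions are the components of \<open>V - S\<close> for finite \<open>S\<close>,
  described without \<open>S\<close>: the neighbourhood of the region itself can serve as
  \<open>S\<close>.\<close>

definition region :: "'v set \<Rightarrow> 'v set set \<Rightarrow> 'v set \<Rightarrow> bool" where
  "region V E C \<longleftrightarrow> C \<noteq> {} \<and> C \<subseteq> V \<and> graph_conn E C \<and> finite (graph_nb V E C)"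

lemma gadj_mono: "A \<subseteq> B \<Longrightarrow> (u, v) \<in> (gadj E A)\<^sup>* \<Longrightarrow> (u, v) \<in> (gadj E B)\<^sup>*"
proof -
  assume "A \<subseteq> B"
  then have "gadj E A \<subseteq> gadj E B" by (auto simp: gadj_def)
  then show "(u, v) \<in> (gadj E A)\<^sup>* \<Longrightarrow> (u, v) \<in> (gadj E B)\<^sup>*" by (rule subsetD[OF rtrancl_mono])
qed

lemma gadj_sym: "(u, v) \<in> (gadj E A)\<^sup>* \<Longrightarrow> (v, u) \<in> (gadj E A)\<^sup>*"
proof -
  have "sym (gadj E A)" by (auto simp: sym_def insert_commute)
  then show "(u, v) \<in> (gadj E A)\<^sup>* \<Longrightarrow> (v, u) \<in> (gadj E A)\<^sup>*" by (meson sym_rtrancl symD)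
qed

lemma gadj_closed:
  assumes "(u, v) \<in> (gadj E A)\<^sup>*" "u \<in> B"
    and cl: "\<And>x y. x \<in> B \<Longrightarrow> x \<in> A \<Longrightarrow> y \<in> A \<Longrightarrow> {x, y} \<in> E \<Longrightarrow> y \<in> B"
  shows "v \<in> B"
  using assms(1,2)
proof (induction rule: rtrancl_induct)
  case (step y z)
  then show ?case using cl[of y z] by simp
qed

lemma gadj_in:
  assumes "(u, v) \<in> (gadj E A)\<^sup>*" "u \<in> A"
  shows "v \<in> A"
  by (rule gadj_closed[OF assms])

lemma graph_connD: "graph_conn E A \<Longrightarrow> u \<in> A \<Longrightarrow> v \<in> A \<Longrightarrow> (u, v) \<in> (gadj E A)\<^sup>*"
  unfolding graph_conn_def by blast

lemma graph_connI:
  assumes "\<And>v. v \<in> A \<Longrightarrow> (u, v) \<in> (gadj E A)\<^sup>*"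
  shows "graph_conn E A"
  unfolding graph_conn_def
proof (intro ballI)
  fix v w assume "v \<in> A" "w \<in> A"
  then show "(v, w) \<in> (gadj E A)\<^sup>*" by (rule rtrancl_trans[OF gadj_sym[OF assms] assms])
qed

lemma graph_comp_subset: "graph_comp E A u \<subseteq> A"
  unfolding graph_comp_def by blast

lemma graph_comp_self: "u \<in> A \<Longrightarrow> u \<in> graph_comp E A u"
  unfolding graph_comp_def by simp

lemma graph_comp_conn:
  assumes "u \<in> A"
  shows "graph_conn E (graph_comp E A u)"
proof (rule graph_connI)
  fix v assume "v \<in> graph_comp E A u"
  then have "(u, v) \<in> (gadj E A)\<^sup>*" unfolding graph_comp_def by simp
  then show "(u, v) \<in> (gadj E (graph_comp E A u))\<^sup>*"
  proof (induction rule: rtrancl_induct)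
    case (step y z)
    have "y \<in> graph_comp E A u" "z \<in> graph_comp E A u"
      using step(1,2) rtrancl_into_rtrancl[OF step(1,2)] unfolding graph_comp_def by auto
    then have "(y, z) \<in> gadj E (graph_comp E A u)" using step(2) by simp
    then show ?case using step(3) by (rule rtrancl_into_rtrancl[rotated])
  qed simp
qed

lemma graph_comp_max:
  assumes "graph_conn E K" "K \<subseteq> A" "x \<in> K" "x \<in> graph_comp E A u"
  shows "K \<subseteq> graph_comp E A u"
proof
  fix v assume v: "v \<in> K"
  have "(x, v) \<in> (gadj E A)\<^sup>*" using gadj_mono[OF assms(2) graph_connD[OF assms(1,3) v]] .
  moreover have "(u, x) \<in> (gadj E A)\<^sup>*" using assms(4) unfolding graph_comp_def by simp
  ultimately show "v \<in> graph_comp E A u"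
    using v assms(2) rtrancl_trans[of u x "gadj E A" v] unfolding graph_comp_def by blast
qed

lemma graph_comp_eq:
  assumes "v \<in> graph_comp E A u"
  shows "graph_comp E A v = graph_comp E A u"
proof -
  have uv: "(u, v) \<in> (gadj E A)\<^sup>*" using assms unfolding graph_comp_def by simp
  have "(u, w) \<in> (gadj E A)\<^sup>* \<longleftrightarrow> (v, w) \<in> (gadj E A)\<^sup>*" for w
    using rtrancl_trans[OF uv] rtrancl_trans[OF gadj_sym[OF uv]] by (rule iffI[rotated])
  then show ?thesis unfolding graph_comp_def by simp
qed

text \<open>A walk can leave \<open>C\<close> only through the neighbourhood of
  \<open>C\<close>.\<close>

lemma conn_avoiding_nb:
  assumes "graph_conn E K" "K \<subseteq> V" "K \<inter> graph_nb V E C = {}" "x \<in> K" "x \<in> C"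
  shows "K \<subseteq> C"
proof
  fix v assume "v \<in> K"
  show "v \<in> C"
  proof (rule gadj_closed[OF graph_connD[OF assms(1,4) \<open>v \<in> K\<close>] assms(5)])
    fix a b assume "a \<in> C" "b \<in> K" "{a, b} \<in> E"
    then show "b \<in> C" using assms(2,3) unfolding graph_nb_def by blast
  qed
qed

lemma nb_meets:
  assumes "graph_conn E C" "C \<subseteq> V" "D \<subset> C" "D \<noteq> {}"
  obtains y where "y \<in> graph_nb V E D" "y \<in> C"
proof -
  have "C \<inter> graph_nb V E D \<noteq> {}"
  proof
    assume *: "C \<inter> graph_nb V E D = {}"
    obtain x where "x \<in> D" using assms(4) by blast
    then have "C \<subseteq> D" using conn_avoiding_nb[OF assms(1,2) *] assms(3) by blast
    then show False using assms(3) by blast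
  qed
  then show thesis using that by blast
qed

text \<open>A neighbour of the component that lies in \<open>C - F\<close> would belong to the
  component itself. What is left are neighbours of \<open>C\<close> and deleted vertices.\<close>

lemma graph_comp_nb:
  "graph_nb V E (graph_comp E (C - F) u) \<subseteq> graph_nb V E C \<union> (F \<inter> C)"
proof
  fix y assume y: "y \<in> graph_nb V E (graph_comp E (C - F) u)"
  then obtain x where x: "x \<in> graph_comp E (C - F) u" "{x, y} \<in> E" "y \<in> V" "y \<notin> graph_comp E (C - F) u"
    unfolding graph_nb_def by blast
  have xC: "x \<in> C - F" "(u, x) \<in> (gadj E (C - F))\<^sup>*" using x(1) unfolding graph_comp_def by auto
  show "y \<in> graph_nb V E C \<union> (F \<inter> C)"
  proof (cases "y \<in> C - F")
    case True
    then have "(x, y) \<in> gadj E (C - F)" using xC(1) x(2) by simp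
    then have "y \<in> graph_comp E (C - F) u" using rtrancl_into_rtrancl[OF xC(2)] True unfolding graph_comp_def by blast
    then show ?thesis using x(4) by blast
  next
    case False
    then show ?thesis using x(2,3) xC(1) unfolding graph_nb_def by blast
  qed
qed

lemma regionD:
  assumes "region V E C"
  shows "C \<noteq> {}" "C \<subseteq> V" "graph_conn E C" "finite (graph_nb V E C)"
  using assms unfolding region_def by blast+

lemma region_comp:
  assumes C: "region V E C" and F: "finite F" and u: "u \<in> C - F"
  shows "region V E (graph_comp E (C - F) u)"
  unfolding region_def
proof (intro conjI)
  show "graph_comp E (C - F) u \<noteq> {}" using graph_comp_self[OF u] by blast
  show "graph_comp E (C - F) u \<subseteq> V" using graph_comp_subset regionD(2)[OF C] by fast
  show "graph_conn E (graph_comp E (C - F) u)" using graph_comp_conn[OF u] .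
  show "finite (graph_nb V E (graph_comp E (C - F) u))"
    by (rule finite_subset[OF graph_comp_nb]) (simp add: regionD(4)[OF C] F)
qed

lemma region_eq_comp:
  assumes C: "region V E C" and u: "u \<in> C"
  shows "graph_comp E (V - graph_nb V E C) u = C"
proof
  have sub: "C \<subseteq> V - graph_nb V E C" using regionD(2)[OF C] unfolding graph_nb_def by blast
  show "C \<subseteq> graph_comp E (V - graph_nb V E C) u"
    using graph_comp_max[OF regionD(3)[OF C] sub u] graph_comp_self u sub by (metis subsetD)
  have uA: "u \<in> V - graph_nb V E C" using u sub by blast
  show "graph_comp E (V - graph_nb V E C) u \<subseteq> C"
  proof (rule conn_avoiding_nb[OF graph_comp_conn[OF uA] _ _ graph_comp_self[OF uA] u])
    show "graph_comp E (V - graph_nb V E C) u \<subseteq> V" using graph_comp_subset[of E "V - graph_nb V E C" u] by blast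
    show "graph_comp E (V - graph_nb V E C) u \<inter> graph_nb V E C = {}"
      using graph_comp_subset[of E "V - graph_nb V E C" u] by blast
  qed
qed

lemma graph_conn_insert:
  assumes K: "graph_conn E K" "y \<in> K" "{y, z} \<in> E"
  shows "graph_conn E (insert z K)"
proof (rule graph_connI)
  fix v assume v: "v \<in> insert z K"
  show "(y, v) \<in> (gadj E (insert z K))\<^sup>*"
  proof (cases "v \<in> K")
    case True
    show ?thesis by (rule gadj_mono[OF subset_insertI graph_connD[OF K(1,2) True]])
  next
    case False
    then show ?thesis using v K by (intro r_into_rtrancl) simp
  qed
qed

lemma finite_connected_subset:
  assumes "(a, x) \<in> (gadj E A)\<^sup>*" "a \<in> A"
  obtains P where "finite P" "P \<subseteq> A" "a \<in> P" "x \<in> P" "graph_conn E P"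
proof -
  have "\<exists>P. finite P \<and> P \<subseteq> A \<and> a \<in> P \<and> x \<in> P \<and> graph_conn E P"
    using assms
  proof (induction rule: rtrancl_induct)
    case base
    then show ?case by (intro exI[of _ "{a}"]) (simp add: graph_conn_def)
  next
    case (step y z)
    then obtain P where "finite P" "P \<subseteq> A" "a \<in> P" "y \<in> P" "graph_conn E P" by blast
    then show ?case using step(2) graph_conn_insert[of E P y z] by (intro exI[of _ "insert z P"]) simp
  qed
  then show thesis using that by blast
qed

lemma graph_conn_Un:
  assumes "graph_conn E A" "graph_conn E B" "x \<in> A" "x \<in> B"
  shows "graph_conn E (A \<union> B)"
proof (rule graph_connI)
  fix v assume "v \<in> A \<union> B"
  then show "(x, v) \<in> (gadj E (A \<union> B))\<^sup>*"
    using gadj_mono[OF Un_upper1 graph_connD[OF assms(1,3)]] gadj_mono[OF Un_upper2 graph_connD[OF assms(2,4)]]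
    by blast
qed

lemma finite_connected_superset:
  assumes C: "graph_conn E C" and S: "finite S" "S \<subseteq> C" "x \<in> C"
  obtains P where "finite P" "P \<subseteq> C" "insert x S \<subseteq> P" "graph_conn E P"
proof -
  have "\<exists>P. finite P \<and> P \<subseteq> C \<and> insert x S \<subseteq> P \<and> graph_conn E P"
    using S(1,2)
  proof (induction rule: finite_induct)
    case empty
    then show ?case using S(3) by (intro exI[of _ "{x}"]) (simp add: graph_conn_def)
  next
    case (insert s S)
    then obtain P where P: "finite P" "P \<subseteq> C" "insert x S \<subseteq> P" "graph_conn E P" by blast
    have s: "s \<in> C" using insert(4) by simp
    obtain Q where Q: "finite Q" "Q \<subseteq> C" "x \<in> Q" "s \<in> Q" "graph_conn E Q"
      by (rule finite_connected_subset[OF graph_connD[OF C S(3) s] S(3)]) (rule that)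
    have xP: "x \<in> P" using P(3) by simp
    show ?case
      using P Q graph_conn_Un[OF P(4) Q(5) xP Q(3)] by (intro exI[of _ "P \<union> Q"]) auto
  qed
  then show thesis using that by blast
qed

section \<open>Constructing rays in graphs\<close>

lemma ray_tail_in_comp:
  assumes \<rho>: "graph_ray V E \<rho>" and A: "\<And>i. i \<ge> j \<Longrightarrow> \<rho> i \<in> A" and "i \<ge> j"
  shows "\<rho> i \<in> graph_comp E A (\<rho> j)"
  using \<open>i \<ge> j\<close>
proof (induction rule: dec_induct)
  case base
  show ?case by (rule graph_comp_self[OF A[OF order_refl]])
next
  case (step i)
  have "{\<rho> i, \<rho> (Suc i)} \<in> E" using \<rho> unfolding graph_ray_def by blast
  then have "(\<rho> i, \<rho> (Suc i)) \<in> gadj E A" using A[OF step(1)] A[OF le_SucI[OF step(1)]] by simp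
  moreover have "(\<rho> j, \<rho> i) \<in> (gadj E A)\<^sup>*" using step(3) unfolding graph_comp_def by simp
  ultimately have "(\<rho> j, \<rho> (Suc i)) \<in> (gadj E A)\<^sup>*" by (rule rtrancl_into_rtrancl[rotated])
  then show ?case using A[OF le_SucI[OF step(1)]] unfolding graph_comp_def by simp
qed

lemma ray_leaves_finite:
  assumes \<rho>: "graph_ray V E \<rho>" and S: "finite S"
  obtains b where "\<And>i. i \<ge> b \<Longrightarrow> \<rho> i \<notin> S"
proof -
  have "inj \<rho>" using \<rho> unfolding graph_ray_def by blast
  with S have "finite (\<rho> -` S)" by (rule finite_vimageI)
  then obtain b where "\<forall>i\<in>\<rho> -` S. i < b" using finite_nat_set_iff_bounded by blast
  then have "\<rho> i \<notin> S" if "i \<ge> b" for i using that by (metis not_le vimageI)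
  then show thesis using that by blast
qed

text \<open>Passing to last visits turns a locally finite walk into a ray.\<close>

lemma ray_from_walk:
  assumes wV: "\<And>i. w i \<in> V" and step: "\<And>i. w (Suc i) = w i \<or> {w i, w (Suc i)} \<in> E"
    and fin: "\<And>v. finite {i. w i = v}"
  obtains \<rho> where "graph_ray V E \<rho>" "\<And>j. \<exists>k\<ge>j. \<rho> j = w k"
proof -
  define L where "L v = Max {i. w i = v}" for v
  have L1: "w (L (w i)) = w i" for i
  proof -
    have "L (w i) \<in> {j. w j = w i}" unfolding L_def by (rule Max_in[OF fin]) blast
    then show ?thesis by simp
  qed
  have L2: "j \<le> L (w i)" if "w j = w i" for i j
    unfolding L_def by (rule Max_ge[OF fin]) (simp add: that)
  \<comment> \<open>After its last visit to a vertex the walk moves to a new one, and the index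
    jumps to the last visit of that vertex. Vertices at last visits are pairwise distinct.\<close>
  define k where "k = rec_nat (L (w 0)) (\<lambda>_ i. L (w (Suc i)))"
  have k0: "k 0 = L (w 0)" and kS: "k (Suc j) = L (w (Suc (k j)))" for j
    unfolding k_def by simp_all
  have kL: "k j = L (w (k j))" for j
    by (cases j) (simp_all only: k0 kS L1)
  have less: "k j < k (Suc j)" for j using L2[of "Suc (k j)" "Suc (k j)"] kS[of j] by simp
  then have smono: "strict_mono k" by (simp add: strict_mono_Suc_iff)
  have "graph_ray V E (\<lambda>j. w (k j))"
    unfolding graph_ray_def
  proof (intro conjI allI)
    show "inj (\<lambda>j. w (k j))"
    proof
      fix i j assume "w (k i) = w (k j)"
      then have "k i = k j" using kL by metis
      then show "i = j" using smono strict_mono_eq by blast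
    qed
    show "range (\<lambda>j. w (k j)) \<subseteq> V" using wV by blast
    fix j
    have "w (k (Suc j)) = w (Suc (k j))" using kS[of j] L1 by simp
    moreover have "w (Suc (k j)) \<noteq> w (k j)" using L2[of "Suc (k j)" "k j"] kL[of j] by auto
    ultimately show "{w (k j), w (k (Suc j))} \<in> E" using step[of "k j"] by simp
  qed
  moreover have "\<exists>i\<ge>j. w (k j) = w i" for j using strict_mono_imp_increasing[OF smono] by blast
  ultimately show thesis using that by blast
qed

text \<open>Finite walks from \<open>y n\<close> to \<open>y (Suc n)\<close> inside
  \<open>K n\<close> are concatenated. Since the sets decrease to the empty set, every vertex is
  visited finitely often, and last visits yield a ray.\<close>

lemma ray_through:
  fixes K :: "nat \<Rightarrow> 'v set"
  assumes dec: "\<And>n. K (Suc n) \<subseteq> K n" and KV: "K 0 \<subseteq> V" and emp: "(\<Inter>n. K n) = {}"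
    and y: "\<And>n. y n \<in> K n" and reach: "\<And>n. (y n, y (Suc n)) \<in> (gadj E (K n))\<^sup>*"
  obtains \<rho> where "graph_ray V E \<rho>" "\<And>n. has_tail_in \<rho> (K n)"
proof -
  have mono: "K n \<subseteq> K m" if "m \<le> n" for m n
    by (rule lift_Suc_antimono_le[of K, OF dec that])
  \<comment> \<open>A state records the stage \<open>n\<close>, the current vertex \<open>v\<close>
    and the number \<open>m\<close> of steps left to \<open>y (Suc n)\<close>. With no steps left
    the stage advances and the walk pauses at \<open>v\<close>.\<close>
  define good where "good s \<longleftrightarrow> (case s of (n, v, m) \<Rightarrow> v \<in> K n \<and> (v, y (Suc n)) \<in> gadj E (K n) ^^ m)"
    for s :: "nat \<times> 'v \<times> nat"
  define nxt where "nxt s s' \<longleftrightarrow> (case s of (n, v, m) \<Rightarrow> case s' of (n', v', m') \<Rightarrow>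
      (m > 0 \<and> n' = n \<and> Suc m' = m \<and> (v, v') \<in> gadj E (K n)) \<or> (m = 0 \<and> n' = Suc n \<and> v' = v))"
    for s s' :: "nat \<times> 'v \<times> nat"
  have init: "\<exists>s. good s \<and> fst s = n \<and> fst (snd s) = y n" for n
  proof -
    obtain m where "(y n, y (Suc n)) \<in> gadj E (K n) ^^ m" using rtrancl_imp_relpow[OF reach] by blast
    then show ?thesis using y unfolding good_def by (intro exI[of _ "(n, y n, m)"]) simp
  qed
  have "\<exists>s'. good s' \<and> nxt s s'" if g: "good s" for s
  proof -
    obtain n v m where s: "s = (n, v, m)" using prod_cases3 by blast
    show ?thesis
    proof (cases m)
      case 0
      then have v: "v = y (Suc n)" using g unfolding s good_def by simp
      obtain s' where "good s'" "fst s' = Suc n" "fst (snd s') = y (Suc n)" using init by blast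
      then show ?thesis using 0 v unfolding s nxt_def by (intro exI[of _ s']) (auto simp: case_prod_beta)
    next
      case (Suc m')
      then have "(v, y (Suc n)) \<in> gadj E (K n) ^^ Suc m'" using g unfolding s good_def by simp
      then obtain v' where "(v, v') \<in> gadj E (K n)" "(v', y (Suc n)) \<in> gadj E (K n) ^^ m'"
        by (rule relpow_Suc_E2)
      then show ?thesis using Suc unfolding s nxt_def good_def by (intro exI[of _ "(n, v', m')"]) simp
    qed
  qed
  then obtain f where f: "\<And>i. good (f i)" "\<And>i. nxt (f i) (f (Suc i))" "fst (f 0) = 0"
    using dependent_nat_choice[of "\<lambda>i s. good s \<and> (i = 0 \<longrightarrow> fst s = 0)" "\<lambda>_. nxt"] init by (metis nat.distinct(1))
  define N where "N i = fst (f i)" for i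
  define w where "w i = fst (snd (f i))" for i
  define M where "M i = snd (snd (f i))" for i
  have wK: "w i \<in> K (N i)" for i using f(1)[of i] unfolding good_def w_def N_def by (simp add: case_prod_beta)
  have st: "(M i > 0 \<and> N (Suc i) = N i \<and> Suc (M (Suc i)) = M i \<and> (w i, w (Suc i)) \<in> gadj E (K (N i))) \<or>
     (M i = 0 \<and> N (Suc i) = Suc (N i) \<and> w (Suc i) = w i)" for i
    using f(2)[of i] unfolding nxt_def w_def N_def M_def by (simp add: case_prod_beta)
  \<comment> \<open>Induction on the number of steps left shows that every stage ends.\<close>
  have prog: "\<exists>j\<ge>i. N j = Suc (N i)" for i
  proof (induction "M i" arbitrary: i)
    case 0
    then show ?case using st[of i] by (intro exI[of _ "Suc i"]) simp
  next
    case (Suc m)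
    then have "m = M (Suc i)" "N (Suc i) = N i" using st[of i] by auto
    then obtain j where "j \<ge> Suc i" "N j = Suc (N i)" using Suc(1)[of "Suc i"] by auto
    then show ?case by (intro exI[of _ j]) simp
  qed
  have reachN: "\<exists>i. N i = n" for n
  proof (induction n)
    case 0
    show ?case using f(3) unfolding N_def by (rule exI)
  next
    case (Suc n)
    then show ?case using prog by metis
  qed
  have Nmono: "N i \<le> N j" if "i \<le> j" for i j
    by (rule lift_Suc_mono_le[OF _ that]) (use st in \<open>metis le_SucI order_refl\<close>)
  have late: "\<exists>i. \<forall>j\<ge>i. w j \<in> K n" for n
  proof -
    obtain i where "N i = n" using reachN by blast
    then have "w j \<in> K n" if "j \<ge> i" for j using wK[of j] mono[of n "N j"] Nmono[OF that] by blast
    then show ?thesis by blast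
  qed
  obtain \<rho> where \<rho>: "graph_ray V E \<rho>" "\<And>j. \<exists>k\<ge>j. \<rho> j = w k"
  proof (rule ray_from_walk[of w V E])
    show "w i \<in> V" for i using wK[of i] mono[of 0 "N i"] KV by blast
    show "w (Suc i) = w i \<or> {w i, w (Suc i)} \<in> E" for i using st[of i] by auto
    fix v
    obtain n where "v \<notin> K n" using emp by blast
    moreover obtain i where "\<forall>j\<ge>i. w j \<in> K n" using late by blast
    ultimately have "{j. w j = v} \<subseteq> {..<i}" by (auto simp: not_le[symmetric])
    then show "finite {i. w i = v}" by (rule finite_subset) simp
  qed (rule that)
  have "has_tail_in \<rho> (K n)" for n
  proof -
    obtain i where i: "\<forall>j\<ge>i. w j \<in> K n" using late by blast
    have "\<rho> j \<in> K n" if "j \<ge> i" for j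
    proof -
      obtain k where "k \<ge> j" "\<rho> j = w k" using \<rho>(2) by blast
      then show ?thesis using i that by simp
    qed
    then show ?thesis unfolding has_tail_in_def by blast
  qed
  then show thesis using that \<rho>(1) by blast
qed


section \<open>Chains of regions\<close>

lemma decreasing_differences_inj:
  fixes G :: "nat \<Rightarrow> 'a set"
  assumes dec: "\<And>n. G (Suc n) \<subseteq> G n" and y: "\<And>n. y n \<in> G n" "\<And>n. y n \<notin> G (Suc n)"
  shows "inj y"
proof -
  have "y m \<noteq> y n" if "m < n" for m n
  proof -
    have "G n \<subseteq> G (Suc m)" by (rule lift_Suc_antimono_le[of G, OF dec]) (use that in simp)
    then show ?thesis using y(1)[of n] y(2)[of m] by auto
  qed
  then show ?thesis by (metis injI linorder_neqE_nat)
qed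

text \<open>Finiteness of the neighbourhoods rules out chains of uncountable coinitiality.\<close>

lemma region_chain_coinitial_sequence:
  assumes ne: "CC \<noteq> {}" and reg: "\<And>C. C \<in> CC \<Longrightarrow> region V E C"
    and chain: "\<And>C D. C \<in> CC \<Longrightarrow> D \<in> CC \<Longrightarrow> C \<subseteq> D \<or> D \<subseteq> C"
  shows "\<exists>C :: nat \<Rightarrow> 'v set. (\<forall>n. C n \<in> CC) \<and> (\<forall>D\<in>CC. \<exists>n. C n \<subseteq> D)"
proof (rule ccontr)
  assume no: "\<not> ?thesis"
  \<comment> \<open>Without a coinitial sequence, each sequence in the chain has a member strictly
    below all of its terms.\<close>
  have lb: "\<exists>D\<in>CC. \<forall>n. D \<subset> C n" if C: "\<And>n. C n \<in> CC" for C :: "nat \<Rightarrow> 'v set"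
  proof -
    have "\<not> (\<forall>D\<in>CC. \<exists>n. C n \<subseteq> D)"
    proof
      assume "\<forall>D\<in>CC. \<exists>n. C n \<subseteq> D"
      then have "\<exists>C :: nat \<Rightarrow> 'v set. (\<forall>n. C n \<in> CC) \<and> (\<forall>D\<in>CC. \<exists>n. C n \<subseteq> D)"
        using C by (intro exI[of _ C] conjI allI)
      then show False using no by (rule notE[rotated])
    qed
    then obtain D where D: "D \<in> CC" "\<And>n. \<not> C n \<subseteq> D" by blast
    have "D \<subset> C n" for n using chain[OF C D(1), of n] D(2)[of n] by blast
    then show ?thesis using D(1) by blast
  qed
  show False
  proof (cases "\<exists>g\<in>CC. \<forall>e\<in>CC. \<exists>D\<in>CC. D \<subset> e \<and> graph_nb V E D \<inter> g \<subseteq> e")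
    \<comment> \<open>Here one can descend from any \<open>e\<close> to a \<open>D\<close> all of
      whose neighbours in \<open>g\<close> lie in \<open>e\<close>. Along such a descent, the traces
      on \<open>g\<close> of the neighbourhoods occupy disjoint layers
      \<open>D n - D (Suc n)\<close>, and a finite path from outside of the descent to a lower bound
      must meet all of them.\<close>
    case True
    then obtain g where g: "g \<in> CC" "\<And>e. e \<in> CC \<Longrightarrow> \<exists>D\<in>CC. D \<subset> e \<and> graph_nb V E D \<inter> g \<subseteq> e" by meson
    obtain D0 where D0: "D0 \<in> CC" "D0 \<subset> g" using g(2)[OF g(1)] by meson
    have "\<exists>D :: nat \<Rightarrow> 'v set. \<forall>n. (D n \<in> CC \<and> (n = 0 \<longrightarrow> D n = D0)) \<and> (D (Suc n) \<subset> D n \<and> graph_nb V E (D (Suc n)) \<inter> g \<subseteq> D n)"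
    proof (rule dependent_nat_choice)
      show "\<exists>x. x \<in> CC \<and> ((0::nat) = 0 \<longrightarrow> x = D0)" using D0(1) by blast
      show "\<exists>y. (y \<in> CC \<and> (Suc n = 0 \<longrightarrow> y = D0)) \<and> y \<subset> x \<and> graph_nb V E y \<inter> g \<subseteq> x"
        if "x \<in> CC \<and> (n = 0 \<longrightarrow> x = D0)" for x n
        using g(2)[of x] that by (meson nat.distinct(2))
    qed
    then obtain D :: "nat \<Rightarrow> 'v set" where Dall: "\<forall>n. (D n \<in> CC \<and> (n = 0 \<longrightarrow> D n = D0)) \<and>
      (D (Suc n) \<subset> D n \<and> graph_nb V E (D (Suc n)) \<inter> g \<subseteq> D n)" by (rule exE)
    then have D: "D n \<in> CC" "D 0 = D0" "D (Suc n) \<subset> D n" "graph_nb V E (D (Suc n)) \<inter> g \<subseteq> D n" for n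
      by simp_all
    obtain D\<omega> where D\<omega>: "D\<omega> \<in> CC" "\<And>n. D\<omega> \<subset> D n" using lb[of D, OF D(1)] by meson
    obtain x where x: "x \<in> D\<omega>" using regionD(1)[OF reg[OF D\<omega>(1)]] by blast
    obtain a where a: "a \<in> g" "a \<notin> D0" using D0(2) by blast
    have xg: "x \<in> g" using x D\<omega>(2)[of 0] D(2) D0(2) by blast
    obtain P where P: "finite P" "P \<subseteq> g" "a \<in> P" "x \<in> P" "graph_conn E P"
      by (rule finite_connected_subset[OF graph_connD[OF regionD(3)[OF reg[OF g(1)]] a(1) xg] a(1)]) (rule that)
    have PV: "P \<subseteq> V" using P(2) regionD(2)[OF reg[OF g(1)]] by blast
    have D0n: "D n \<subseteq> D0" for n
    proof (induction n)
      case (Suc n)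
      then show ?case using D(3)[of n] by blast
    qed (simp add: D(2))
    \<comment> \<open>\<open>P\<close> joins \<open>a\<close>, outside of \<open>D0\<close>, to
      \<open>x\<close>, inside of every \<open>D n\<close>, so it crosses the neighbourhood of each
      of them.\<close>
    have "\<exists>y. y \<in> P \<and> y \<in> graph_nb V E (D (Suc n))" for n
    proof (rule ccontr)
      assume *: "\<not> ?thesis"
      have "P \<subseteq> D (Suc n)"
        by (rule conn_avoiding_nb[OF P(5) PV _ P(4)]) (use * x D\<omega>(2)[of "Suc n"] in auto)
      then show False using P(3) a(2) D0n by blast
    qed
    then obtain y where y: "\<And>n. y n \<in> P" "\<And>n. y n \<in> graph_nb V E (D (Suc n))" by metis
    have "inj y"
    proof (rule decreasing_differences_inj[of D])
      show "D (Suc n) \<subseteq> D n" for n using D(3)[of n] by blast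
      show "y n \<in> D n" for n using D(4)[of n] y[of n] P(2) by blast
      show "y n \<notin> D (Suc n)" for n using y(2)[of n] unfolding graph_nb_def by blast
    qed
    moreover have "range y \<subseteq> P" using y(1) by blast
    ultimately show False using P(1) finite_subset infinite_UNIV_nat finite_imageD by metis
  next
    \<comment> \<open>Now every \<open>g\<close> has an \<open>e\<close> such that each member
      strictly below \<open>e\<close> has a neighbour in \<open>g - e\<close>. Iterating gives
      \<open>g n\<close>, and a member below all of them has a neighbour in every layer
      \<open>g n - g (Suc n)\<close>, infinitely many in all.\<close>
    case False
    have "\<exists>e\<in>CC. e \<subseteq> g \<and> (\<forall>D\<in>CC. D \<subset> e \<longrightarrow> \<not> graph_nb V E D \<inter> g \<subseteq> e)" if g: "g \<in> CC" for g
    proof -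
      have "\<not> (\<forall>e\<in>CC. \<exists>D\<in>CC. D \<subset> e \<and> graph_nb V E D \<inter> g \<subseteq> e)"
        using notE[OF False bexI[OF _ g]] by (rule notI)
      then obtain e where e: "e \<in> CC" "\<forall>D\<in>CC. D \<subset> e \<longrightarrow> \<not> graph_nb V E D \<inter> g \<subseteq> e" by meson
      show ?thesis
      proof (cases "e \<subseteq> g")
        case True
        then show ?thesis using e by blast
      next
        case False
        \<comment> \<open>In this case any trace on \<open>g\<close> lies in \<open>e\<close>
          trivially, so a member strictly below \<open>g\<close> contradicts the choice of
          \<open>e\<close>.\<close>
        then have "g \<subseteq> e" using chain[OF g e(1)] by blast
        moreover obtain D where D: "D \<in> CC" "D \<subset> g" using lb[of "\<lambda>_. g"] g by meson
        ultimately have "D \<subset> e" "graph_nb V E D \<inter> g \<subseteq> e" by blast+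
        then show ?thesis using e(2) D(1) by meson
      qed
    qed
    moreover obtain g0 where "g0 \<in> CC" using ne by blast
    ultimately have "\<exists>g. \<forall>n :: nat. g n \<in> CC \<and> (g (Suc n) \<subseteq> g n \<and>
        (\<forall>D\<in>CC. D \<subset> g (Suc n) \<longrightarrow> \<not> graph_nb V E D \<inter> g n \<subseteq> g (Suc n)))"
      by (intro dependent_nat_choice) meson+
    then obtain g :: "nat \<Rightarrow> 'v set" where gall: "\<forall>n. g n \<in> CC \<and> (g (Suc n) \<subseteq> g n \<and>
        (\<forall>D\<in>CC. D \<subset> g (Suc n) \<longrightarrow> \<not> graph_nb V E D \<inter> g n \<subseteq> g (Suc n)))" by (rule exE)
    then have g: "g n \<in> CC" "g (Suc n) \<subseteq> g n"
      "D \<in> CC \<Longrightarrow> D \<subset> g (Suc n) \<Longrightarrow> \<not> graph_nb V E D \<inter> g n \<subseteq> g (Suc n)" for n D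
      by simp_all
    obtain D where D: "D \<in> CC" "\<And>n. D \<subset> g n" using lb[of g, OF g(1)] by meson
    have "\<exists>y. y \<in> graph_nb V E D \<and> y \<in> g n \<and> y \<notin> g (Suc n)" for n using g(3)[OF D(1) D(2)] by blast
    then obtain y where y: "\<And>n. y n \<in> graph_nb V E D" "\<And>n. y n \<in> g n" "\<And>n. y n \<notin> g (Suc n)" by metis
    have "inj y" by (rule decreasing_differences_inj[of g, OF g(2) y(2,3)])
    moreover have "range y \<subseteq> graph_nb V E D" using y(1) by blast
    ultimately show False using regionD(4)[OF reg[OF D(1)]] finite_subset infinite_UNIV_nat finite_imageD by metis
  qed
qed

text \<open>Coherence forces the neighbourhoods inside \<open>B\<close> of the members of the chain to be connected to
  each other above the intersection of the chain; this is what produces a ray along the chain.\<close>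

definition coherent_chain :: "'v set \<Rightarrow> 'v set set \<Rightarrow> 'v set set \<Rightarrow> bool" where
  "coherent_chain V E CC \<longleftrightarrow>
     (\<forall>C\<in>CC. \<forall>D\<in>CC. C \<subseteq> D \<or> D \<subseteq> C) \<and>
     (\<forall>B\<in>CC. \<forall>C\<in>CC. \<forall>C1\<in>CC. \<forall>C2\<in>CC. \<forall>y1\<in>graph_nb V E C1 \<inter> B. \<forall>y2\<in>graph_nb V E C2 \<inter> B.
        C \<subseteq> C1 \<and> C1 \<subset> B \<and> C \<subseteq> C2 \<and> C2 \<subset> B \<longrightarrow> (y1, y2) \<in> (gadj E (B - C))\<^sup>*)"

text \<open>The condition under which \<open>D\<close> may be added below a coherent chain. Joining
  every neighbour to one hub \<open>z\<close> per \<open>B\<close> replaces the pairwise connections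
  required by coherence.\<close>

definition chain_hubs :: "'v set \<Rightarrow> 'v set set \<Rightarrow> 'v set set \<Rightarrow> 'v set \<Rightarrow> bool" where
  "chain_hubs V E CC D \<longleftrightarrow>
     (\<forall>B\<in>CC. \<exists>z. \<forall>C\<in>insert D CC. \<forall>y\<in>graph_nb V E C \<inter> B. C \<subset> B \<longrightarrow> (z, y) \<in> (gadj E (B - D))\<^sup>*)"

lemma coherent_chainD:
  assumes "coherent_chain V E CC"
  shows "C \<in> CC \<Longrightarrow> D \<in> CC \<Longrightarrow> C \<subseteq> D \<or> D \<subseteq> C"
    and "\<lbrakk>B \<in> CC; C \<in> CC; C1 \<in> CC; C2 \<in> CC; y1 \<in> graph_nb V E C1; y1 \<in> B; y2 \<in> graph_nb V E C2; y2 \<in> B;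
      C \<subseteq> C1; C1 \<subset> B; C \<subseteq> C2; C2 \<subset> B\<rbrakk> \<Longrightarrow> (y1, y2) \<in> (gadj E (B - C))\<^sup>*"
proof -
  show "C \<in> CC \<Longrightarrow> D \<in> CC \<Longrightarrow> C \<subseteq> D \<or> D \<subseteq> C" using assms unfolding coherent_chain_def by blast
  note * = conjunct2[OF assms[unfolded coherent_chain_def], rule_format]
  show "\<lbrakk>B \<in> CC; C \<in> CC; C1 \<in> CC; C2 \<in> CC; y1 \<in> graph_nb V E C1; y1 \<in> B; y2 \<in> graph_nb V E C2; y2 \<in> B;
      C \<subseteq> C1; C1 \<subset> B; C \<subseteq> C2; C2 \<subset> B\<rbrakk> \<Longrightarrow> (y1, y2) \<in> (gadj E (B - C))\<^sup>*"
    by (rule *[of B C C1 C2]) simp_all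
qed

lemma region_nb_meets:
  assumes "region V E C" "D \<subset> C" "D \<noteq> {}"
  shows "\<exists>y. y \<in> graph_nb V E D \<and> y \<in> C"
  by (rule nb_meets[OF regionD(3)[OF assms(1)] regionD(2)[OF assms(1)] assms(2,3)], rule exI, rule conjI)

lemma coherent_chain_insert:
  assumes CC: "coherent_chain V E CC" and D: "\<And>C. C \<in> CC \<Longrightarrow> D \<subset> C" and hub: "chain_hubs V E CC D"
  shows "coherent_chain V E (insert D CC)"
  unfolding coherent_chain_def
proof (intro conjI ballI impI)
  show "A \<subseteq> B \<or> B \<subseteq> A" if "A \<in> insert D CC" "B \<in> insert D CC" for A B
    using that D[of A] D[of B] coherent_chainD(1)[OF CC, of A B] by blast
  fix B C C1 C2 y1 y2
  assume m: "B \<in> insert D CC" "C \<in> insert D CC" "C1 \<in> insert D CC" "C2 \<in> insert D CC"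
    and y: "y1 \<in> graph_nb V E C1 \<inter> B" "y2 \<in> graph_nb V E C2 \<inter> B"
    and le: "C \<subseteq> C1 \<and> C1 \<subset> B \<and> C \<subseteq> C2 \<and> C2 \<subset> B"
  have B: "B \<in> CC" using m(1,3) le D[of C1] by blast
  show "(y1, y2) \<in> (gadj E (B - C))\<^sup>*"
  proof (cases "C = D")
    case True
    obtain z where z: "\<forall>C\<in>insert D CC. \<forall>y\<in>graph_nb V E C \<inter> B. C \<subset> B \<longrightarrow> (z, y) \<in> (gadj E (B - D))\<^sup>*"
      using hub B unfolding chain_hubs_def by (rule bspec[elim_format]) (elim exE)
    have "(z, y1) \<in> (gadj E (B - D))\<^sup>*" "(z, y2) \<in> (gadj E (B - D))\<^sup>*"
      using z m(3,4) y le by blast+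
    then show ?thesis unfolding True by (rule rtrancl_trans[OF gadj_sym])
  next
    case False
    then have "C \<in> CC" using m(2) by blast
    then have "C1 \<in> CC" "C2 \<in> CC" using D[of C] m(3,4) le by blast+
    then show ?thesis using coherent_chainD(2)[OF CC B \<open>C \<in> CC\<close>, of C1 C2 y1 y2] y le by simp
  qed
qed

text \<open>A chain with a least member \<open>C\<close> is continued by a component of
  \<open>C - {x}\<close>. The only neighbour of such a component inside \<open>C\<close> is
  \<open>x\<close>, so \<open>x\<close> is chosen adjacent to a neighbour \<open>y0\<close> of
  \<open>C\<close> that lies in all larger members; \<open>y0\<close> then serves as their common
  hub.\<close>

lemma coherent_chain_below_minimum:
  assumes CC: "coherent_chain V E CC" and reg: "\<And>C. C \<in> CC \<Longrightarrow> region V E C"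
    and C: "C \<in> CC" "\<And>D. D \<in> CC \<Longrightarrow> C \<subseteq> D"
  obtains x where "x \<in> C" "\<And>u. u \<in> C - {x} \<Longrightarrow> chain_hubs V E CC (graph_comp E (C - {x}) u)"
proof -
  have "\<exists>x\<in>C. \<forall>B\<in>CC. B \<noteq> C \<longrightarrow> (\<exists>y0\<in>graph_nb V E C \<inter> B. {y0, x} \<in> E)"
  proof (cases "CC = {C}")
    case True
    then show ?thesis using regionD(1)[OF reg[OF C(1)]] by blast
  next
    case False
    then obtain B1 where B1: "B1 \<in> CC - {C}" using C(1) by blast
    \<comment> \<open>The neighbourhood of \<open>C\<close> is finite and its traces on the chain
      are nested, so a trace of least cardinality is contained in all larger members.\<close>
    obtain B0 where B0: "B0 \<in> CC - {C}"
      "\<And>B. B \<in> CC - {C} \<Longrightarrow> card (graph_nb V E C \<inter> B0) \<le> card (graph_nb V E C \<inter> B)"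
      using ex_has_least_nat[of "\<lambda>B. B \<in> CC - {C}" B1 "\<lambda>B. card (graph_nb V E C \<inter> B)"] B1 by blast
    have sub: "graph_nb V E C \<inter> B0 \<subseteq> B" if B: "B \<in> CC - {C}" for B
    proof (cases "B0 \<subseteq> B")
      case False
      then have "graph_nb V E C \<inter> B \<subseteq> graph_nb V E C \<inter> B0"
        using coherent_chainD(1)[OF CC, of B B0] B B0(1) by blast
      moreover have "finite (graph_nb V E C \<inter> B0)" using regionD(4)[OF reg[OF C(1)]] by blast
      ultimately have "graph_nb V E C \<inter> B = graph_nb V E C \<inter> B0"
        using card_seteq[of "graph_nb V E C \<inter> B0" "graph_nb V E C \<inter> B"] B0(2)[OF B] by simp
      then show ?thesis by blast
    qed blast
    have "C \<subset> B0" using C(2) B0(1) by blast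
    moreover have "region V E B0" using reg B0(1) by blast
    ultimately obtain y0 where y0: "y0 \<in> graph_nb V E C" "y0 \<in> B0"
      using region_nb_meets[of V E B0 C] regionD(1)[OF reg[OF C(1)]] by blast
    then obtain x where "x \<in> C" "{x, y0} \<in> E" unfolding graph_nb_def by blast
    then show ?thesis using y0 sub by (intro bexI[of _ x] ballI impI bexI[of _ y0]) (auto simp: insert_commute)
  qed
  then obtain x where x: "x \<in> C" "\<And>B. B \<in> CC \<Longrightarrow> B \<noteq> C \<Longrightarrow> \<exists>y0\<in>graph_nb V E C \<inter> B. {y0, x} \<in> E" by blast
  have "chain_hubs V E CC (graph_comp E (C - {x}) u)" if u: "u \<in> C - {x}" for u
    unfolding chain_hubs_def
  proof
    let ?D = "graph_comp E (C - {x}) u"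
    have DC: "?D \<subseteq> C - {x}" by (rule graph_comp_subset)
    have nbD: "graph_nb V E ?D \<subseteq> insert x (graph_nb V E C)" using graph_comp_nb[of V E C "{x}" u] by blast
    have low: "C1 = C" if "C1 \<in> CC" "C1 \<subseteq> C" for C1 using C(2)[OF that(1)] that(2) by blast
    fix B assume B: "B \<in> CC"
    show "\<exists>z. \<forall>C1\<in>insert ?D CC. \<forall>y\<in>graph_nb V E C1 \<inter> B. C1 \<subset> B \<longrightarrow> (z, y) \<in> (gadj E (B - ?D))\<^sup>*"
    proof (cases "B = C")
      case True
      \<comment> \<open>Inside \<open>C\<close> itself there is only one neighbour to connect, so
        \<open>x\<close> is its own hub.\<close>
      have "y = x" if "C1 \<in> insert ?D CC" "y \<in> graph_nb V E C1 \<inter> B" "C1 \<subset> B" for C1 y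
      proof -
        have "C1 = ?D" using that(1,3) low[of C1] True by blast
        then have "y \<in> insert x (graph_nb V E C)" "y \<in> C" using that(2) nbD True by blast+
        then show ?thesis unfolding graph_nb_def by blast
      qed
      then show ?thesis by (intro exI[of _ x]) auto
    next
      case False
      obtain y0 where y0: "y0 \<in> graph_nb V E C" "y0 \<in> B" "{y0, x} \<in> E" using x(2)[OF B False] by blast
      have CB: "C \<subset> B" using C(2)[OF B] False by blast
      have y0C: "y0 \<notin> C" using y0(1) unfolding graph_nb_def by blast
      have old: "(y0, y) \<in> (gadj E (B - ?D))\<^sup>*"
        if "C1 \<in> CC" "y \<in> graph_nb V E C1" "y \<in> B" "C1 \<subset> B" for C1 y
      proof (rule gadj_mono)
        show "B - C \<subseteq> B - ?D" using DC by blast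
        show "(y0, y) \<in> (gadj E (B - C))\<^sup>*"
          using coherent_chainD(2)[OF CC B C(1) C(1) that(1) y0(1,2) that(2,3) _ CB C(2)[OF that(1)] that(4)] by blast
      qed
      have "(y0, y) \<in> (gadj E (B - ?D))\<^sup>*"
        if C1: "C1 \<in> insert ?D CC" "y \<in> graph_nb V E C1 \<inter> B" "C1 \<subset> B" for C1 y
      proof (cases "C1 \<in> CC")
        case True
        then show ?thesis using old C1 by blast
      next
        case False
        then have y: "y \<in> insert x (graph_nb V E C)" "y \<in> B" using C1 nbD by blast+
        show ?thesis
        proof (cases "y = x")
          case True
          have "x \<notin> ?D" "y0 \<notin> ?D" using DC y0C by blast+
          then have "(y0, x) \<in> gadj E (B - ?D)" using y(2) True y0 by simp
          then show ?thesis unfolding True by (rule r_into_rtrancl)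
        next
          case False
          then show ?thesis using old[OF C(1)] y CB by blast
        qed
      qed
      then show ?thesis by blast
    qed
  qed
  then show thesis using that x(1) by blast
qed

lemma decreasing_finite_stabilises:
  fixes N :: "nat \<Rightarrow> 'a set"
  assumes dec: "\<And>n. N (Suc n) \<subseteq> N n" and fin: "\<And>n. finite (N n)"
  obtains m where "\<And>n. n \<ge> m \<Longrightarrow> N n = N m"
proof -
  obtain m where m: "\<And>n. card (N m) \<le> card (N n)"
    using ex_has_least_nat[of "\<lambda>_. True" 0 "\<lambda>n. card (N n)"] by blast
  have "N n = N m" if "n \<ge> m" for n
    by (rule card_seteq[OF fin lift_Suc_antimono_le[of N, OF dec that] m])
  then show thesis using that by blast
qed

text \<open>Without a least member, coherence yields a ray along the chain, and \<open>ray\<close> a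
  finite set \<open>S\<close> separating bad sets from its end. Around the ray there are sets
  avoiding \<open>S\<close> whose neighbours inside the chain eventually stay fixed and lie in the
  intersection \<open>I\<close>. Deleting these neighbours leaves a bad component away from the ray,
  and this component falls into \<open>I\<close>.\<close>

lemma coherent_chain_below_limit:
  fixes C :: "nat \<Rightarrow> 'v set"
  assumes CC: "coherent_chain V E CC" and bad: "\<And>B. B \<in> CC \<Longrightarrow> Bad B"
    and reg: "\<And>B. Bad B \<Longrightarrow> region V E B"
    and split: "\<And>B F. Bad B \<Longrightarrow> finite F \<Longrightarrow> \<exists>u\<in>B - F. Bad (graph_comp E (B - F) u)"
    and ray: "\<And>\<rho>. graph_ray V E \<rho> \<Longrightarrow> \<exists>S. finite S \<and> (\<forall>B. Bad B \<and> has_tail_in \<rho> B \<longrightarrow> B \<inter> S \<noteq> {})"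
    and C: "\<And>n. C n \<in> CC" "\<And>B. B \<in> CC \<Longrightarrow> \<exists>n. C n \<subseteq> B" "\<And>n. C (Suc n) \<subset> C n"
  obtains D where "Bad D" "\<And>B. B \<in> CC \<Longrightarrow> D \<subset> B" "chain_hubs V E CC D"
proof -
  define I where "I = (\<Inter>n. C n)"
  have IC: "I \<subseteq> C n" for n unfolding I_def by blast
  have regC: "region V E (C n)" for n by (rule reg[OF bad[OF C(1)]])
  have mono: "C n \<subseteq> C m" if "m \<le> n" for m n
    by (rule lift_Suc_antimono_le[of C, OF _ that]) (use C(3) in blast)
  have "\<exists>z. z \<in> graph_nb V E (C (Suc n)) \<and> z \<in> C n" for n
    by (rule region_nb_meets[OF regC C(3) regionD(1)[OF regC]])
  then obtain y where y: "\<And>n. y n \<in> graph_nb V E (C (Suc n))" "\<And>n. y n \<in> C n" by metis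
  have yI: "y n \<in> C n - I" for n using y IC[of "Suc n"] unfolding graph_nb_def by blast
  \<comment> \<open>Coherence is applied with a member \<open>C l\<close> below both
    \<open>C1\<close> and \<open>C (Suc n)\<close>. The path obtained avoids \<open>C l\<close>,
    hence also \<open>I\<close>.\<close>
  have hub: "(y n, z) \<in> (gadj E (B - I))\<^sup>*"
    if B: "B \<in> CC" "C n \<subseteq> B" and C1: "C1 \<in> CC" "C1 \<subset> B" and z: "z \<in> graph_nb V E C1" "z \<in> B" for B C1 n z
  proof -
    obtain k where k: "C k \<subseteq> C1" using C(2)[OF C1(1)] by blast
    define l where "l = max k (Suc n)"
    have l: "C l \<subseteq> C1" "C l \<subseteq> C (Suc n)" using k mono[of k l] mono[of "Suc n" l] unfolding l_def by auto
    have "C (Suc n) \<subset> B" using C(3)[of n] B(2) by blast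
    then have "(y n, z) \<in> (gadj E (B - C l))\<^sup>*"
      using coherent_chainD(2)[OF CC B(1) C(1)[of l] C(1)[of "Suc n"] C1(1) y(1) _ z l(2) _ l(1) C1(2)]
        y(2)[of n] B(2) by blast
    then show ?thesis by (rule gadj_mono[rotated]) (use IC[of l] in blast)
  qed
  \<comment> \<open>The part of \<open>C n\<close> above the intersection in which the ray will run.
    By \<open>hub\<close> it contains every neighbour in \<open>C n\<close> of a member strictly
    below \<open>C n\<close>.\<close>
  define K where "K n = graph_comp E (C n - I) (y n)" for n
  have Ksub: "K n \<subseteq> C n - I" for n unfolding K_def by (rule graph_comp_subset)
  have Kconn: "graph_conn E (K n)" for n unfolding K_def by (rule graph_comp_conn[OF yI])
  have yK: "y n \<in> K n" for n unfolding K_def by (rule graph_comp_self[OF yI])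
  have hubK: "z \<in> K n" if "C1 \<in> CC" "C1 \<subset> C n" "z \<in> graph_nb V E C1" "z \<in> C n" for C1 z n
  proof -
    have "(y n, z) \<in> (gadj E (C n - I))\<^sup>*" using hub[OF C(1) order_refl that] .
    then show ?thesis using gadj_in[OF _ yI] unfolding K_def graph_comp_def by blast
  qed
  have yK': "y (Suc n) \<in> K n" for n
  proof (rule hubK[OF C(1) _ y(1)])
    show "C (Suc (Suc n)) \<subset> C n" using C(3)[of n] C(3)[of "Suc n"] by blast
    show "y (Suc n) \<in> C n" using y(2)[of "Suc n"] C(3)[of n] by blast
  qed
  have Kdec: "K (Suc n) \<subseteq> K n" for n
    unfolding K_def[of n]
  proof (rule graph_comp_max[OF Kconn _ yK])
    show "K (Suc n) \<subseteq> C n - I" using Ksub[of "Suc n"] C(3)[of n] by blast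
    show "y (Suc n) \<in> graph_comp E (C n - I) (y n)" using yK'[of n] unfolding K_def .
  qed
  obtain \<rho> where \<rho>: "graph_ray V E \<rho>" "\<And>n. has_tail_in \<rho> (K n)"
  proof (rule ray_through[of K V y E, OF Kdec _ _ yK])
    show "K 0 \<subseteq> V" using Ksub[of 0] regionD(2)[OF regC, of 0] by blast
    show "(\<Inter>n. K n) = {}" using Ksub unfolding I_def by blast
    show "(y n, y (Suc n)) \<in> (gadj E (K n))\<^sup>*" for n by (rule graph_connD[OF Kconn yK yK'])
  qed (rule that)
  obtain S where S: "finite S" "\<And>B. Bad B \<Longrightarrow> has_tail_in \<rho> B \<Longrightarrow> B \<inter> S \<noteq> {}" using ray[OF \<rho>(1)] by blast
  have "\<exists>j. \<forall>i\<ge>j. \<rho> i \<in> K n \<and> \<rho> i \<notin> S" for n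
  proof -
    obtain j where j: "\<forall>i\<ge>j. \<rho> i \<in> K n" using \<rho>(2)[of n] unfolding has_tail_in_def by blast
    obtain b where b: "\<And>i. i \<ge> b \<Longrightarrow> \<rho> i \<notin> S" by (rule ray_leaves_finite[OF \<rho>(1) S(1)]) (rule that)
    have "\<rho> i \<in> K n \<and> \<rho> i \<notin> S" if "i \<ge> max j b" for i
      using j b that by simp
    then show ?thesis by blast
  qed
  then obtain J where J: "\<And>n i. i \<ge> J n \<Longrightarrow> \<rho> i \<in> K n \<and> \<rho> i \<notin> S" by metis
  have J': "\<rho> i \<in> C n - S" if "i \<ge> J n" for n i using J[OF that] Ksub by blast
  \<comment> \<open>The side of the ray in \<open>C n\<close> after deleting \<open>S\<close>. Its
    neighbours inside \<open>C n\<close>, collected in \<open>N n\<close>, all belong to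
    \<open>S\<close>.\<close>
  define U where "U n = graph_comp E (C n - S) (\<rho> (J n))" for n
  have Usub: "U n \<subseteq> C n - S" for n unfolding U_def by (rule graph_comp_subset)
  have Uconn: "graph_conn E (U n)" for n unfolding U_def by (rule graph_comp_conn[OF J'[OF order_refl]])
  have UV: "U n \<subseteq> V" for n using Usub[of n] regionD(2)[OF regC, of n] by blast
  have tailU: "\<rho> i \<in> U n" if "i \<ge> J n" for n i
    unfolding U_def by (rule ray_tail_in_comp[OF \<rho>(1) J' that])
  have Udec: "U (Suc n) \<subseteq> U n" for n
  proof -
    let ?i = "max (J n) (J (Suc n))"
    have "U (Suc n) \<subseteq> C n - S" using Usub[of "Suc n"] C(3)[of n] by blast
    moreover have "\<rho> ?i \<in> U (Suc n)" "\<rho> ?i \<in> U n" using tailU by simp_all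
    ultimately show ?thesis using graph_comp_max[OF Uconn] unfolding U_def[of n] by blast
  qed
  have Umono: "U n \<subseteq> U m" if "m \<le> n" for m n
    by (rule lift_Suc_antimono_le[of U, OF Udec that])
  define N where "N n = graph_nb V E (U n) \<inter> C n" for n
  have NS: "N n \<subseteq> S" for n
  proof
    fix z assume "z \<in> N n"
    then have "z \<in> graph_nb V E (C n) \<union> (S \<inter> C n)" "z \<in> C n"
      using graph_comp_nb[of V E "C n" S "\<rho> (J n)"] unfolding N_def U_def by blast+
    then show "z \<in> S" unfolding graph_nb_def by blast
  qed
  \<comment> \<open>A neighbour of \<open>U (Suc n)\<close> inside \<open>C (Suc n)\<close> lies in
    \<open>S\<close> and so cannot have been absorbed by the larger \<open>U n\<close>, which avoids
    \<open>S\<close>; it is a neighbour of \<open>U n\<close> too.\<close>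
  have Ndec: "N (Suc n) \<subseteq> N n" for n
  proof
    fix z assume z: "z \<in> N (Suc n)"
    then obtain w where w: "w \<in> U (Suc n)" "{w, z} \<in> E" "z \<in> V" "z \<in> C (Suc n)"
      unfolding N_def graph_nb_def by blast
    have "z \<notin> U n" using z NS Usub[of n] by blast
    moreover have "w \<in> U n" "z \<in> C n" using w(1,4) Udec[of n] C(3)[of n] by blast+
    ultimately show "z \<in> N n" using w(2,3) unfolding N_def graph_nb_def by blast
  qed
  \<comment> \<open>The \<open>N n\<close> form a decreasing sequence of subsets of the finite set
    \<open>S\<close>. Their stable value lies in every \<open>C n\<close>, hence in
    \<open>I\<close>.\<close>
  obtain m where m: "\<And>n. n \<ge> m \<Longrightarrow> N n = N m"
    by (rule decreasing_finite_stabilises[of N, OF Ndec finite_subset[OF NS S(1)]]) (rule that)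
  have NI: "N m \<subseteq> I"
    unfolding I_def
  proof (rule INT_greatest)
    fix n
    have "N m = N (max n m)" using m[of "max n m"] by simp
    also have "\<dots> \<subseteq> C (max n m)" unfolding N_def by blast
    also have "\<dots> \<subseteq> C n" by (rule mono) simp
    finally show "N m \<subseteq> C n" .
  qed
  \<comment> \<open>The exits from \<open>U n\<close> inside \<open>C n\<close> now lie in
    \<open>I\<close>, which \<open>K n\<close> avoids; so the connected set \<open>K n\<close>,
    which shares a vertex of the ray with \<open>U n\<close>, never leaves it.\<close>
  have KU: "K n \<subseteq> U n" if "n \<ge> m" for n
  proof (rule conn_avoiding_nb[OF Kconn])
    show "K n \<subseteq> V" using Ksub[of n] regionD(2)[OF regC, of n] by blast
    have "N n \<subseteq> I" using m[OF that] NI by simp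
    then show "K n \<inter> graph_nb V E (U n) = {}" using Ksub[of n] unfolding N_def by blast
    show "\<rho> (J n) \<in> K n" using J by blast
    show "\<rho> (J n) \<in> U n" using tailU by blast
  qed
  \<comment> \<open>The deletion uses the stable set \<open>N m\<close> rather than all of
    \<open>S\<close>, so that the new neighbours of the bad component are in
    \<open>I\<close>.\<close>
  obtain u where u: "u \<in> C m - N m" "Bad (graph_comp E (C m - N m) u)"
    using split[OF bad[OF C(1)] finite_subset[OF NS S(1)]] by blast
  define D where "D = graph_comp E (C m - N m) u"
  have Dbad: "Bad D" using u(2) unfolding D_def .
  have Dsub: "D \<subseteq> C m - N m" unfolding D_def by (rule graph_comp_subset)
  note Dreg = reg[OF Dbad]
  \<comment> \<open>If \<open>D\<close> met \<open>U m\<close>, the two sets would coincide. Then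
    \<open>D\<close> would be a bad set that contains a tail of the ray and avoids
    \<open>S\<close>.\<close>
  have DU: "D \<inter> U m = {}"
  proof (rule ccontr)
    assume "D \<inter> U m \<noteq> {}"
    then obtain x where x: "x \<in> D" "x \<in> U m" by blast
    have "D \<subseteq> U m"
    proof (rule conn_avoiding_nb[OF regionD(3)[OF Dreg] regionD(2)[OF Dreg] _ x])
      show "D \<inter> graph_nb V E (U m) = {}" using Dsub unfolding N_def by blast
    qed
    then have "D \<inter> S = {}" using Usub[of m] by blast
    moreover have "U m \<subseteq> D"
      unfolding D_def
    proof (rule graph_comp_max[OF Uconn _ x(2)])
      show "U m \<subseteq> C m - N m" using Usub[of m] unfolding N_def graph_nb_def by blast
      show "x \<in> graph_comp E (C m - N m) u" using x(1) unfolding D_def .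
    qed
    then have "has_tail_in \<rho> D" using tailU[of m] unfolding has_tail_in_def by blast
    ultimately show False using S(2)[OF Dbad] by blast
  qed
  have "\<rho> (J m) \<in> C m" "\<rho> (J m) \<notin> D" using tailU[of m "J m"] Usub[of m] DU by blast+
  then have "D \<subset> C m" using Dsub by blast
  then obtain s where s: "s \<in> graph_nb V E D" "s \<in> C m"
    using region_nb_meets[OF regC _ regionD(1)[OF Dreg]] by blast
  have nbD: "graph_nb V E D \<subseteq> graph_nb V E (C m) \<union> N m"
    using graph_comp_nb[of V E "C m" "N m" u] unfolding D_def by blast
  have sN: "s \<in> N m" using s nbD unfolding graph_nb_def[of V E "C m"] by blast
  obtain t where t: "t \<in> D" "{t, s} \<in> E" using s(1) unfolding graph_nb_def by blast
  \<comment> \<open>\<open>D\<close> has a neighbour \<open>s\<close> in \<open>N m\<close>, which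
    lies in \<open>C k\<close>. Leaving \<open>C k\<close> inside \<open>C m\<close> would require a
    vertex of \<open>K m\<close>, thus of \<open>U m\<close>, and \<open>D\<close> has none.\<close>
  have Dlate: "D \<subseteq> C k" if k: "k > m" for k
  proof -
    have Ck: "C k \<subset> C m" using mono[of "Suc m" k] C(3)[of m] k by auto
    have sk: "s \<in> C k" using sN NI IC by blast
    have "insert s D \<subseteq> C k"
    proof (rule conn_avoiding_nb[OF graph_conn_insert[OF regionD(3)[OF Dreg] t] _ _ insertI1 sk])
      show "insert s D \<subseteq> V" using regionD(2)[OF Dreg] sk regionD(2)[OF regC] by blast
      have "z \<notin> D" if z: "z \<in> graph_nb V E (C k)" for z
      proof
        assume "z \<in> D"
        then have "z \<in> U m" using hubK[OF C(1) Ck z] Dsub KU[OF order_refl] by blast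
        then show False using DU \<open>z \<in> D\<close> by blast
      qed
      then show "insert s D \<inter> graph_nb V E (C k) = {}" using sk unfolding graph_nb_def[of V E "C k"] by blast
    qed
    then show ?thesis by blast
  qed
  have DC: "D \<subseteq> C n" for n using order_trans[OF Dlate[of "max n (Suc m)"] mono[of n "max n (Suc m)"]] by (simp add: less_max_iff_disj)
  then have DI: "D \<subseteq> I" unfolding I_def by blast
  have Dlow: "D \<subset> B" if "B \<in> CC" for B
  proof -
    obtain n where "C n \<subseteq> B" using C(2)[OF \<open>B \<in> CC\<close>] by blast
    then show ?thesis using DC[of "Suc n"] C(3)[of n] by blast
  qed
  have "chain_hubs V E CC D"
    unfolding chain_hubs_def
  proof
    fix B assume B: "B \<in> CC"
    obtain n where n: "C n \<subseteq> B" using C(2)[OF B] by blast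
    \<comment> \<open>From stage \<open>m\<close> on, \<open>N k\<close> equals \<open>N m\<close>
      and \<open>y k\<close> lies in \<open>U k\<close>. So a neighbour of \<open>D\<close> in
      \<open>N m\<close> is reached from the hub \<open>y k\<close> through \<open>U k\<close>,
      which avoids \<open>D\<close>; the other neighbours of \<open>D\<close> are neighbours of
      \<open>C m\<close> and already connected.\<close>
    define k where "k = max n m"
    have k: "C k \<subseteq> B" "k \<ge> m" using n mono[of n k] unfolding k_def by auto
    have old: "(y k, z) \<in> (gadj E (B - D))\<^sup>*" if "C1 \<in> CC" "C1 \<subset> B" "z \<in> graph_nb V E C1" "z \<in> B" for C1 z
      by (rule gadj_mono[OF _ hub[OF B k(1) that]]) (use DI in blast)
    have "(y k, z) \<in> (gadj E (B - D))\<^sup>*"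
      if C1: "C1 \<in> insert D CC" and z: "z \<in> graph_nb V E C1 \<inter> B" and "C1 \<subset> B" for C1 z
    proof (cases "C1 \<in> CC")
      case True
      then show ?thesis using old \<open>C1 \<subset> B\<close> z by blast
    next
      case False
      then have zD: "z \<in> graph_nb V E D" "z \<in> B" using C1 z by blast+
      show ?thesis
      proof (cases "z \<in> N m")
        case True
        then have "z \<in> N k" using m[OF k(2)] by simp
        then obtain w where w: "w \<in> U k" "{w, z} \<in> E" unfolding N_def graph_nb_def by blast
        have UB: "U k \<subseteq> B - D" using Usub[of k] k(1) Umono[OF k(2)] DU by blast
        have "(y k, w) \<in> (gadj E (U k))\<^sup>*" using graph_connD[OF Uconn _ w(1)] KU[OF k(2)] yK by blast
        then have "(y k, w) \<in> (gadj E (B - D))\<^sup>*" by (rule gadj_mono[OF UB])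
        moreover have "w \<in> B - D" "z \<in> B - D" using w(1) UB zD unfolding graph_nb_def by blast+
        then have "(w, z) \<in> gadj E (B - D)" using w(2) by simp
        ultimately show ?thesis by (rule rtrancl_into_rtrancl)
      next
        case False
        then have zm: "z \<in> graph_nb V E (C m)" using zD nbD by blast
        then have "z \<notin> C m" unfolding graph_nb_def by blast
        then have "C m \<subset> B" using coherent_chainD(1)[OF CC C(1)[of m] B] zD(2) by blast
        then show ?thesis using old[OF C(1)] zm zD(2) by blast
      qed
    qed
    then show "\<exists>z. \<forall>C\<in>insert D CC. \<forall>y\<in>graph_nb V E C \<inter> B. C \<subset> B \<longrightarrow> (z, y) \<in> (gadj E (B - D))\<^sup>*"
      by blast
  qed
  then show thesis using that Dbad Dlow by blast
qed

text \<open>\<open>split\<close> is what badness inherits from gluing partitions of components, and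
  \<open>ray\<close> what it inherits from good neighbourhoods of ends. A maximal coherent chain of
  bad sets is then extendable whether or not it has a least member.\<close>

theorem no_bad_region:
  assumes reg: "\<And>B. Bad B \<Longrightarrow> region V E B"
    and split: "\<And>B F. Bad B \<Longrightarrow> finite F \<Longrightarrow> \<exists>u\<in>B - F. Bad (graph_comp E (B - F) u)"
    and ray: "\<And>\<rho>. graph_ray V E \<rho> \<Longrightarrow> \<exists>S. finite S \<and> (\<forall>B. Bad B \<and> has_tail_in \<rho> B \<longrightarrow> B \<inter> S \<noteq> {})"
  shows "\<not> Bad C0"
proof
  assume C0: "Bad C0"
  let ?A = "{CC. CC \<noteq> {} \<and> (\<forall>C\<in>CC. Bad C) \<and> coherent_chain V E CC}"
  have "\<exists>M\<in>?A. \<forall>X\<in>?A. M \<subseteq> X \<longrightarrow> X = M"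
  proof (rule subset_Zorn_nonempty)
    have "{C0} \<in> ?A" using C0 unfolding coherent_chain_def by simp
    then show "?A \<noteq> {}" by blast
    fix K assume K: "K \<noteq> {}" "subset.chain ?A K"
    have KA: "CC \<in> ?A" if "CC \<in> K" for CC using K(2) that unfolding subset_chain_def by blast
    \<comment> \<open>Coherence speaks of at most four members at a time, and finitely many members
      of the union lie in a single chain.\<close>
    have pair: "\<exists>CC\<in>K. F \<subseteq> CC" if "finite F" "F \<subseteq> \<Union>K" for F
      by (rule finite_subset_Union_chain[OF that K]) blast
    have "coherent_chain V E (\<Union>K)"
      unfolding coherent_chain_def
    proof (intro conjI ballI impI)
      fix C D assume "C \<in> \<Union>K" "D \<in> \<Union>K"
      then obtain CC where "CC \<in> K" "{C, D} \<subseteq> CC" using pair[of "{C, D}"] by auto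
      then show "C \<subseteq> D \<or> D \<subseteq> C" using coherent_chainD(1)[of V E CC C D] KA by simp
    next
      fix B C C1 C2 y1 y2
      assume *: "B \<in> \<Union>K" "C \<in> \<Union>K" "C1 \<in> \<Union>K" "C2 \<in> \<Union>K" "y1 \<in> graph_nb V E C1 \<inter> B"
        "y2 \<in> graph_nb V E C2 \<inter> B" "C \<subseteq> C1 \<and> C1 \<subset> B \<and> C \<subseteq> C2 \<and> C2 \<subset> B"
      then obtain CC where "CC \<in> K" "{B, C, C1, C2} \<subseteq> CC" using pair[of "{B, C, C1, C2}"] by auto
      then show "(y1, y2) \<in> (gadj E (B - C))\<^sup>*"
        using coherent_chainD(2)[of V E CC B C C1 C2 y1 y2] KA *(5-7) by simp
    qed
    moreover have "\<Union>K \<noteq> {}" using K(1) KA by blast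
    moreover have "\<forall>C\<in>\<Union>K. Bad C" using KA by blast
    ultimately show "\<Union>K \<in> ?A" by blast
  qed
  then obtain CC where "CC \<in> ?A" and max: "\<forall>X\<in>?A. CC \<subseteq> X \<longrightarrow> X = CC" by (rule bexE)
  then have CC: "CC \<noteq> {}" "\<And>C. C \<in> CC \<Longrightarrow> Bad C" "coherent_chain V E CC" by simp_all
  have regCC: "region V E C" if "C \<in> CC" for C using reg[OF CC(2)[OF that]] .
  have ext: False if D: "Bad D" "\<And>C. C \<in> CC \<Longrightarrow> D \<subset> C" "chain_hubs V E CC D" for D
  proof -
    have "insert D CC \<in> ?A" using D(1) CC(2) coherent_chain_insert[OF CC(3) D(2,3)] by simp
    then have "insert D CC = CC" using max subset_insertI by blast
    then show False using D(2)[of D] by blast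
  qed
  have nomin: "\<exists>D\<in>CC. D \<subset> C" if C: "C \<in> CC" for C
  proof (rule ccontr)
    assume "\<not> ?thesis"
    then have min: "C \<subseteq> D" if "D \<in> CC" for D using coherent_chainD(1)[OF CC(3) C that] that by blast
    obtain x where x: "x \<in> C" "\<And>u. u \<in> C - {x} \<Longrightarrow> chain_hubs V E CC (graph_comp E (C - {x}) u)"
      by (rule coherent_chain_below_minimum[OF CC(3) regCC C min]) (assumption | rule that)+
    obtain u where u: "u \<in> C - {x}" "Bad (graph_comp E (C - {x}) u)" using split[OF CC(2)[OF C], of "{x}"] by blast
    have "graph_comp E (C - {x}) u \<subset> D" if "D \<in> CC" for D
      using graph_comp_subset[of E "C - {x}" u] x(1) min[OF that] by blast
    then show False using ext u x(2) by blast
  qed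
  have "\<exists>C' :: nat \<Rightarrow> 'a set. (\<forall>n. C' n \<in> CC) \<and> (\<forall>D\<in>CC. \<exists>n. C' n \<subseteq> D)"
  proof (rule region_chain_coinitial_sequence[OF CC(1)])
    show "region V E C" if "C \<in> CC" for C by (rule regCC[OF that])
    show "C \<subseteq> D \<or> D \<subseteq> C" if "C \<in> CC" "D \<in> CC" for C D by (rule coherent_chainD(1)[OF CC(3) that])
  qed
  then obtain C' :: "nat \<Rightarrow> 'a set" where C'all: "(\<forall>n. C' n \<in> CC) \<and> (\<forall>D\<in>CC. \<exists>n. C' n \<subseteq> D)"
    by (rule exE)
  then have C': "C' n \<in> CC" "D \<in> CC \<Longrightarrow> \<exists>n. C' n \<subseteq> D" for n D by simp_all
  \<comment> \<open>The coinitial sequence is made strictly decreasing: the smaller of the current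
    member and \<open>C' n\<close> is again in the chain, and the chain has no least member.\<close>
  have "\<exists>C. \<forall>n. C n \<in> CC \<and> (C (Suc n) \<subset> C n \<and> C (Suc n) \<subseteq> C' n)"
  proof (rule dependent_nat_choice)
    show "\<exists>x. x \<in> CC" using CC(1) by blast
    fix x n assume x: "x \<in> CC"
    have "x \<inter> C' n = x \<or> x \<inter> C' n = C' n" using coherent_chainD(1)[OF CC(3) x C'(1)[of n]] by blast
    then have "x \<inter> C' n \<in> CC" using x C'(1)[of n] by metis
    then obtain D where "D \<in> CC" "D \<subset> x \<inter> C' n" using nomin by blast
    then show "\<exists>y. y \<in> CC \<and> (y \<subset> x \<and> y \<subseteq> C' n)" by blast
  qed
  then obtain C where Call: "\<forall>n. C n \<in> CC \<and> (C (Suc n) \<subset> C n \<and> C (Suc n) \<subseteq> C' n)" by (rule exE)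
  then have C: "C n \<in> CC" "C (Suc n) \<subset> C n" "C (Suc n) \<subseteq> C' n" for n by simp_all
  have coin: "\<exists>n. C n \<subseteq> D" if "D \<in> CC" for D
    using C'(2)[OF that] C(3) by (meson order_trans)
  obtain D where "Bad D" "\<And>B. B \<in> CC \<Longrightarrow> D \<subset> B" "chain_hubs V E CC D"
    by (rule coherent_chain_below_limit[where Bad = Bad and C = C, OF CC(3,2) reg split ray C(1) coin C(2)])
      (assumption | rule that)+
  then show False using ext by blast
qed


section \<open>End spaces\<close>

lemma graph_components_eq: "graph_components V E S = graph_comp E (V - S) ` (V - S)"
proof -
  have "adj_avoiding V E S = gadj E (V - S)" unfolding adj_avoiding_def gadj_def by blast
  then show ?thesis unfolding graph_components_def graph_comp_def by auto
qed

lemma graph_components_same: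
  assumes C: "C \<in> graph_components V E S" and D: "D \<in> graph_components V E S" and x: "x \<in> C" "x \<in> D"
  shows "C = D"
proof -
  obtain u v where "C = graph_comp E (V - S) u" "D = graph_comp E (V - S) v"
    using C D unfolding graph_components_eq by blast
  then show ?thesis using graph_comp_eq x by metis
qed

lemma has_tail_in_common:
  assumes "has_tail_in \<rho> C" "has_tail_in \<rho> D"
  obtains x where "x \<in> C" "x \<in> D"
proof -
  obtain m n where "\<forall>i\<ge>m. \<rho> i \<in> C" "\<forall>i\<ge>n. \<rho> i \<in> D" using assms unfolding has_tail_in_def by blast
  then have "\<rho> (max m n) \<in> C" "\<rho> (max m n) \<in> D" by simp_all
  then show thesis by (rule that)
qed

lemma has_tail_in_mono: "has_tail_in \<rho> C \<Longrightarrow> C \<subseteq> D \<Longrightarrow> has_tail_in \<rho> D"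
  unfolding has_tail_in_def by blast

lemma ray_tail_component:
  assumes \<rho>: "graph_ray V E \<rho>" "has_tail_in \<rho> A" and F: "finite F"
  obtains u where "u \<in> A - F" "has_tail_in \<rho> (graph_comp E (A - F) u)"
proof -
  obtain j where j: "\<forall>i\<ge>j. \<rho> i \<in> A" using \<rho>(2) unfolding has_tail_in_def by blast
  obtain b where b: "\<And>i. i \<ge> b \<Longrightarrow> \<rho> i \<notin> F" by (rule ray_leaves_finite[OF \<rho>(1) F]) (rule that)
  have in': "\<rho> i \<in> A - F" if "i \<ge> max j b" for i using j b that by simp
  have "has_tail_in \<rho> (graph_comp E (A - F) (\<rho> (max j b)))"
    unfolding has_tail_in_def using ray_tail_in_comp[OF \<rho>(1) in'] by blast
  then show thesis using that in'[OF order_refl] by blast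
qed

lemma ray_has_component:
  assumes \<rho>: "graph_ray V E \<rho>" and S: "finite S"
  shows "\<exists>C\<in>graph_components V E S. has_tail_in \<rho> C"
proof -
  have "has_tail_in \<rho> V" using \<rho> unfolding graph_ray_def has_tail_in_def by blast
  then obtain u where "u \<in> V - S" "has_tail_in \<rho> (graph_comp E (V - S) u)"
    by (rule ray_tail_component[OF \<rho> _ S]) (rule that)
  then show ?thesis unfolding graph_components_eq by blast
qed

lemma ray_equivD:
  assumes "(\<rho>, \<sigma>) \<in> ray_equiv V E"
  shows "graph_ray V E \<rho>" "graph_ray V E \<sigma>"
    "finite S \<Longrightarrow> S \<subseteq> V \<Longrightarrow> \<exists>C\<in>graph_components V E S. has_tail_in \<rho> C \<and> has_tail_in \<sigma> C"
  using assms unfolding ray_equiv_def by simp_all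

lemma ray_equivI:
  assumes "graph_ray V E \<rho>" "graph_ray V E \<sigma>"
    "\<And>S. finite S \<Longrightarrow> S \<subseteq> V \<Longrightarrow> \<exists>C\<in>graph_components V E S. has_tail_in \<rho> C \<and> has_tail_in \<sigma> C"
  shows "(\<rho>, \<sigma>) \<in> ray_equiv V E"
  using assms unfolding ray_equiv_def by simp

lemma equiv_ray_equiv: "equiv {\<rho>. graph_ray V E \<rho>} (ray_equiv V E)"
proof (rule equivI)
  show "ray_equiv V E \<subseteq> {\<rho>. graph_ray V E \<rho>} \<times> {\<rho>. graph_ray V E \<rho>}"
    using ray_equivD(1,2) by fast
  show "refl_on {\<rho>. graph_ray V E \<rho>} (ray_equiv V E)"
    by (rule refl_onI) (use ray_has_component in \<open>auto intro!: ray_equivI\<close>)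
  show "sym (ray_equiv V E)" by (rule symI) (auto simp: ray_equiv_def conj_commute)
  show "trans (ray_equiv V E)"
  proof (rule transI)
    fix \<rho> \<sigma> \<tau> assume 1: "(\<rho>, \<sigma>) \<in> ray_equiv V E" and 2: "(\<sigma>, \<tau>) \<in> ray_equiv V E"
    show "(\<rho>, \<tau>) \<in> ray_equiv V E"
    proof (rule ray_equivI[OF ray_equivD(1)[OF 1] ray_equivD(2)[OF 2]])
      fix S assume S: "finite S" "S \<subseteq> V"
      obtain C where C: "C \<in> graph_components V E S" "has_tail_in \<rho> C" "has_tail_in \<sigma> C"
        using ray_equivD(3)[OF 1 S] by blast
      obtain D where D: "D \<in> graph_components V E S" "has_tail_in \<sigma> D" "has_tail_in \<tau> D"
        using ray_equivD(3)[OF 2 S] by blast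
      obtain x where "x \<in> C" "x \<in> D" by (rule has_tail_in_common[OF C(3) D(2)]) (rule that)
      then have "C = D" by (rule graph_components_same[OF C(1) D(1)])
      then show "\<exists>C\<in>graph_components V E S. has_tail_in \<rho> C \<and> has_tail_in \<tau> C" using C D by blast
    qed
  qed
qed

lemma graph_endD:
  assumes "\<omega> \<in> graph_ends V E"
  shows "\<omega> \<noteq> {}" "\<rho> \<in> \<omega> \<Longrightarrow> graph_ray V E \<rho>" "\<rho> \<in> \<omega> \<Longrightarrow> \<sigma> \<in> \<omega> \<Longrightarrow> (\<rho>, \<sigma>) \<in> ray_equiv V E"
    "\<rho> \<in> \<omega> \<Longrightarrow> \<omega> = ray_equiv V E `` {\<rho>}"
proof -
  note q = assms[unfolded graph_ends_def] and eq = equiv_ray_equiv[of V E]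
  show "\<omega> \<noteq> {}" using in_quotient_imp_non_empty[OF eq q] .
  show "\<rho> \<in> \<omega> \<Longrightarrow> graph_ray V E \<rho>" using in_quotient_imp_subset[OF eq q] by blast
  show "\<rho> \<in> \<omega> \<Longrightarrow> \<sigma> \<in> \<omega> \<Longrightarrow> (\<rho>, \<sigma>) \<in> ray_equiv V E" using in_quotient_imp_in_rel[OF eq q] by blast
  show "\<rho> \<in> \<omega> \<Longrightarrow> \<omega> = ray_equiv V E `` {\<rho>}"
  proof -
    assume \<rho>: "\<rho> \<in> \<omega>"
    obtain \<sigma> where \<sigma>: "\<omega> = ray_equiv V E `` {\<sigma>}" by (rule quotientE[OF q]) (rule that)
    then have "(\<sigma>, \<rho>) \<in> ray_equiv V E" using \<rho> by simp
    then show "\<omega> = ray_equiv V E `` {\<rho>}" unfolding \<sigma> by (rule equiv_class_eq[OF eq])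
  qed
qed

lemma graph_end_of_ray:
  assumes "graph_ray V E \<rho>"
  shows "ray_equiv V E `` {\<rho>} \<in> graph_ends V E" "\<rho> \<in> ray_equiv V E `` {\<rho>}"
  using assms quotientI[of \<rho> "{\<rho>. graph_ray V E \<rho>}" "ray_equiv V E"]
    equiv_class_self[OF equiv_ray_equiv, of \<rho> V E] unfolding graph_ends_def by simp_all

text \<open>For a component \<open>C\<close> this is the basic open set of ends that live in
  \<open>C\<close>, written without reference to a separating set or to an end.\<close>

definition ends_in :: "'v set \<Rightarrow> 'v set set \<Rightarrow> 'v set \<Rightarrow> (nat \<Rightarrow> 'v) set set" where
  "ends_in V E C = {\<omega> \<in> graph_ends V E. \<forall>\<rho>\<in>\<omega>. has_tail_in \<rho> C}"

text \<open>One ray decides: equivalent rays have tails in a common component, and distinct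
  components are disjoint.\<close>

lemma end_component_eqI:
  assumes \<omega>: "\<omega> \<in> graph_ends V E" and S: "finite S" "S \<subseteq> V"
    and C: "C \<in> graph_components V E S" and \<rho>: "\<rho> \<in> \<omega>" "has_tail_in \<rho> C"
  shows "end_component V E S \<omega> = C" and "\<omega> \<in> ends_in V E C"
proof -
  have tails: "has_tail_in \<sigma> C" if \<sigma>: "\<sigma> \<in> \<omega>" for \<sigma>
  proof -
    obtain D where D: "D \<in> graph_components V E S" "has_tail_in \<rho> D" "has_tail_in \<sigma> D"
      using ray_equivD(3)[OF graph_endD(3)[OF \<omega> \<rho>(1) \<sigma>] S] by blast
    obtain x where "x \<in> C" "x \<in> D" by (rule has_tail_in_common[OF \<rho>(2) D(2)]) (rule that)
    then have "C = D" by (rule graph_components_same[OF C D(1)])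
    then show ?thesis using D(3) by simp
  qed
  then show "\<omega> \<in> ends_in V E C" using \<omega> unfolding ends_in_def by simp
  show "end_component V E S \<omega> = C"
    unfolding end_component_def
  proof (rule the_equality)
    fix D assume D: "D \<in> graph_components V E S \<and> (\<forall>\<rho>\<in>\<omega>. has_tail_in \<rho> D)"
    then have "has_tail_in \<rho> D" using \<rho>(1) by blast
    then obtain x where "x \<in> D" "x \<in> C" by (rule has_tail_in_common[OF _ \<rho>(2)]) (rule that)
    then show "D = C" using graph_components_same C D by metis
  qed (use C tails in blast)
qed

lemma end_component:
  assumes \<omega>: "\<omega> \<in> graph_ends V E" and S: "finite S" "S \<subseteq> V"
  shows "end_component V E S \<omega> \<in> graph_components V E S" "\<omega> \<in> ends_in V E (end_component V E S \<omega>)"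
proof -
  obtain \<rho> where \<rho>: "\<rho> \<in> \<omega>" using graph_endD(1)[OF \<omega>] by blast
  obtain C where C: "C \<in> graph_components V E S" "has_tail_in \<rho> C"
    using ray_has_component[OF graph_endD(2)[OF \<omega> \<rho>] S(1)] by blast
  show "end_component V E S \<omega> \<in> graph_components V E S" "\<omega> \<in> ends_in V E (end_component V E S \<omega>)"
    using end_component_eqI[OF \<omega> S C(1) \<rho> C(2)] C(1) by simp_all
qed

lemma ends_inD:
  assumes "\<omega> \<in> ends_in V E C"
  shows "\<omega> \<in> graph_ends V E" "\<rho> \<in> \<omega> \<Longrightarrow> has_tail_in \<rho> C"
  using assms unfolding ends_in_def by simp_all

lemma ends_in_mono: "C \<subseteq> D \<Longrightarrow> ends_in V E C \<subseteq> ends_in V E D"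
  unfolding ends_in_def using has_tail_in_mono by blast

lemma ends_in_component:
  assumes \<omega>: "\<omega> \<in> ends_in V E C" and S: "finite S" "S \<subseteq> V" and C: "C \<in> graph_components V E S"
  shows "end_component V E S \<omega> = C"
proof -
  obtain \<rho> where "\<rho> \<in> \<omega>" using graph_endD(1)[OF ends_inD(1)[OF \<omega>]] by blast
  then show ?thesis using end_component_eqI(1)[OF ends_inD(1)[OF \<omega>] S C] ends_inD(2)[OF \<omega>] by blast
qed

lemma end_nbhd_eq:
  assumes \<omega>: "\<omega> \<in> graph_ends V E" and S: "finite S" "S \<subseteq> V"
  shows "end_nbhd V E S \<omega> = ends_in V E (end_component V E S \<omega>)"
proof (intro equalityI subsetI)
  fix \<omega>' assume "\<omega>' \<in> end_nbhd V E S \<omega>"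
  then have "\<omega>' \<in> graph_ends V E" "end_component V E S \<omega>' = end_component V E S \<omega>"
    unfolding end_nbhd_def by simp_all
  then show "\<omega>' \<in> ends_in V E (end_component V E S \<omega>)" using end_component(2)[OF _ S] by metis
next
  fix \<omega>' assume \<omega>': "\<omega>' \<in> ends_in V E (end_component V E S \<omega>)"
  show "\<omega>' \<in> end_nbhd V E S \<omega>"
    unfolding end_nbhd_def using ends_in_component[OF \<omega>' S end_component(1)[OF \<omega> S]] ends_inD(1)[OF \<omega>'] by simp
qed

lemma region_of_component:
  assumes S: "finite S" and C: "C \<in> graph_components V E S"
  shows "region V E C" "C \<subseteq> V - S"
proof -
  obtain u where u: "u \<in> V - S" "C = graph_comp E (V - S) u" using C unfolding graph_components_eq by blast
  show "C \<subseteq> V - S" unfolding u(2) by (rule graph_comp_subset)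
  have "graph_nb V E V = {}" unfolding graph_nb_def by blast
  then have "graph_nb V E C \<subseteq> S" using graph_comp_nb[of V E V S u] u(2) by blast
  then show "region V E C"
    unfolding region_def using \<open>C \<subseteq> V - S\<close> graph_comp_self[OF u(1)] graph_comp_conn[OF u(1)] S u(2) finite_subset by blast
qed

lemma region_component:
  assumes C: "region V E C"
  shows "C \<in> graph_components V E (graph_nb V E C)" "finite (graph_nb V E C)" "graph_nb V E C \<subseteq> V"
proof -
  obtain u where u: "u \<in> C" using regionD(1)[OF C] by blast
  have "u \<in> V - graph_nb V E C" using u regionD(2)[OF C] unfolding graph_nb_def by blast
  then show "C \<in> graph_components V E (graph_nb V E C)"
    unfolding graph_components_eq using region_eq_comp[OF C u] by blast
  show "finite (graph_nb V E C)" by (rule regionD(4)[OF C])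
  show "graph_nb V E C \<subseteq> V" unfolding graph_nb_def by blast
qed

lemma region_ends_inI:
  assumes "region V E C" "\<omega> \<in> graph_ends V E" "\<rho> \<in> \<omega>" "has_tail_in \<rho> C"
  shows "\<omega> \<in> ends_in V E C"
  using end_component_eqI(2)[OF assms(2) region_component(2,3)[OF assms(1)] region_component(1)[OF assms(1)] assms(3,4)] .

lemma openin_ends_in:
  assumes C: "region V E C"
  shows "openin (end_space V E) (ends_in V E C)"
proof (cases "ends_in V E C = {}")
  case False
  then obtain \<omega> where \<omega>: "\<omega> \<in> ends_in V E C" by blast
  note S = region_component(2,3)[OF C]
  have "ends_in V E C = end_nbhd V E (graph_nb V E C) \<omega>"
    using end_nbhd_eq[OF ends_inD(1)[OF \<omega>] S] ends_in_component[OF \<omega> S region_component(1)[OF C]] by simp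
  then show ?thesis
    unfolding end_space_def using S ends_inD(1)[OF \<omega>] by (intro topology_generated_by_Basis) blast
qed simp

lemma ends_in_subset_nbhd:
  assumes B: "region V E B" "B \<inter> S = {}" and S: "finite S" "S \<subseteq> V" and \<omega>: "\<omega> \<in> ends_in V E B"
  shows "ends_in V E B \<subseteq> end_nbhd V E S \<omega>"
proof -
  obtain x where x: "x \<in> B" using regionD(1)[OF B(1)] by blast
  have xS: "x \<in> V - S" using x B(2) regionD(2)[OF B(1)] by blast
  have sub: "B \<subseteq> graph_comp E (V - S) x"
    by (rule graph_comp_max[OF regionD(3)[OF B(1)] _ x graph_comp_self[OF xS]]) (use B(2) regionD(2)[OF B(1)] in blast)
  have C: "graph_comp E (V - S) x \<in> graph_components V E S" using xS unfolding graph_components_eq by blast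
  have "\<omega> \<in> ends_in V E (graph_comp E (V - S) x)" using \<omega> ends_in_mono[OF sub] by blast
  then have "end_component V E S \<omega> = graph_comp E (V - S) x" by (rule ends_in_component[OF _ S C])
  then show ?thesis using end_nbhd_eq[OF ends_inD(1)[OF \<omega>] S] ends_in_mono[OF sub] by simp
qed

lemma end_nbhd_antimono:
  assumes \<omega>: "\<omega> \<in> graph_ends V E" and S: "finite S" "S \<subseteq> V" and T: "T \<subseteq> S"
  shows "end_nbhd V E S \<omega> \<subseteq> end_nbhd V E T \<omega>"
proof -
  note C = end_component[OF \<omega> S]
  have "end_component V E S \<omega> \<inter> T = {}" using region_of_component(2)[OF S(1) C(1)] T by blast
  moreover have "finite T" "T \<subseteq> V" using S T finite_subset by auto
  ultimately show ?thesis
    using ends_in_subset_nbhd[OF region_of_component(1)[OF S(1) C(1)] _ _ _ C(2)] end_nbhd_eq[OF \<omega> S] by simp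
qed

lemma end_nbhd_self: "\<omega> \<in> graph_ends V E \<Longrightarrow> \<omega> \<in> end_nbhd V E S \<omega>"
  unfolding end_nbhd_def by simp

lemma topspace_end_space: "topspace (end_space V E) = graph_ends V E"
proof -
  have "\<Union>{end_nbhd V E S \<omega> | S \<omega>. finite S \<and> S \<subseteq> V \<and> \<omega> \<in> graph_ends V E} = graph_ends V E"
  proof
    show "\<Union>{end_nbhd V E S \<omega> | S \<omega>. finite S \<and> S \<subseteq> V \<and> \<omega> \<in> graph_ends V E} \<subseteq> graph_ends V E"
      unfolding end_nbhd_def by blast
    show "graph_ends V E \<subseteq> \<Union>{end_nbhd V E S \<omega> | S \<omega>. finite S \<and> S \<subseteq> V \<and> \<omega> \<in> graph_ends V E}"
    proof
      fix \<omega> assume \<omega>: "\<omega> \<in> graph_ends V E"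
      then have "end_nbhd V E {} \<omega> \<in> {end_nbhd V E S \<omega> | S \<omega>. finite S \<and> S \<subseteq> V \<and> \<omega> \<in> graph_ends V E}" by blast
      then show "\<omega> \<in> \<Union>{end_nbhd V E S \<omega> | S \<omega>. finite S \<and> S \<subseteq> V \<and> \<omega> \<in> graph_ends V E}"
        using end_nbhd_self[OF \<omega>] by (rule UnionI)
    qed
  qed
  then show ?thesis unfolding end_space_def by simp
qed

text \<open>The topology is given by generators, so the induction follows its generation.
  Intersections are handled by deleting \<open>S \<union> T\<close>, and a basic set is recentred at
  any of its ends.\<close>

lemma openin_end_space_nbhd:
  assumes W: "openin (end_space V E) W" "\<omega> \<in> W"
  obtains S where "finite S" "S \<subseteq> V" "end_nbhd V E S \<omega> \<subseteq> W"
proof -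
  let ?B = "{end_nbhd V E S \<omega> | S \<omega>. finite S \<and> S \<subseteq> V \<and> \<omega> \<in> graph_ends V E}"
  have "generate_topology_on ?B W" using W(1) unfolding end_space_def openin_topology_generated_by_iff .
  then have "\<forall>\<omega>\<in>W. \<omega> \<in> graph_ends V E \<and> (\<exists>S. finite S \<and> S \<subseteq> V \<and> end_nbhd V E S \<omega> \<subseteq> W)"
  proof (induction rule: generate_topology_on.induct)
    case (Int A B)
    show ?case
    proof
      fix \<omega> assume \<omega>: "\<omega> \<in> A \<inter> B"
      obtain S where S: "finite S" "S \<subseteq> V" "end_nbhd V E S \<omega> \<subseteq> A" using Int(3) \<omega> by blast
      obtain T where T: "finite T" "T \<subseteq> V" "end_nbhd V E T \<omega> \<subseteq> B" using Int(4) \<omega> by blast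
      have end\<omega>: "\<omega> \<in> graph_ends V E" using Int(3) \<omega> by blast
      have ST: "finite (S \<union> T)" "S \<union> T \<subseteq> V" using S T by auto
      have "end_nbhd V E (S \<union> T) \<omega> \<subseteq> A \<inter> B"
        using end_nbhd_antimono[OF end\<omega> ST Un_upper1] end_nbhd_antimono[OF end\<omega> ST Un_upper2] S(3) T(3) by blast
      then show "\<omega> \<in> graph_ends V E \<and> (\<exists>S. finite S \<and> S \<subseteq> V \<and> end_nbhd V E S \<omega> \<subseteq> A \<inter> B)"
        using end\<omega> ST by blast
    qed
  next
    case (UN K)
    show ?case
    proof
      fix \<omega> assume "\<omega> \<in> \<Union>K"
      then obtain k where k: "k \<in> K" "\<omega> \<in> k" by blast
      then obtain S where "finite S" "S \<subseteq> V" "end_nbhd V E S \<omega> \<subseteq> k" "\<omega> \<in> graph_ends V E"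
        using UN by meson
      then show "\<omega> \<in> graph_ends V E \<and> (\<exists>S. finite S \<and> S \<subseteq> V \<and> end_nbhd V E S \<omega> \<subseteq> \<Union>K)"
        using Sup_upper[OF k(1)] by (meson order_trans)
    qed
  next
    case (Basis s)
    then obtain S \<omega>0 where s: "s = end_nbhd V E S \<omega>0" "finite S" "S \<subseteq> V" by blast
    have "end_nbhd V E S \<omega> = s" "\<omega> \<in> graph_ends V E" if "\<omega> \<in> s" for \<omega>
      using that unfolding s(1) end_nbhd_def by auto
    then show ?case using s(2,3) by (metis order_refl)
  qed simp
  then show thesis using W(2) that by blast
qed

text \<open>Each end of \<open>K\<close> lives in exactly one component of \<open>K - F\<close>.
  Allowing any \<open>K\<close> covers \<open>V\<close> with \<open>F = {}\<close>, where the graph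
  may be disconnected.\<close>

lemma ends_in_splits:
  assumes reg: "\<And>u. u \<in> K - F \<Longrightarrow> region V E (graph_comp E (K - F) u)" and F: "finite F"
    and sp: "\<And>u. u \<in> K - F \<Longrightarrow> splits X UU (ends_in V E (graph_comp E (K - F) u))"
  shows "splits X UU (ends_in V E K)"
proof -
  let ?D = "\<lambda>u. graph_comp E (K - F) u"
  have "ends_in V E K = \<Union>((\<lambda>u. ends_in V E (?D u)) ` (K - F))"
  proof (intro equalityI subsetI)
    fix \<omega> assume \<omega>: "\<omega> \<in> ends_in V E K"
    obtain \<rho> where \<rho>: "\<rho> \<in> \<omega>" using graph_endD(1)[OF ends_inD(1)[OF \<omega>]] by blast
    obtain u where u: "u \<in> K - F" "has_tail_in \<rho> (?D u)"
      by (rule ray_tail_component[OF graph_endD(2)[OF ends_inD(1)[OF \<omega>] \<rho>] ends_inD(2)[OF \<omega> \<rho>] F]) (rule that)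
    then have "\<omega> \<in> ends_in V E (?D u)" using region_ends_inI[OF reg ends_inD(1)[OF \<omega>] \<rho>] by blast
    then show "\<omega> \<in> \<Union>((\<lambda>u. ends_in V E (?D u)) ` (K - F))" using u(1) by blast
  next
    fix \<omega> assume "\<omega> \<in> \<Union>((\<lambda>u. ends_in V E (?D u)) ` (K - F))"
    then obtain u where "\<omega> \<in> ends_in V E (?D u)" by blast
    moreover have "?D u \<subseteq> K" using graph_comp_subset[of E "K - F" u] by blast
    ultimately show "\<omega> \<in> ends_in V E K" using ends_in_mono by blast
  qed
  moreover have "splits X UU (\<Union>((\<lambda>u. ends_in V E (?D u)) ` (K - F)))"
  proof (rule splits_Union)
    show "splits X UU W" if "W \<in> (\<lambda>u. ends_in V E (?D u)) ` (K - F)" for W using that sp by blast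
    fix A B assume AB: "A \<in> (\<lambda>u. ends_in V E (?D u)) ` (K - F)" "B \<in> (\<lambda>u. ends_in V E (?D u)) ` (K - F)" "A \<noteq> B"
    then obtain u v where uv: "A = ends_in V E (?D u)" "B = ends_in V E (?D v)" by blast
    show "A \<inter> B = {}"
    proof (rule ccontr)
      assume "A \<inter> B \<noteq> {}"
      then obtain \<omega> where \<omega>: "\<omega> \<in> ends_in V E (?D u)" "\<omega> \<in> ends_in V E (?D v)" using uv by blast
      obtain \<rho> where \<rho>: "\<rho> \<in> \<omega>" using graph_endD(1)[OF ends_inD(1)[OF \<omega>(1)]] by blast
      obtain x where "x \<in> ?D u" "x \<in> ?D v"
        by (rule has_tail_in_common[OF ends_inD(2)[OF \<omega>(1) \<rho>] ends_inD(2)[OF \<omega>(2) \<rho>]]) (rule that)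
      then have "?D u = ?D v" using graph_comp_eq by metis
      then show False using AB(3) uv by simp
    qed
  qed
  ultimately show ?thesis by simp
qed

lemma end_space_ultraparacompact: "ultraparacompact_space (end_space V E)"
  unfolding ultraparacompact_iff_splits topspace_end_space
proof (intro allI impI)
  fix UU assume UU: "(\<forall>U\<in>UU. openin (end_space V E) U) \<and> \<Union>UU = graph_ends V E"
  let ?ok = "\<lambda>C. splits (end_space V E) UU (ends_in V E C)"
  have reg_ok: "?ok C" if C: "region V E C" for C
  proof -
    have "\<not> (region V E C \<and> \<not> ?ok C)"
    proof (rule no_bad_region[where Bad = "\<lambda>C. region V E C \<and> \<not> ?ok C"])
      show "region V E B" if "region V E B \<and> \<not> ?ok B" for B using that by blast
    next
      fix B F assume B: "region V E B \<and> \<not> ?ok B" and F: "finite (F :: 'a set)"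
      show "\<exists>u\<in>B - F. region V E (graph_comp E (B - F) u) \<and> \<not> ?ok (graph_comp E (B - F) u)"
      proof (rule ccontr)
        assume no: "\<not> ?thesis"
        have r: "region V E (graph_comp E (B - F) u)" if "u \<in> B - F" for u
          using region_comp[OF _ F that] B by blast
        then have okF: "?ok (graph_comp E (B - F) u)" if "u \<in> B - F" for u using no that by blast
        have "?ok B" by (rule ends_in_splits[OF r F okF])
        then show False using B by blast
      qed
    next
      fix \<rho> assume \<rho>: "graph_ray V E \<rho>"
      let ?\<omega> = "ray_equiv V E `` {\<rho>}"
      note \<omega> = graph_end_of_ray[OF \<rho>]
      obtain U where U: "U \<in> UU" "?\<omega> \<in> U" using UU \<omega>(1) by blast
      then have oU: "openin (end_space V E) U" using UU by blast
      obtain S where S: "finite S" "S \<subseteq> V" "end_nbhd V E S ?\<omega> \<subseteq> U"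
        by (rule openin_end_space_nbhd[OF oU U(2)]) (rule that)
      \<comment> \<open>A region that avoids \<open>S\<close> and carries a tail of the ray has all
        its ends in the member \<open>U\<close> of the cover, so it splits trivially.\<close>
      have "B \<inter> S \<noteq> {}" if B: "region V E B" "\<not> ?ok B" "has_tail_in \<rho> B" for B
      proof
        assume BS: "B \<inter> S = {}"
        have "?\<omega> \<in> ends_in V E B" by (rule region_ends_inI[OF B(1) \<omega> B(3)])
        then have "ends_in V E B \<subseteq> end_nbhd V E S ?\<omega>" by (rule ends_in_subset_nbhd[OF B(1) BS S(1,2)])
        then have "?ok B" using splits_base[OF openin_ends_in[OF B(1)] U(1)] S(3) by (meson order_trans)
        then show False using B(2) by blast
      qed
      then show "\<exists>S. finite S \<and> (\<forall>B. (region V E B \<and> \<not> ?ok B) \<and> has_tail_in \<rho> B \<longrightarrow> B \<inter> S \<noteq> {})"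
        using S(1) by blast
    qed
    then show ?thesis using C by blast
  qed
  have "region V E (graph_comp E (V - {}) u)" if "u \<in> V - {}" for u
    by (rule region_of_component(1)[of "{}"]) (use that in \<open>auto simp: graph_components_eq\<close>)
  then have "?ok V" using ends_in_splits[of V "{}" V E] reg_ok by blast
  moreover have "has_tail_in \<rho> V" if "graph_ray V E \<rho>" for \<rho>
    using that unfolding graph_ray_def has_tail_in_def by blast
  then have "ends_in V E V = graph_ends V E" unfolding ends_in_def using graph_endD(2) by fast
  ultimately show "splits (end_space V E) UU (graph_ends V E)" by simp
qed

text \<open>A label is a region with a base vertex. \<open>P\<close> leads from the old base vertex
  to a neighbour of the new one while staying outside of the new region, so that the paths of a play
  can be joined to a ray and never enter the intersection of its regions.\<close>

definition end_label_step :: "'v set set \<Rightarrow> 'v set \<times> 'v \<Rightarrow> 'v set \<times> 'v \<Rightarrow> bool" where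
  "end_label_step E p q \<longleftrightarrow> fst q \<subseteq> fst p \<and>
     (\<exists>P. P \<subseteq> fst p - fst q \<and> graph_conn E P \<and> snd p \<in> P \<and> (\<exists>y\<in>P. {y, snd q} \<in> E))"

lemma metrizable_end_space_imp_completely_ultrametrizable:
  assumes met: "metrizable_space (end_space V E)"
  shows "completely_ultrametrizable_space (end_space V E)"
proof (rule ultraparacompact_labels_imp_completely_ultrametrizable[OF met end_space_ultraparacompact,
      where L = "{(C, x). region V E C \<and> x \<in> C}" and N = "\<lambda>p. ends_in V E (fst p)" and R = "end_label_step E"])
  fix \<omega> assume "\<omega> \<in> topspace (end_space V E)"
  then have \<omega>: "\<omega> \<in> graph_ends V E" unfolding topspace_end_space .
  let ?C = "end_component V E {} \<omega>"
  have C: "region V E ?C" "\<omega> \<in> ends_in V E ?C"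
    using region_of_component(1) end_component[OF \<omega>] by (metis empty_subsetI finite.emptyI)+
  obtain x where "x \<in> ?C" using regionD(1)[OF C(1)] by blast
  then show "\<exists>p\<in>{(C, x). region V E C \<and> x \<in> C}. \<omega> \<in> ends_in V E (fst p)"
    using C by (intro bexI[of _ "(?C, x)"]) simp_all
next
  show "openin (end_space V E) (ends_in V E (fst p))" if "p \<in> {(C, x). region V E C \<and> x \<in> C}" for p
    using that openin_ends_in by auto
next
  fix p \<omega> W
  assume p: "p \<in> {(C, x). region V E C \<and> x \<in> C}" and \<omega>: "\<omega> \<in> ends_in V E (fst p)"
    and W: "openin (end_space V E) W" "\<omega> \<in> W"
  obtain C x where Cx: "p = (C, x)" "region V E C" "x \<in> C" using p by blast
  have \<omega>C: "\<omega> \<in> ends_in V E C" using \<omega> Cx(1) by simp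
  obtain S where S: "finite S" "S \<subseteq> V" "end_nbhd V E S \<omega> \<subseteq> W" by (rule openin_end_space_nbhd[OF W]) (rule that)
  have SC: "finite (S \<inter> C)" "S \<inter> C \<subseteq> C" using S(1) by auto
  \<comment> \<open>A finite connected set that contains both the base vertex and the part of
    \<open>S\<close> in \<open>C\<close>. The component of \<open>C - P\<close> in which the end
    lives avoids \<open>S\<close> and is attached to \<open>P\<close>.\<close>
  obtain P where P: "finite P" "P \<subseteq> C" "insert x (S \<inter> C) \<subseteq> P" "graph_conn E P"
    by (rule finite_connected_superset[OF regionD(3)[OF Cx(2)] SC Cx(3)]) (rule that)
  obtain \<rho> where \<rho>: "\<rho> \<in> \<omega>" using graph_endD(1)[OF ends_inD(1)[OF \<omega>C]] by blast
  obtain u where u: "u \<in> C - P" "has_tail_in \<rho> (graph_comp E (C - P) u)"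
    by (rule ray_tail_component[OF graph_endD(2)[OF ends_inD(1)[OF \<omega>C] \<rho>] ends_inD(2)[OF \<omega>C \<rho>] P(1)]) (rule that)
  define D where "D = graph_comp E (C - P) u"
  have D: "region V E D" unfolding D_def by (rule region_comp[OF Cx(2) P(1) u(1)])
  have DC: "D \<subseteq> C - P" unfolding D_def by (rule graph_comp_subset)
  then have "D \<subset> C" using Cx(3) P(3) by blast
  then obtain y where y: "y \<in> graph_nb V E D" "y \<in> C" using region_nb_meets[OF Cx(2) _ regionD(1)[OF D]] by blast
  have "y \<in> graph_nb V E C \<union> (P \<inter> C)" using y(1) graph_comp_nb[of V E C P u] unfolding D_def by blast
  then have yP: "y \<in> P" using y(2) unfolding graph_nb_def by blast
  obtain z where z: "z \<in> D" "{z, y} \<in> E" using y(1) unfolding graph_nb_def by blast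
  have \<omega>D: "\<omega> \<in> ends_in V E D"
    using region_ends_inI[OF D ends_inD(1)[OF \<omega>C] \<rho>] u(2) unfolding D_def by blast
  have "D \<inter> S = {}" using DC P(3) by blast
  then have "ends_in V E D \<subseteq> W" using ends_in_subset_nbhd[OF D _ S(1,2) \<omega>D] S(3) by (meson order_trans)
  moreover have "end_label_step E p (D, z)"
    unfolding end_label_step_def Cx(1) fst_conv snd_conv
  proof (intro conjI exI[of _ P])
    show "D \<subseteq> C" "P \<subseteq> C - D" "graph_conn E P" "x \<in> P" using DC P by blast+
    show "\<exists>y\<in>P. {y, z} \<in> E" using yP z(2) by (metis insert_commute)
  qed
  ultimately show "\<exists>q\<in>{(C, x). region V E C \<and> x \<in> C}. end_label_step E p q \<and> \<omega> \<in> ends_in V E (fst q) \<and> ends_in V E (fst q) \<subseteq> W"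
    using D z(1) \<omega>D by (intro bexI[of _ "(D, z)"]) simp_all
next
  fix p :: "nat \<Rightarrow> 'a set \<times> 'a"
  assume H: "\<And>n. p n \<in> {(C, x). region V E C \<and> x \<in> C} \<and> ends_in V E (fst (p n)) \<noteq> {} \<and>
    ends_in V E (fst (p (Suc n))) \<subseteq> ends_in V E (fst (p n)) \<and> end_label_step E (p n) (p (Suc n))"
  have p: "p n \<in> {(C, x). region V E C \<and> x \<in> C}" "end_label_step E (p n) (p (Suc n))" for n
    using H[of n] by - (elim conjE, assumption)+
  define C where "C n = fst (p n)" for n
  define x where "x n = snd (p n)" for n
  have Cx: "region V E (C n)" "x n \<in> C n" for n using p(1)[of n] unfolding C_def x_def by auto
  have Cdec: "C (Suc n) \<subseteq> C n" for n using p(2)[of n] unfolding end_label_step_def C_def by blast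
  have "\<exists>P. P \<subseteq> C n - C (Suc n) \<and> graph_conn E P \<and> x n \<in> P \<and> (\<exists>y\<in>P. {y, x (Suc n)} \<in> E)" for n
    using p(2)[of n] unfolding end_label_step_def C_def x_def by blast
  then obtain P where P: "\<And>n. P n \<subseteq> C n - C (Suc n) \<and> graph_conn E (P n) \<and> x n \<in> P n \<and> (\<exists>y\<in>P n. {y, x (Suc n)} \<in> E)"
    by metis
  \<comment> \<open>Removing the common part makes these sets decrease to the empty set.
    \<open>P n\<close> survives because it misses \<open>C (Suc n)\<close>.\<close>
  define K where "K n = C n - (\<Inter>k. C k)" for n
  have PK: "P n \<subseteq> K n" for n using P[of n] unfolding K_def by blast
  have xK: "x n \<in> K n" for n using P[of n] PK[of n] by blast
  have Kdec: "K (Suc n) \<subseteq> K n" for n using Cdec[of n] unfolding K_def by blast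
  obtain \<rho> where \<rho>: "graph_ray V E \<rho>" "\<And>n. has_tail_in \<rho> (K n)"
  proof (rule ray_through[of K V x E, OF Kdec _ _ xK])
    show "K 0 \<subseteq> V" using regionD(2)[OF Cx(1), of 0] unfolding K_def by blast
    show "(\<Inter>n. K n) = {}" unfolding K_def by blast
    fix n
    obtain y where y: "y \<in> P n" "{y, x (Suc n)} \<in> E" using P by blast
    have "graph_conn E (insert (x (Suc n)) (P n))" by (rule graph_conn_insert[OF _ y]) (use P in blast)
    then have "(x n, x (Suc n)) \<in> (gadj E (insert (x (Suc n)) (P n)))\<^sup>*" using graph_connD P by (metis insertCI)
    moreover have "insert (x (Suc n)) (P n) \<subseteq> K n" using PK[of n] xK[of "Suc n"] Kdec[of n] by blast
    ultimately show "(x n, x (Suc n)) \<in> (gadj E (K n))\<^sup>*" by (rule gadj_mono[rotated])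
  qed (rule that)
  have "has_tail_in \<rho> (C n)" for n by (rule has_tail_in_mono[OF \<rho>(2)[of n]]) (simp add: K_def)
  then have "ray_equiv V E `` {\<rho>} \<in> ends_in V E (fst (p n))" for n
    using region_ends_inI[OF Cx(1) graph_end_of_ray[OF \<rho>(1)]] unfolding C_def by blast
  then show "\<exists>\<omega>. \<forall>n. \<omega> \<in> ends_in V E (fst (p n))" by blast
qed


section \<open>Trees from scales\<close>

text \<open>The height bound concerns branches, so the chain below \<open>t\<close> is first
  extended to one; its embedding into the natural numbers sends the strict predecessors of
  \<open>t\<close> to an initial segment below a number.\<close>

lemma graph_theoretic_tree_finite_below:
  assumes r: "graph_theoretic_tree r" and t: "t \<in> Field r"
  shows "finite (underS r t)"
proof -
  have ot: "order_tree r" using r unfolding graph_theoretic_tree_def by blast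
  obtain B where B: "tree_branch r B" "{x. (x, t) \<in> r} \<subseteq> B"
    by (rule tree_path_extends_to_branch[OF tree_path_under[OF ot t]]) (rule that)
  note path = branchD(1)[OF B(1)]
  let ?R = "Restr r B"
  have "(?R, natLeq) \<in> ordLeq" using r B(1) unfolding graph_theoretic_tree_def by blast
  then obtain f where W: "Well_order ?R" and f: "embed ?R natLeq f" unfolding ordLeq_def by blast
  have tt: "(t, t) \<in> r" by (rule order_tree_refl[OF ot t])
  then have "t \<in> Field ?R" using B(2) by (intro FieldI1[of t t]) blast
  then have "bij_betw f (underS ?R t) (underS natLeq (f t))" by (rule embed_underS[OF W f])
  moreover have "finite (underS natLeq (f t))" unfolding natLeq_underS_less by simp
  ultimately have "finite (underS ?R t)" using bij_betw_finite by blast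
  moreover have "underS r t \<subseteq> underS ?R t" using B(2) tt unfolding underS_def by blast
  ultimately show ?thesis by (rule finite_subset[rotated])
qed

lemma pruned_branch_is_ray:
  assumes r: "order_tree r" and p: "pruned_tree r" and B: "tree_branch r B"
  shows "tree_ray r B"
  unfolding tree_ray_def
proof (intro conjI notI)
  show path: "tree_path r B" by (rule branchD(1)[OF B])
  assume "\<exists>m\<in>B. \<forall>x\<in>B. (m, x) \<in> r \<longrightarrow> x = m"
  then obtain m where m: "m \<in> B" "\<And>x. x \<in> B \<Longrightarrow> (m, x) \<in> r \<Longrightarrow> x = m" by blast
  obtain u where u: "(m, u) \<in> r" "m \<noteq> u"
    using p tree_path_Field[OF path m(1)] unfolding pruned_tree_def tree_succ_def by blast
  have uF: "u \<in> Field r" by (rule order_tree_Field(2)[OF u(1)])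
  have "(x, u) \<in> r" if "x \<in> B" for x
  proof -
    have "(x, m) \<in> r" using tree_pathD(2)[OF path \<open>x \<in> B\<close> m(1)] m(2)[OF \<open>x \<in> B\<close>] by blast
    then show ?thesis by (rule order_tree_trans[OF r _ u(1)])
  qed
  then have "B \<subseteq> {x. (x, u) \<in> r}" by blast
  then have "{x. (x, u) \<in> r} = B" by (rule branchD(2)[OF B tree_path_under[OF r uF]])
  then have "u \<in> B" using order_tree_refl[OF r uF] by blast
  then show False using m(2)[of u] u by blast
qed

lemma Hausdorff_set_space: "Hausdorff_space (set_space PP)"
  unfolding Hausdorff_space_def topspace_set_space
proof (intro allI impI)
  have *: "\<exists>U V. openin (set_space PP) U \<and> openin (set_space PP) V \<and> P \<in> U \<and> Q \<in> V \<and> disjnt U V"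
    if "P \<in> PP" "Q \<in> PP" "x \<in> P" "x \<notin> Q" for P Q x
    by (rule exI[of _ "set_nbhd PP {x} {}"], rule exI[of _ "set_nbhd PP {} {x}"], intro conjI openin_set_nbhd)
      (use that in \<open>auto simp: set_nbhd_def disjnt_def\<close>)
  fix P Q assume PQ: "P \<in> PP \<and> Q \<in> PP \<and> P \<noteq> Q"
  then consider x where "x \<in> P" "x \<notin> Q" | x where "x \<in> Q" "x \<notin> P" by blast
  then show "\<exists>U V. openin (set_space PP) U \<and> openin (set_space PP) V \<and> P \<in> U \<and> Q \<in> V \<and> disjnt U V"
  proof cases
    case 1
    then show ?thesis using * PQ by blast
  next
    case 2
    then show ?thesis using *[of Q P x] PQ by (metis disjnt_sym)
  qed
qed

text \<open>Branches are compared on their nodes of level below \<open>n\<close>. This scale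
  supplies metrizability, after which the result on metrizable branch spaces applies.\<close>

lemma graph_theoretic_tree_completely_ultrametrizable:
  assumes g: "graph_theoretic_tree r" and p: "pruned_tree r"
  shows "completely_ultrametrizable_space (branch_space r)"
proof -
  have r: "order_tree r" using g unfolding graph_theoretic_tree_def by blast
  define lev where "lev t = card (underS r t)" for t
  have lev_less: "lev t < lev u" if "(t, u) \<in> r" "t \<noteq> u" for t u
    unfolding lev_def
  proof (rule psubset_card_mono)
    show "finite (underS r u)" by (rule graph_theoretic_tree_finite_below[OF g order_tree_Field(2)[OF that(1)]])
    have "(x, u) \<in> r \<and> x \<noteq> u" if "(x, t) \<in> r" "x \<noteq> t" for x
      using order_tree_trans[OF r that(1) \<open>(t, u) \<in> r\<close>] order_tree_antisym[OF r \<open>(t, u) \<in> r\<close>] that \<open>t \<noteq> u\<close> by blast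
    then have "underS r t \<subseteq> underS r u" unfolding underS_def by blast
    moreover have "t \<in> underS r u" "t \<notin> underS r t" using that unfolding underS_def by auto
    ultimately show "underS r t \<subset> underS r u" by blast
  qed
  have deep: "\<exists>t\<in>B. lev t \<ge> n" if B: "tree_branch r B" for B n
  proof (induction n)
    case 0
    show ?case using tree_pathD(1)[OF branchD(1)[OF B]] by blast
  next
    case (Suc n)
    then obtain t where t: "t \<in> B" "lev t \<ge> n" by blast
    obtain u where "u \<in> B" "(t, u) \<in> r" "u \<noteq> t" using rayD(2)[OF pruned_branch_is_ray[OF r p B] t(1)] by blast
    then show ?case using lev_less[of t u] t(2) by (intro bexI[of _ u]) auto
  qed
  define low where "low n B = {t \<in> B. lev t < n}" for n B
  define c where "c n B = {Q. tree_branch r Q \<and> low n Q = low n B}" for n B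
  \<comment> \<open>On \<open>P\<close> a node of level below \<open>n\<close> is comparable with
    \<open>t\<close>, and its smaller level forces it below \<open>t\<close>, hence onto
    \<open>Q\<close>.\<close>
  have sub: "low n P \<subseteq> low n Q" if P: "tree_branch r P" and Q: "tree_branch r Q" and t: "t \<in> P" "t \<in> Q" "lev t \<ge> n" for n P Q t
  proof
    fix x assume "x \<in> low n P"
    then have x: "x \<in> P" "lev x < n" unfolding low_def by auto
    have "(x, t) \<in> r"
      using tree_pathD(2)[OF branchD(1)[OF P] x(1) t(1)] lev_less[of t x] x(2) t(3) by fastforce
    then have "x \<in> Q" by (rule tree_pathD(3)[OF branchD(1)[OF Q] t(2)])
    then show "x \<in> low n Q" using x(2) unfolding low_def by blast
  qed
  let ?X = "set_space (branches r)"
  have "ultra_scale ?X c"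
    unfolding ultra_scale_def topspace_set_space
  proof (intro conjI allI ballI impI)
    fix n B assume "B \<in> branches r"
    then have B: "tree_branch r B" by blast
    show "B \<in> c n B" using B unfolding c_def by blast
    show "c n Q = c n B" if "Q \<in> c n B" for Q using that unfolding c_def by simp
    show "c (Suc n) B \<subseteq> c n B"
    proof
      fix Q assume Q: "Q \<in> c (Suc n) B"
      have "low n P = {t \<in> low (Suc n) P. lev t < n}" for P unfolding low_def by auto
      then show "Q \<in> c n B" using Q unfolding c_def by simp
    qed
    show "openin ?X (c n B)"
    proof (subst openin_subopen, intro ballI)
      fix Q assume Q: "Q \<in> c n B"
      then have Qb: "tree_branch r Q" "low n Q = low n B" unfolding c_def by auto
      obtain t where t: "t \<in> Q" "lev t \<ge> n" using deep[OF Qb(1)] by blast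
      have "{P. tree_branch r P \<and> t \<in> P} \<subseteq> c n B"
      proof
        fix P assume "P \<in> {P. tree_branch r P \<and> t \<in> P}"
        then have P: "tree_branch r P" "t \<in> P" by auto
        have "low n P = low n Q" using sub[OF P(1) Qb(1) P(2) t] sub[OF Qb(1) P(1) t(1) P(2) t(2)] by blast
        then show "P \<in> c n B" using P(1) Qb(2) unfolding c_def by simp
      qed
      then show "\<exists>T. openin ?X T \<and> Q \<in> T \<and> T \<subseteq> c n B"
        using openin_branch_cone[of r t] Qb(1) t(1) by (intro exI[of _ "{P. tree_branch r P \<and> t \<in> P}"]) simp
    qed
  next
    fix U B assume U: "openin ?X U \<and> B \<in> U"
    obtain t where t: "t \<in> B" "{Q. tree_branch r Q \<and> t \<in> Q} \<subseteq> U"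
      by (rule branch_nbhd[OF r conjunct1[OF U] conjunct2[OF U]]) (rule that)
    have "c (Suc (lev t)) B \<subseteq> {Q. tree_branch r Q \<and> t \<in> Q}"
    proof
      fix Q assume Q: "Q \<in> c (Suc (lev t)) B"
      have "t \<in> low (Suc (lev t)) B" using t(1) unfolding low_def by simp
      then have "t \<in> low (Suc (lev t)) Q" using Q unfolding c_def by simp
      then show "Q \<in> {Q. tree_branch r Q \<and> t \<in> Q}" using Q unfolding c_def low_def by simp
    qed
    then have "c (Suc (lev t)) B \<subseteq> U" using t(2) by (rule order_trans)
    then show "\<exists>n. c n B \<subseteq> U" by (rule exI)
  qed
  then have "metrizable_space ?X" using Hausdorff_set_space by (rule scale_imp_metrizable)
  then have "metrizable_space (branch_space r)"
    using homeomorphic_metrizable_space[OF branch_space_homeomorphic] by blast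
  then show ?thesis by (rule metrizable_branch_space_imp_completely_ultrametrizable[OF r])
qed

lemma shared_tail_ray_equiv:
  assumes \<rho>: "graph_ray V E \<rho>" and \<sigma>: "graph_ray V E \<sigma>" and eq: "\<And>i. \<rho> (m + i) = \<sigma> (k + i)"
  shows "(\<rho>, \<sigma>) \<in> ray_equiv V E"
proof (rule ray_equivI[OF \<rho> \<sigma>])
  fix S :: "'a set" assume "finite S" "S \<subseteq> V"
  obtain C where C: "C \<in> graph_components V E S" "has_tail_in \<rho> C" using ray_has_component[OF \<rho> \<open>finite S\<close>] by blast
  obtain j where j: "\<forall>i\<ge>j. \<rho> i \<in> C" using C(2) unfolding has_tail_in_def by blast
  have "\<sigma> i \<in> C" if "i \<ge> k + j" for i
  proof -
    have "\<sigma> i = \<rho> (m + (i - k))" using eq[of "i - k"] that by simp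
    moreover have "m + (i - k) \<ge> j" using that by simp
    ultimately show ?thesis using j by simp
  qed
  then have "has_tail_in \<sigma> C" unfolding has_tail_in_def by blast
  then show "\<exists>C\<in>graph_components V E S. has_tail_in \<rho> C \<and> has_tail_in \<sigma> C" using C by blast
qed

lemma infinite_times_lepoll:
  assumes "infinite (UNIV :: 'n set)"
  shows "(UNIV :: nat set) \<times> (UNIV :: 'n set) \<lesssim> (UNIV :: 'n set)"
proof -
  have "(UNIV :: nat set) \<lesssim> (UNIV :: 'n set)" using assms infinite_le_lepoll by blast
  then have "(UNIV :: nat set) \<times> (UNIV :: 'n set) \<lesssim> (UNIV :: 'n set) \<times> (UNIV :: 'n set)"
    by (intro times_lepoll_mono lepoll_refl)
  also have "(UNIV :: 'n set) \<times> (UNIV :: 'n set) \<approx> (UNIV :: 'n set)"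
    using card_of_Times_same_infinite[OF assms] unfolding eqpoll_def card_of_ordIso .
  finally show ?thesis .
qed

text \<open>The level is encoded along with the cell because one set can be a cell of many levels,
  for instance at an isolated point; the levels keep every path going. \<open>c0\<close> provides
  the single root.\<close>

locale scale_tree =
  fixes X :: "'a topology" and c :: "nat \<Rightarrow> 'a \<Rightarrow> 'a set" and enc :: "nat \<times> 'a set \<Rightarrow> 'n"
  assumes c: "ultra_scale X c" and comp: "complete_scale X c" and H: "Hausdorff_space X"
    and c0: "\<And>x. x \<in> topspace X \<Longrightarrow> c 0 x = topspace X" and ne: "topspace X \<noteq> {}"
    and enc: "inj_on enc {(n, c n x) | n x. x \<in> topspace X}"
begin

definition node :: "nat \<Rightarrow> 'a \<Rightarrow> 'n" where
  "node n x = enc (n, c n x)"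

definition tree :: "'n rel" where
  "tree = {(node m x, node n x) | m n x. m \<le> n \<and> x \<in> topspace X}"

definition level :: "'n \<Rightarrow> nat" where
  "level t = fst (inv_into {(n, c n x) | n x. x \<in> topspace X} enc t)"

definition path_of :: "'a \<Rightarrow> 'n set" where
  "path_of x = range (\<lambda>n. node n x)"

lemma level_node [simp]: "x \<in> topspace X \<Longrightarrow> level (node n x) = n"
  unfolding level_def node_def by (subst inv_into_f_f[OF enc]) auto

lemma node_eq_iff:
  assumes "x \<in> topspace X" "y \<in> topspace X"
  shows "node m x = node n y \<longleftrightarrow> m = n \<and> c m x = c n y"
proof
  assume "node m x = node n y"
  then have "(m, c m x) = (n, c n y)"
    unfolding node_def by (rule inj_onD[OF enc]) (use assms in auto)
  then show "m = n \<and> c m x = c n y" unfolding prod.inject .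
next
  assume "m = n \<and> c m x = c n y"
  then show "node m x = node n y" unfolding node_def by (elim conjE) simp
qed

lemma cell_eq_iff:
  assumes "x \<in> topspace X" "y \<in> topspace X"
  shows "c n x = c n y \<longleftrightarrow> y \<in> c n x"
  using ultra_scaleD(1)[OF c assms(2)] ultra_scaleD(4)[OF c assms(1)] by metis

lemma node_eqI:
  assumes "x \<in> topspace X" "y \<in> c n x"
  shows "node n x = node n y"
  unfolding node_def using ultra_scaleD(4)[OF c assms] by simp

lemma cell_eq_mono:
  assumes "x \<in> topspace X" "y \<in> topspace X" "c n x = c n y" "m \<le> n"
  shows "c m x = c m y"
  using assms cell_eq_iff ultra_scale_mono[OF c assms(1,4)] by blast

lemma tree_iff:
  assumes "x \<in> topspace X" "y \<in> topspace X"
  shows "(node m x, node n y) \<in> tree \<longleftrightarrow> m \<le> n \<and> c m x = c m y"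
proof
  assume "(node m x, node n y) \<in> tree"
  then obtain m' n' z where z: "node m x = node m' z" "node n y = node n' z" "m' \<le> n'" "z \<in> topspace X"
    unfolding tree_def by blast
  then have "m' = m" "n' = n" "c m x = c m z" "c n y = c n z"
    using node_eq_iff[OF assms(1) z(4)] node_eq_iff[OF assms(2) z(4)] by auto
  then show "m \<le> n \<and> c m x = c m y" using cell_eq_mono[OF assms(2) z(4)] z(3) by metis
next
  assume *: "m \<le> n \<and> c m x = c m y"
  then have "node m x = node m y" by (simp add: node_def)
  then show "(node m x, node n y) \<in> tree" unfolding tree_def using * assms(2) by blast
qed

lemma treeE:
  assumes "(s, t) \<in> tree"
  obtains m n x where "s = node m x" "t = node n x" "m \<le> n" "x \<in> topspace X"
  using assms unfolding tree_def by blast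

lemma Field_tree: "Field tree = {node n x | n x. x \<in> topspace X}"
proof (intro equalityI subsetI)
  fix t assume "t \<in> Field tree"
  then show "t \<in> {node n x | n x. x \<in> topspace X}" unfolding Field_def
    by (auto elim!: treeE)
next
  fix t assume "t \<in> {node n x | n x. x \<in> topspace X}"
  then obtain n x where t: "t = node n x" "x \<in> topspace X" by blast
  then have "(t, t) \<in> tree" using tree_iff by simp
  then show "t \<in> Field tree" by (rule FieldI1)
qed

lemma node_Field: "x \<in> topspace X \<Longrightarrow> node n x \<in> Field tree"
  unfolding Field_tree by blast

lemma FieldE:
  assumes "t \<in> Field tree"
  obtains n x where "t = node n x" "x \<in> topspace X"
  using assms unfolding Field_tree by blast

lemma partial_order_tree: "Partial_order tree"
  unfolding partial_order_on_def preorder_on_def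
proof (intro conjI)
  show "refl_on (Field tree) tree"
    by (rule refl_onI) (auto elim!: FieldE simp: tree_iff)
  show "trans tree"
  proof (rule transI)
    fix s t u assume "(s, t) \<in> tree" "(t, u) \<in> tree"
    then obtain m n x k l y where 1: "s = node m x" "t = node n x" "m \<le> n" "x \<in> topspace X"
      "t = node k y" "u = node l y" "k \<le> l" "y \<in> topspace X" by (elim treeE) blast
    then have "n = k" "c n x = c n y" using node_eq_iff[OF 1(4,8), of n k] by auto
    then show "(s, u) \<in> tree"
      using 1 tree_iff[OF 1(4,8), of m l] cell_eq_mono[OF 1(4,8) _ 1(3)] by auto
  qed
  show "antisym tree"
  proof (rule antisymI)
    fix s t assume "(s, t) \<in> tree" "(t, s) \<in> tree"
    then obtain m n x k l y where 1: "s = node m x" "t = node n x" "m \<le> n" "x \<in> topspace X"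
      "t = node k y" "s = node l y" "k \<le> l" "y \<in> topspace X" by (elim treeE) blast
    then have "n = k" "m = l" using node_eq_iff[OF 1(4,8)] by metis+
    then have "m = n" using 1(3,7) by simp
    then show "s = t" using 1(1,2) by simp
  qed
qed (auto intro: FieldI1 FieldI2)

lemma well_order_Restr_tree:
  assumes tot: "\<And>s t. s \<in> A \<Longrightarrow> t \<in> A \<Longrightarrow> (s, t) \<in> tree \<or> (t, s) \<in> tree"
  shows "Well_order (Restr tree A)" and "A \<subseteq> Field (Restr tree A)"
proof -
  have PO: "Partial_order (Restr tree A)" by (rule Partial_order_Restr[OF partial_order_tree])
  have "wf (Restr tree A - Id)"
  proof (rule wf_subset[OF wf_inv_image[OF wf_less_than, of level]])
    show "Restr tree A - Id \<subseteq> inv_image less_than level"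
    proof
      fix p assume p: "p \<in> Restr tree A - Id"
      then obtain s t where st: "p = (s, t)" "(s, t) \<in> tree" "s \<noteq> t" by auto
      obtain m n x where x: "s = node m x" "t = node n x" "m \<le> n" "x \<in> topspace X" by (rule treeE[OF st(2)]) (rule that)
      then have "m < n" using st(3) by (cases "m = n") auto
      then show "p \<in> inv_image less_than level" using x st(1) by simp
    qed
  qed
  moreover have "total_on (Field (Restr tree A)) (Restr tree A)"
  proof (rule total_onI)
    fix s t assume "s \<in> Field (Restr tree A)" "t \<in> Field (Restr tree A)" "s \<noteq> t"
    then have "s \<in> A" "t \<in> A" unfolding Field_def by auto
    then show "(s, t) \<in> Restr tree A \<or> (t, s) \<in> Restr tree A" using tot by blast
  qed
  ultimately show "Well_order (Restr tree A)" using PO unfolding well_order_on_def linear_order_on_def by simp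
  show "A \<subseteq> Field (Restr tree A)"
  proof
    fix t assume "t \<in> A"
    then have "(t, t) \<in> Restr tree A" using tot by blast
    then show "t \<in> Field (Restr tree A)" by (rule FieldI1)
  qed
qed

lemma order_tree_tree: "order_tree tree"
  unfolding order_tree_def
proof (intro conjI ballI)
  show "Partial_order tree" by (rule partial_order_tree)
  obtain x where x: "x \<in> topspace X" using ne by blast
  have root: "(node 0 x, t) \<in> tree" if "t \<in> Field tree" for t
    using that by (rule FieldE) (simp add: tree_iff[OF x] c0 x)
  show "\<exists>!\<rho>. \<rho> \<in> Field tree \<and> (\<forall>y. (y, \<rho>) \<in> tree \<longrightarrow> y = \<rho>)"
  proof (rule ex1I[of _ "node 0 x"])
    show "node 0 x \<in> Field tree \<and> (\<forall>y. (y, node 0 x) \<in> tree \<longrightarrow> y = node 0 x)"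
    proof (intro conjI allI impI)
      show "node 0 x \<in> Field tree" by (rule node_Field[OF x])
      fix y assume y: "(y, node 0 x) \<in> tree"
      then have "(node 0 x, y) \<in> tree" using root[OF FieldI1] by blast
      then show "y = node 0 x" using y partial_order_tree unfolding partial_order_on_def antisym_def by blast
    qed
    fix \<rho> assume \<rho>: "\<rho> \<in> Field tree \<and> (\<forall>y. (y, \<rho>) \<in> tree \<longrightarrow> y = \<rho>)"
    then show "\<rho> = node 0 x" using root[of \<rho>] by metis
  qed
  fix t assume "t \<in> Field tree"
  then obtain n x where t: "t = node n x" "x \<in> topspace X" by (rule FieldE)
  show "Well_order (Restr tree (underS tree t))"
  proof (rule well_order_Restr_tree(1))
    have below: "\<exists>m. s = node m x" if "(s, t) \<in> tree" for s
    proof -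
      obtain m n' y where y: "s = node m y" "t = node n' y" "m \<le> n'" "y \<in> topspace X" by (rule treeE[OF \<open>(s, t) \<in> tree\<close>]) (rule that)
      then have "n' = n" "c n x = c n y" using t node_eq_iff[OF t(2) y(4), of n n'] by auto
      then have "c m x = c m y" using cell_eq_mono[OF t(2) y(4)] y(3) by simp
      then show ?thesis using y(1) by (simp add: node_def) metis
    qed
    fix s u assume "s \<in> underS tree t" "u \<in> underS tree t"
    then obtain m k where "s = node m x" "u = node k x" using below unfolding underS_def by blast
    then show "(s, u) \<in> tree \<or> (u, s) \<in> tree" using tree_iff[OF t(2) t(2)] by auto
  qed
qed

lemma tree_succ_iff: "tree_succ tree s t \<longleftrightarrow> (\<exists>n. \<exists>x\<in>topspace X. s = node n x \<and> t = node (Suc n) x)"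
proof
  assume st: "tree_succ tree s t"
  then obtain m n x where x: "s = node m x" "t = node n x" "m \<le> n" "x \<in> topspace X"
    unfolding tree_succ_def by (elim conjE treeE) blast
  have "m \<noteq> n" using st x unfolding tree_succ_def by blast
  moreover have "\<not> Suc m < n"
  proof
    assume "Suc m < n"
    then have "(s, node (Suc m) x) \<in> tree" "(node (Suc m) x, t) \<in> tree" "node (Suc m) x \<noteq> s" "node (Suc m) x \<noteq> t"
      using x tree_iff[OF x(4) x(4)] node_eq_iff[OF x(4) x(4)] by auto
    then show False using st unfolding tree_succ_def by blast
  qed
  ultimately have "n = Suc m" using x(3) by simp
  then show "\<exists>n. \<exists>x\<in>topspace X. s = node n x \<and> t = node (Suc n) x" using x by blast
next
  assume "\<exists>n. \<exists>x\<in>topspace X. s = node n x \<and> t = node (Suc n) x"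
  then obtain n x where x: "x \<in> topspace X" "s = node n x" "t = node (Suc n) x" by blast
  have "v = s \<or> v = t" if v: "(s, v) \<in> tree" "(v, t) \<in> tree" for v
  proof -
    obtain k y where y: "v = node k y" "y \<in> topspace X" by (rule FieldE[OF FieldI2[OF v(1)]]) (rule that)
    have "n \<le> k" "k \<le> Suc n" "c k x = c k y"
      using v unfolding x(2,3) y(1) tree_iff[OF x(1) y(2)] tree_iff[OF y(2) x(1)] by auto
    then have "v = node k x" "k = n \<or> k = Suc n" using y(1) by (auto simp: node_def)
    then show ?thesis using x(2,3) by blast
  qed
  then show "tree_succ tree s t"
    unfolding tree_succ_def using x tree_iff[OF x(1) x(1)] node_eq_iff[OF x(1) x(1)] by auto
qed

lemma pruned_tree_tree: "pruned_tree tree"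
  unfolding pruned_tree_def tree_succ_iff by (auto elim!: FieldE)

lemma path_of_tree_path:
  assumes x: "x \<in> topspace X"
  shows "tree_path tree (path_of x)"
proof (rule tree_pathI)
  show "path_of x \<noteq> {}" unfolding path_of_def by blast
  show "(s, t) \<in> tree \<or> (t, s) \<in> tree" if "s \<in> path_of x" "t \<in> path_of x" for s t
    using that tree_iff[OF x x] unfolding path_of_def by auto
  fix s t assume s: "s \<in> path_of x" and ts: "(t, s) \<in> tree"
  obtain n where n: "s = node n x" using s unfolding path_of_def by blast
  obtain m y where y: "t = node m y" "y \<in> topspace X" by (rule FieldE[OF FieldI1[OF ts]]) (rule that)
  then have "c m y = c m x" using ts n tree_iff[OF y(2) x] by simp
  then have "t = node m x" using y(1) by (simp add: node_def)
  then show "t \<in> path_of x" unfolding path_of_def by blast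
qed

lemma node_in_path_of:
  assumes "x \<in> topspace X" "y \<in> topspace X"
  shows "node n y \<in> path_of x \<longleftrightarrow> y \<in> c n x"
proof -
  have "node n y \<in> path_of x \<longleftrightarrow> c n x = c n y"
    unfolding path_of_def using node_eq_iff[OF assms(2,1)] by auto
  then show ?thesis using cell_eq_iff[OF assms] by simp
qed

lemma points_eqI:
  assumes xy: "x \<in> topspace X" "y \<in> topspace X" and "\<And>n. y \<in> c n x"
  shows "x = y"
proof (rule ccontr)
  assume "x \<noteq> y"
  then obtain U V where UV: "openin X U" "openin X V" "x \<in> U" "y \<in> V" "disjnt U V"
    using H xy unfolding Hausdorff_space_def by blast
  obtain n where "c n x \<subseteq> U" by (rule ultra_scale_base[OF c UV(1,3)]) (rule that)
  then show False using assms(3)[of n] UV(4,5) by (auto simp: disjnt_iff)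
qed

lemma inj_path_of: "inj_on path_of (topspace X)"
proof (rule inj_onI)
  fix x y assume xy: "x \<in> topspace X" "y \<in> topspace X" "path_of x = path_of y"
  have "node n y \<in> path_of y" for n unfolding path_of_def by blast
  then have "node n y \<in> path_of x" for n using xy(3) by simp
  then show "x = y" using node_in_path_of[OF xy(1,2)] points_eqI[OF xy(1,2)] by blast
qed

text \<open>This is completeness of the scale in terms of nodes: one coherent node per level
  determines a point.\<close>

lemma nodes_have_point:
  assumes y: "\<And>n. y n \<in> topspace X" and step: "\<And>n. c n (y (Suc n)) = c n (y n)"
  obtains z where "z \<in> topspace X" "\<And>n. node n (y n) = node n z"
proof -
  have "\<forall>n. y n \<in> topspace X \<and> y (Suc n) \<in> c n (y n)" using y step ultra_scaleD(1)[OF c] by metis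
  then obtain z where z: "z \<in> topspace X" "\<And>n. z \<in> c n (y n)" using comp unfolding complete_scale_def by blast
  have "node n (y n) = node n z" for n by (rule node_eqI[OF y z(2)])
  then show thesis using that z(1) by blast
qed

text \<open>A path of a point has a node of every level, and comparable nodes of equal level
  coincide, so nothing can be added.\<close>

lemma path_of_branch:
  assumes x: "x \<in> topspace X"
  shows "tree_branch tree (path_of x)"
  unfolding tree_branch_def
proof (intro conjI allI impI)
  show "tree_path tree (path_of x)" by (rule path_of_tree_path[OF x])
  fix Q assume Q: "tree_path tree Q \<and> path_of x \<subseteq> Q"
  have "Q \<subseteq> path_of x"
  proof
    fix t assume t: "t \<in> Q"
    obtain m y where y: "t = node m y" "y \<in> topspace X"
      by (rule FieldE[OF tree_path_Field[OF conjunct1[OF Q] t]]) (rule that)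
    have "node m x \<in> Q" using Q unfolding path_of_def by blast
    then have "(t, node m x) \<in> tree \<or> (node m x, t) \<in> tree" using tree_pathD(2)[OF conjunct1[OF Q] t] by blast
    then have "c m x = c m y" using tree_iff[OF x y(2)] tree_iff[OF y(2) x] y(1) by auto
    then have "t = node m x" using y(1) by (simp add: node_def)
    then show "t \<in> path_of x" unfolding path_of_def by blast
  qed
  then show "Q = path_of x" using Q by blast
qed

lemma ray_is_path_of:
  assumes P: "tree_ray tree P"
  obtains z where "z \<in> topspace X" "P = path_of z"
proof -
  note path = rayD(1)[OF P]
  \<comment> \<open>A ray meets every level: beyond its node of level \<open>n\<close> there is
    another node, whose predecessor of level \<open>Suc n\<close> is on the ray by
    down-closure.\<close>
  have ex: "\<exists>x\<in>topspace X. node n x \<in> P" for n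
  proof (induction n)
    case 0
    obtain t where t: "t \<in> P" using tree_pathD(1)[OF path] by blast
    obtain m x where x: "t = node m x" "x \<in> topspace X" by (rule FieldE[OF tree_path_Field[OF path t]]) (rule that)
    have "(node 0 x, t) \<in> tree" using tree_iff[OF x(2) x(2)] x(1) by simp
    then show ?case using tree_pathD(3)[OF path t] x(2) by blast
  next
    case (Suc n)
    then obtain x where x: "x \<in> topspace X" "node n x \<in> P" by blast
    obtain t where t: "t \<in> P" "(node n x, t) \<in> tree" "t \<noteq> node n x" using rayD(2)[OF P x(2)] by blast
    obtain m y where y: "t = node m y" "y \<in> topspace X" by (rule FieldE[OF tree_path_Field[OF path t(1)]]) (rule that)
    have "n \<le> m" "c n x = c n y" using t(2) tree_iff[OF x(1) y(2)] y(1) by auto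
    moreover have "n \<noteq> m" using t(3) y(1) calculation(2) by (auto simp: node_def)
    ultimately have "(node (Suc n) y, t) \<in> tree" using tree_iff[OF y(2) y(2)] y(1) by simp
    then show ?case using tree_pathD(3)[OF path t(1)] y(2) by blast
  qed
  then obtain y where y: "\<And>n. y n \<in> topspace X" "\<And>n. node n (y n) \<in> P" by metis
  have step: "c n (y (Suc n)) = c n (y n)" for n
  proof -
    have "(node n (y n), node (Suc n) (y (Suc n))) \<in> tree \<or> (node (Suc n) (y (Suc n)), node n (y n)) \<in> tree"
      using tree_pathD(2)[OF path y(2) y(2)] by blast
    then show ?thesis using tree_iff[OF y(1) y(1)] by auto
  qed
  obtain z where z: "z \<in> topspace X" "\<And>n. node n (y n) = node n z"
    by (rule nodes_have_point[of y, OF y(1) step]) (assumption | rule that)+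
  have "path_of z \<subseteq> P" using y(2) z(2) unfolding path_of_def by auto
  then have "P = path_of z" using branchD(2)[OF path_of_branch[OF z(1)] path] by blast
  then show thesis using that z(1) by blast
qed

text \<open>Paths of points are branches, branches are rays as the tree is pruned, and rays are
  paths of points by completeness.\<close>

lemma branches_eq: "branches tree = path_of ` topspace X" and rays_eq: "rays tree = path_of ` topspace X"
proof -
  have 1: "path_of ` topspace X \<subseteq> branches tree" using path_of_branch by blast
  have 2: "branches tree \<subseteq> rays tree" using pruned_branch_is_ray[OF order_tree_tree pruned_tree_tree] by blast
  have 3: "rays tree \<subseteq> path_of ` topspace X"
  proof
    fix P assume "P \<in> rays tree"
    then have P: "tree_ray tree P" by simp
    obtain z where "z \<in> topspace X" "P = path_of z" by (rule ray_is_path_of[OF P]) (rule that)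
    then show "P \<in> path_of ` topspace X" by blast
  qed
  show "branches tree = path_of ` topspace X" "rays tree = path_of ` topspace X" using 1 2 3 by blast+
qed

lemma graph_theoretic_tree_tree: "graph_theoretic_tree tree"
  unfolding graph_theoretic_tree_def
proof (intro conjI allI impI)
  show "order_tree tree" by (rule order_tree_tree)
  fix B assume "tree_branch tree B"
  then obtain x where x: "x \<in> topspace X" "B = path_of x" using branches_eq by blast
  note path = path_of_tree_path[OF x(1)]
  have W: "Well_order (Restr tree B)" and F: "B \<subseteq> Field (Restr tree B)"
    using well_order_Restr_tree[of B] tree_pathD(2)[OF path] x(2) by blast+
  have FB: "Field (Restr tree B) = B" using F by (auto simp: Field_def)
  have "iso (Restr tree B) natLeq level"
    unfolding iso_iff2 FB Field_natLeq
  proof (intro conjI ballI)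
    show "bij_betw level B UNIV"
      unfolding bij_betw_def x(2) path_of_def
    proof
      show "inj_on level (range (\<lambda>n. node n x))" using x(1) by (auto intro!: inj_onI)
      show "level ` range (\<lambda>n. node n x) = UNIV" using x(1) by (simp add: image_image)
    qed
    fix s t assume "s \<in> B" "t \<in> B"
    moreover from this obtain m n where "s = node m x" "t = node n x" unfolding x(2) path_of_def by blast
    ultimately show "(s, t) \<in> Restr tree B \<longleftrightarrow> (level s, level t) \<in> natLeq"
      using x(1) tree_iff[OF x(1) x(1)] by (simp add: natLeq_def)
  qed
  then have "embed (Restr tree B) natLeq level" unfolding iso_def by blast
  then show "(Restr tree B, natLeq) \<in> ordLeq" unfolding ordLeq_def using W natLeq_Well_order by blast
qed

lemma homeomorphic_paths: "X homeomorphic_space set_space (path_of ` topspace X)"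
proof (rule homeomorphic_space_openness[of path_of])
  let ?P = "path_of ` topspace X"
  show "bij_betw path_of (topspace X) (topspace (set_space ?P))"
    using inj_path_of by (simp add: bij_betw_def)
  fix W assume W: "W \<subseteq> topspace X"
  show "openin X W \<longleftrightarrow> openin (set_space ?P) (path_of ` W)"
  proof
    assume op: "openin X W"
    show "openin (set_space ?P) (path_of ` W)"
      unfolding openin_set_space
    proof (intro conjI ballI)
      show "path_of ` W \<subseteq> ?P" using W by blast
      fix P assume "P \<in> path_of ` W"
      then obtain x where x: "x \<in> W" "P = path_of x" by blast
      have xX: "x \<in> topspace X" using x(1) W by blast
      obtain n where n: "c n x \<subseteq> W" by (rule ultra_scale_base[OF c op x(1)]) (rule that)
      have "set_nbhd ?P {node n x} {} \<subseteq> path_of ` W"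
      proof
        fix Q assume "Q \<in> set_nbhd ?P {node n x} {}"
        then obtain y where y: "y \<in> topspace X" "Q = path_of y" "node n x \<in> path_of y"
          unfolding set_nbhd_def by blast
        then have "x \<in> c n y" using node_in_path_of[OF y(1) xX] by simp
        then have "y \<in> c n x" using ultra_scale_sym[OF c xX y(1)] by blast
        then show "Q \<in> path_of ` W" using n y(2) by blast
      qed
      moreover have "P \<in> set_nbhd ?P {node n x} {}" using x(2) xX unfolding set_nbhd_def path_of_def by blast
      ultimately show "\<exists>A F. finite A \<and> finite F \<and> P \<in> set_nbhd ?P A F \<and> set_nbhd ?P A F \<subseteq> path_of ` W"
        by (intro exI[of _ "{node n x}"] exI[of _ "{}"]) simp
    qed
  next
    assume op: "openin (set_space ?P) (path_of ` W)"
    show "openin X W"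
    proof (subst openin_subopen, intro ballI)
      fix x assume x: "x \<in> W"
      have xX: "x \<in> topspace X" using x W by blast
      have "\<forall>Q\<in>path_of ` W. \<exists>A F. finite A \<and> finite F \<and> Q \<in> set_nbhd ?P A F \<and> set_nbhd ?P A F \<subseteq> path_of ` W"
        using op unfolding openin_set_space by (rule conjunct2)
      from bspec[OF this imageI[OF x]] obtain A F where
        AF: "finite A" "finite F" "path_of x \<in> set_nbhd ?P A F" "set_nbhd ?P A F \<subseteq> path_of ` W"
        by (elim exE conjE)
      \<comment> \<open>Beyond the levels of all nodes mentioned: points in one cell of level
        \<open>n\<close> have the same nodes up to level \<open>n\<close>.\<close>
      define n where "n = Max (insert 0 (level ` (A \<union> F)))"
      have n: "level t \<le> n" if "t \<in> A \<union> F" for t unfolding n_def using that AF(1,2) by (intro Max_ge) auto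
      have "y \<in> W" if y: "y \<in> c n x" for y
      proof -
        have yX: "y \<in> topspace X" using y ultra_scaleD(5)[OF c xX] by blast
        have same: "t \<in> path_of x \<longleftrightarrow> t \<in> path_of y" if t: "t \<in> A \<union> F" for t
        proof -
          have "node m x = node m y" if "m \<le> n" for m
            by (rule node_eqI[OF xX subsetD[OF ultra_scale_mono[OF c xX that] y]])
          then show ?thesis using n[OF t] xX yX unfolding path_of_def by force
        qed
        have "A \<subseteq> path_of x" "F \<inter> path_of x = {}" using AF(3) unfolding set_nbhd_def by auto
        then have "A \<subseteq> path_of y" "F \<inter> path_of y = {}" using same by blast+
        then have "path_of y \<in> set_nbhd ?P A F" using yX unfolding set_nbhd_def by blast
        then have "path_of y \<in> path_of ` W" using AF(4) by blast
        then show ?thesis using inj_on_image_mem_iff[OF inj_path_of yX W] by blast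
      qed
      then show "\<exists>T. openin X T \<and> x \<in> T \<and> T \<subseteq> W"
        using ultra_scaleD(1,2)[OF c xX] by (intro exI[of _ "c n x"]) blast
    qed
  qed
qed

section \<open>Ends of the tree of cells\<close>

definition node_ray :: "'a \<Rightarrow> nat \<Rightarrow> 'n" where
  "node_ray x n = node n x"

definition cone :: "nat \<Rightarrow> 'a \<Rightarrow> 'n set" where
  "cone n x = {node m y | m y. n \<le> m \<and> y \<in> c n x}"

lemma edge_iff: "{s, t} \<in> tree_edges tree \<longleftrightarrow>
  (\<exists>n. \<exists>x\<in>topspace X. (s = node n x \<and> t = node (Suc n) x) \<or> (t = node n x \<and> s = node (Suc n) x))"
  unfolding tree_edges_def tree_succ_iff by (auto simp: doubleton_eq_iff)

lemma node_ray:
  assumes x: "x \<in> topspace X"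
  shows "graph_ray (Field tree) (tree_edges tree) (node_ray x)"
  unfolding graph_ray_def node_ray_def
proof (intro conjI allI)
  show "inj (\<lambda>n. node n x)" using node_eq_iff[OF x x] by (auto intro!: injI)
  show "range (\<lambda>n. node n x) \<subseteq> Field tree" using node_Field[OF x] by blast
  show "{node n x, node (Suc n) x} \<in> tree_edges tree" for n unfolding edge_iff using x by blast
qed

lemma node_in_cone:
  assumes "x \<in> topspace X" "y \<in> topspace X"
  shows "node m y \<in> cone n x \<longleftrightarrow> n \<le> m \<and> y \<in> c n x"
proof
  assume "node m y \<in> cone n x"
  then obtain m' z where z: "node m y = node m' z" "n \<le> m'" "z \<in> c n x" unfolding cone_def by blast
  have zX: "z \<in> topspace X" using z(3) ultra_scaleD(5)[OF c assms(1)] by blast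
  have "m = m'" "c m y = c m z" using z(1) node_eq_iff[OF assms(2) zX, of m m'] by auto
  then have "c n y = c n z" using cell_eq_mono[OF assms(2) zX] z(2) by simp
  then show "n \<le> m \<and> y \<in> c n x" using z(2,3) \<open>m = m'\<close> ultra_scaleD(1)[OF c assms(2)] ultra_scaleD(4)[OF c assms(1)] by metis
next
  assume "n \<le> m \<and> y \<in> c n x"
  then show "node m y \<in> cone n x" unfolding cone_def by blast
qed

text \<open>A cone is joined to the rest of the tree only by the edge below its least node. At level
  0 no such edge exists, and the bound by \<open>node (n - 1) x\<close> holds for an empty
  neighbourhood.\<close>

lemma cone_region:
  assumes x: "x \<in> topspace X"
  shows "region (Field tree) (tree_edges tree) (cone n x)"
  unfolding region_def
proof (intro conjI)
  show "cone n x \<noteq> {}" using node_in_cone[OF x x, of n n] ultra_scaleD(1)[OF c x, of n] by blast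
  show "cone n x \<subseteq> Field tree" unfolding cone_def using node_Field ultra_scaleD(5)[OF c x] by blast
  show "graph_conn (tree_edges tree) (cone n x)"
  proof (rule graph_connI)
    fix t assume "t \<in> cone n x"
    then obtain m y where y: "t = node m y" "n \<le> m" "y \<in> c n x" unfolding cone_def by blast
    have yX: "y \<in> topspace X" using y(3) ultra_scaleD(5)[OF c x] by blast
    show "(node n x, t) \<in> (gadj (tree_edges tree) (cone n x))\<^sup>*"
      unfolding y(1) using y(2)
    proof (induction rule: dec_induct)
      case base
      have "node n x = node n y" by (rule node_eqI[OF x y(3)])
      then show ?case by simp
    next
      case (step k)
      have "node k y \<in> cone n x" "node (Suc k) y \<in> cone n x" using step(1) y(3) node_in_cone[OF x yX] by auto
      moreover have "{node k y, node (Suc k) y} \<in> tree_edges tree" unfolding edge_iff using yX by blast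
      ultimately have "(node k y, node (Suc k) y) \<in> gadj (tree_edges tree) (cone n x)" by simp
      then show ?case by (rule rtrancl_into_rtrancl[OF step(3)])
    qed
  qed
  have "graph_nb (Field tree) (tree_edges tree) (cone n x) \<subseteq> {node (n - 1) x}"
  proof
    fix v assume "v \<in> graph_nb (Field tree) (tree_edges tree) (cone n x)"
    then obtain t where t: "v \<notin> cone n x" "t \<in> cone n x" "{t, v} \<in> tree_edges tree" unfolding graph_nb_def by blast
    from t(3) obtain k z where z: "z \<in> topspace X" "(t = node k z \<and> v = node (Suc k) z) \<or> (v = node k z \<and> t = node (Suc k) z)"
      unfolding edge_iff by blast
    from z(2) show "v \<in> {node (n - 1) x}"
    proof
      assume "t = node k z \<and> v = node (Suc k) z"
      then have False using t(1,2) node_in_cone[OF x z(1)] by auto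
      then show ?thesis ..
    next
      assume v: "v = node k z \<and> t = node (Suc k) z"
      then have k: "n = Suc k" "z \<in> c n x" using t(1,2) node_in_cone[OF x z(1)] by auto
      have "c n x = c n z" using k(2) cell_eq_iff[OF x z(1)] by simp
      then have "c k x = c k z" by (rule cell_eq_mono[OF x z(1)]) (simp add: k(1))
      then show ?thesis using v k(1) by (simp add: node_def)
    qed
  qed
  then show "finite (graph_nb (Field tree) (tree_edges tree) (cone n x))" by (rule finite_subset) simp
qed

text \<open>Once an injective walk in the tree goes up, it keeps going up; and it cannot go down forever.\<close>

lemma graph_ray_tail:
  assumes \<rho>: "graph_ray (Field tree) (tree_edges tree) \<rho>"
  obtains z m k where "z \<in> topspace X" "\<And>i. \<rho> (m + i) = node_ray z (k + i)"
proof -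
  have inj: "inj \<rho>" and edge: "\<And>i. {\<rho> i, \<rho> (Suc i)} \<in> tree_edges tree"
    using \<rho> unfolding graph_ray_def by auto
  define up where "up i \<longleftrightarrow> (\<exists>n. \<exists>x\<in>topspace X. \<rho> i = node n x \<and> \<rho> (Suc i) = node (Suc n) x)" for i
  have up_or: "up i \<or> level (\<rho> i) = Suc (level (\<rho> (Suc i)))" for i
  proof -
    obtain n x where x: "x \<in> topspace X" "(\<rho> i = node n x \<and> \<rho> (Suc i) = node (Suc n) x) \<or> (\<rho> (Suc i) = node n x \<and> \<rho> i = node (Suc n) x)"
      using edge[of i] unfolding edge_iff by blast
    then show ?thesis unfolding up_def by auto
  qed
  have "\<exists>m. up m"
  proof (rule ccontr)
    assume no: "\<nexists>m. up m"
    \<comment> \<open>Descending at every step would lower the level by one each time, which fails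
      beyond the initial level.\<close>
    have "level (\<rho> i) + i = level (\<rho> 0)" for i
      using up_or no by (induction i) (metis add_0_right, metis add_Suc add_Suc_right)
    from this[of "Suc (level (\<rho> 0))"] show False by simp
  qed
  then obtain m where m: "up m" by blast
  have up_Suc: "up (Suc i)" if "up i" for i
  proof -
    obtain n x where x: "x \<in> topspace X" "\<rho> i = node n x" "\<rho> (Suc i) = node (Suc n) x" using \<open>up i\<close> unfolding up_def by blast
    obtain k y where y: "y \<in> topspace X" "(\<rho> (Suc i) = node k y \<and> \<rho> (Suc (Suc i)) = node (Suc k) y) \<or>
        (\<rho> (Suc (Suc i)) = node k y \<and> \<rho> (Suc i) = node (Suc k) y)"
      using edge[of "Suc i"] unfolding edge_iff by blast
    from y(2) show ?thesis
    proof
      assume "\<rho> (Suc i) = node k y \<and> \<rho> (Suc (Suc i)) = node (Suc k) y"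
      then show ?thesis unfolding up_def using y(1) by blast
    next
      assume d: "\<rho> (Suc (Suc i)) = node k y \<and> \<rho> (Suc i) = node (Suc k) y"
      then have "k = n" "c (Suc n) x = c (Suc n) y" using x(3) node_eq_iff[OF x(1) y(1), of "Suc n" "Suc k"] by auto
      \<comment> \<open>A node has only one predecessor of the next lower level, so turning down
        after a step up would return to the vertex just left.\<close>
      then have "\<rho> (Suc (Suc i)) = \<rho> i" using d x(2) cell_eq_mono[OF x(1) y(1), of "Suc n" n] by (simp add: node_def)
      then have "Suc (Suc i) = i" by (rule injD[OF inj])
      then show ?thesis by simp
    qed
  qed
  have ups: "up (m + i)" for i by (induction i) (use m up_Suc in auto)
  define k where "k = level (\<rho> m)"
  have "\<exists>y\<in>topspace X. \<rho> (m + i) = node (k + i) y" for i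
  proof (induction i)
    case 0
    show ?case using m unfolding up_def k_def by auto
  next
    case (Suc i)
    then obtain y where y: "y \<in> topspace X" "\<rho> (m + i) = node (k + i) y" by blast
    obtain n x where x: "x \<in> topspace X" "\<rho> (m + i) = node n x" "\<rho> (Suc (m + i)) = node (Suc n) x"
      using ups[of i] unfolding up_def by blast
    then have "n = k + i" using y node_eq_iff[OF y(1) x(1), of "k + i" n] by simp
    then show ?case using x by auto
  qed
  then obtain y where y: "\<And>i. y i \<in> topspace X" "\<And>i. \<rho> (m + i) = node (k + i) (y i)" by metis
  have ystep: "c (k + i) (y (Suc i)) = c (k + i) (y i)" for i
  proof -
    obtain n x where x: "x \<in> topspace X" "\<rho> (m + i) = node n x" "\<rho> (Suc (m + i)) = node (Suc n) x"
      using ups[of i] unfolding up_def by blast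
    have 1: "n = k + i" "c n x = c n (y i)" using x(2) y(2)[of i] node_eq_iff[OF x(1) y(1), of n "k + i" i] by auto
    have "c (Suc n) x = c (Suc n) (y (Suc i))"
      using x(3) y(2)[of "Suc i"] node_eq_iff[OF x(1) y(1), of "Suc n" "k + Suc i" "Suc i"] 1(1) by auto
    then have "c n x = c n (y (Suc i))" using cell_eq_mono[OF x(1) y(1), of "Suc n" "Suc i" n] by simp
    then show ?thesis using 1 by simp
  qed
  \<comment> \<open>For \<open>n < k\<close> the subtraction is 0 and \<open>y 0\<close> is used,
    whose nodes are the predecessors of the starting node of the tail.\<close>
  define w where "w n = y (n - k)" for n
  have wstep: "c n (w (Suc n)) = c n (w n)" for n
  proof (cases "k \<le> n")
    case True
    then show ?thesis using ystep[of "n - k"] by (simp add: w_def Suc_diff_le)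
  qed (simp add: w_def)
  obtain z where z: "z \<in> topspace X" "\<And>n. node n (w n) = node n z"
    by (rule nodes_have_point[of w, OF _ wstep]) (auto simp: w_def y(1) intro: that)
  have "\<rho> (m + i) = node_ray z (k + i)" for i using y(2)[of i] z(2)[of "k + i"] by (simp add: w_def node_ray_def)
  then show thesis using that z(1) by blast
qed

definition end_of :: "'a \<Rightarrow> (nat \<Rightarrow> 'n) set" where
  "end_of x = ray_equiv (Field tree) (tree_edges tree) `` {node_ray x}"

lemma end_of:
  assumes "x \<in> topspace X"
  shows "end_of x \<in> graph_ends (Field tree) (tree_edges tree)" "node_ray x \<in> end_of x"
  using graph_end_of_ray[OF node_ray[OF assms]] unfolding end_of_def by simp_all

lemma end_of_in_cone:
  assumes "x \<in> topspace X" "y \<in> topspace X"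
  shows "end_of y \<in> ends_in (Field tree) (tree_edges tree) (cone n x) \<longleftrightarrow> y \<in> c n x"
proof
  assume "end_of y \<in> ends_in (Field tree) (tree_edges tree) (cone n x)"
  then have "has_tail_in (node_ray y) (cone n x)" using end_of(2)[OF assms(2)] by (rule ends_inD(2))
  then obtain m where "node m y \<in> cone n x" unfolding has_tail_in_def node_ray_def by blast
  then show "y \<in> c n x" using node_in_cone[OF assms] by blast
next
  assume "y \<in> c n x"
  then have "has_tail_in (node_ray y) (cone n x)"
    using node_in_cone[OF assms] unfolding has_tail_in_def node_ray_def by blast
  then show "end_of y \<in> ends_in (Field tree) (tree_edges tree) (cone n x)"
    by (rule region_ends_inI[OF cone_region[OF assms(1)] end_of[OF assms(2)]])
qed

text \<open>Cones separate the ends of distinct points. Conversely, a graph ray shares a tail with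
  some \<open>node_ray z\<close> and is therefore equivalent to it.\<close>

lemma bij_end_of: "bij_betw end_of (topspace X) (graph_ends (Field tree) (tree_edges tree))"
  unfolding bij_betw_def
proof (intro conjI equalityI subsetI)
  show "inj_on end_of (topspace X)"
  proof (rule inj_onI)
    fix x y assume xy: "x \<in> topspace X" "y \<in> topspace X" "end_of x = end_of y"
    have "y \<in> c n x" for n
      using end_of_in_cone[OF xy(1,1), of n] end_of_in_cone[OF xy(1,2), of n] ultra_scaleD(1)[OF c xy(1)] xy(3) by simp
    then show "x = y" by (rule points_eqI[OF xy(1,2)])
  qed
  show "\<omega> \<in> graph_ends (Field tree) (tree_edges tree)" if "\<omega> \<in> end_of ` topspace X" for \<omega>
    using that end_of(1) by blast
  fix \<omega> assume \<omega>: "\<omega> \<in> graph_ends (Field tree) (tree_edges tree)"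
  obtain \<rho> where \<rho>: "\<rho> \<in> \<omega>" using graph_endD(1)[OF \<omega>] by blast
  note ray = graph_endD(2)[OF \<omega> \<rho>]
  obtain z m k where z: "z \<in> topspace X" "\<And>i. \<rho> (m + i) = node_ray z (k + i)"
    by (rule graph_ray_tail[OF ray]) (rule that)
  have "(\<rho>, node_ray z) \<in> ray_equiv (Field tree) (tree_edges tree)"
    by (rule shared_tail_ray_equiv[OF ray node_ray[OF z(1)] z(2)])
  then have "ray_equiv (Field tree) (tree_edges tree) `` {\<rho>} = end_of z"
    unfolding end_of_def by (rule equiv_class_eq[OF equiv_ray_equiv])
  then have "\<omega> = end_of z" using graph_endD(4)[OF \<omega> \<rho>] by simp
  then show "\<omega> \<in> end_of ` topspace X" using z(1) by blast
qed

lemma homeomorphic_ends: "X homeomorphic_space end_space (Field tree) (tree_edges tree)"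
proof (rule homeomorphic_space_openness[of end_of])
  let ?E = "end_space (Field tree) (tree_edges tree)"
  show "bij_betw end_of (topspace X) (topspace ?E)" unfolding topspace_end_space by (rule bij_end_of)
  have inj: "inj_on end_of (topspace X)" using bij_end_of unfolding bij_betw_def by blast
  have cone_eq: "ends_in (Field tree) (tree_edges tree) (cone n x) = end_of ` c n x" if x: "x \<in> topspace X" for n x
  proof (intro equalityI subsetI)
    fix \<omega> assume \<omega>: "\<omega> \<in> ends_in (Field tree) (tree_edges tree) (cone n x)"
    then obtain y where y: "y \<in> topspace X" "\<omega> = end_of y"
      using bij_end_of ends_inD(1)[OF \<omega>] unfolding bij_betw_def by blast
    then show "\<omega> \<in> end_of ` c n x" using \<omega> end_of_in_cone[OF x y(1)] by blast
  next
    fix \<omega> assume "\<omega> \<in> end_of ` c n x"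
    then obtain y where y: "y \<in> c n x" "\<omega> = end_of y" by blast
    then show "\<omega> \<in> ends_in (Field tree) (tree_edges tree) (cone n x)"
      using end_of_in_cone[OF x ultra_scaleD(5)[OF c x y(1)]] by blast
  qed
  fix W assume W: "W \<subseteq> topspace X"
  show "openin X W \<longleftrightarrow> openin ?E (end_of ` W)"
  proof
    assume op: "openin X W"
    show "openin ?E (end_of ` W)"
    proof (subst openin_subopen, intro ballI)
      fix \<omega> assume "\<omega> \<in> end_of ` W"
      then obtain x where x: "x \<in> W" "\<omega> = end_of x" by blast
      have xX: "x \<in> topspace X" using x(1) W by blast
      obtain n where n: "c n x \<subseteq> W" by (rule ultra_scale_base[OF c op x(1)]) (rule that)
      have "openin ?E (end_of ` c n x)" using openin_ends_in[OF cone_region[OF xX]] cone_eq[OF xX] by metis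
      moreover have "\<omega> \<in> end_of ` c n x" using x(2) ultra_scaleD(1)[OF c xX] by blast
      moreover have "end_of ` c n x \<subseteq> end_of ` W" using n by blast
      ultimately show "\<exists>T. openin ?E T \<and> \<omega> \<in> T \<and> T \<subseteq> end_of ` W" by blast
    qed
  next
    assume op: "openin ?E (end_of ` W)"
    show "openin X W"
    proof (subst openin_subopen, intro ballI)
      fix x assume x: "x \<in> W"
      have xX: "x \<in> topspace X" using x W by blast
      have xW: "end_of x \<in> end_of ` W" using x by blast
      obtain S where S: "finite S" "S \<subseteq> Field tree" "end_nbhd (Field tree) (tree_edges tree) S (end_of x) \<subseteq> end_of ` W"
        by (rule openin_end_space_nbhd[OF op xW]) (rule that)
      \<comment> \<open>One level above all of \<open>S\<close>, so that the cone of level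
        \<open>n\<close> avoids \<open>S\<close>.\<close>
      define n where "n = Suc (Max (insert 0 (level ` S)))"
      have n: "level t < n" if "t \<in> S" for t unfolding n_def using that S(1) by (intro le_imp_less_Suc Max_ge) auto
      have "cone n x \<inter> S = {}"
      proof (rule ccontr)
        assume "cone n x \<inter> S \<noteq> {}"
        then obtain m y where y: "n \<le> m" "y \<in> c n x" "node m y \<in> S" unfolding cone_def by blast
        then show False using n[OF y(3)] ultra_scaleD(5)[OF c xX y(2)] by simp
      qed
      moreover have "end_of x \<in> ends_in (Field tree) (tree_edges tree) (cone n x)"
        using end_of_in_cone[OF xX xX] ultra_scaleD(1)[OF c xX] by blast
      ultimately have "ends_in (Field tree) (tree_edges tree) (cone n x) \<subseteq> end_nbhd (Field tree) (tree_edges tree) S (end_of x)"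
        by (intro ends_in_subset_nbhd[OF cone_region[OF xX] _ S(1,2)])
      then have "end_of ` c n x \<subseteq> end_of ` W" unfolding cone_eq[OF xX] using S(3) by (rule order_trans)
      moreover have "c n x \<subseteq> topspace X" using ultra_scaleD(5)[OF c xX] by blast
      ultimately have "c n x \<subseteq> W" using inj_on_image_subset_iff[OF inj _ W] by simp
      then show "\<exists>T. openin X T \<and> x \<in> T \<and> T \<subseteq> W"
        using ultra_scaleD(1,2)[OF c xX] by blast
    qed
  qed
qed

end

text \<open>The pairs of level and cell are an image of the product of \<open>nat\<close> with the
  space, and this product embeds into the infinite type \<open>'n\<close>.\<close>

lemma completely_ultrametrizable_imp_tree:
  fixes X :: "'a topology"
  assumes X: "completely_ultrametrizable_space X" and ne: "topspace X \<noteq> {}"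
    and inf: "infinite (UNIV :: 'n set)" and le: "topspace X \<lesssim> (UNIV :: 'n set)"
  obtains r :: "'n rel" where "graph_theoretic_tree r" "pruned_tree r"
    "X homeomorphic_space end_space (Field r) (tree_edges r)" "X homeomorphic_space ray_space r"
    "X homeomorphic_space branch_space r"
proof -
  obtain c where c: "ultra_scale X c" "complete_scale X c" "Hausdorff_space X"
    "\<And>x. x \<in> topspace X \<Longrightarrow> c 0 x = topspace X"
    by (rule completely_ultrametrizable_imp_complete_scale[OF X]) (rule that)
  let ?N = "{(n, c n x) | n x. x \<in> topspace X}"
  have "?N = (\<lambda>(n, x). (n, c n x)) ` (UNIV \<times> topspace X)" by auto
  then have "?N \<lesssim> (UNIV :: nat set) \<times> topspace X" using image_lepoll by metis
  also have "(UNIV :: nat set) \<times> topspace X \<lesssim> (UNIV :: nat set) \<times> (UNIV :: 'n set)"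
    by (intro times_lepoll_mono lepoll_refl le)
  also have "\<dots> \<lesssim> (UNIV :: 'n set)" by (rule infinite_times_lepoll[OF inf])
  finally obtain enc :: "nat \<times> 'a set \<Rightarrow> 'n" where enc: "inj_on enc ?N" unfolding lepoll_def by blast
  interpret scale_tree X c enc by (unfold_locales) (use c ne enc in auto)
  have "X homeomorphic_space ray_space tree"
    using homeomorphic_paths homeomorphic_space_sym[THEN iffD1, OF ray_space_homeomorphic[of tree]]
    unfolding rays_eq by (rule homeomorphic_space_trans)
  moreover have "X homeomorphic_space branch_space tree"
    using homeomorphic_paths homeomorphic_space_sym[THEN iffD1, OF branch_space_homeomorphic[of tree]]
    unfolding branches_eq by (rule homeomorphic_space_trans)
  ultimately show thesis
    by (rule that[OF graph_theoretic_tree_tree pruned_tree_tree homeomorphic_ends])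
qed

section \<open>The equivalences\<close>

lemma simple_graph_tree_edges: "simple_graph (Field r) (tree_edges r)"
  unfolding simple_graph_def tree_edges_def tree_succ_def by (auto intro: FieldI1 FieldI2)

lemma homeomorphic_empty_spaces:
  assumes "topspace X = {}" "topspace Y = {}"
  shows "X homeomorphic_space Y"
  using assms homeomorphic_empty_space_eq[of X Y] by simp

lemma empty_end_space: "topspace (end_space ({} :: 'v set) {}) = {}"
proof -
  have "\<not> graph_ray {} {} \<rho>" for \<rho> :: "nat \<Rightarrow> 'v" unfolding graph_ray_def by simp
  then show ?thesis unfolding topspace_end_space graph_ends_def by simp
qed

text \<open>This represents the empty space as a ray space: the only path of a one-node tree has a
  maximal element. No branch space is empty, since every path extends to a branch.\<close>

lemma singleton_tree:
  shows "order_tree {(a, a)}" and "topspace (ray_space {(a, a)}) = {}"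
proof -
  have F: "Field {(a, a)} = {a}" by (auto simp: Field_def)
  have "Restr {(a, a)} (underS {(a, a)} a) = {}" by (auto simp: underS_def)
  then have "Well_order (Restr {(a, a)} (underS {(a, a)} a))" by (simp only: Field_empty well_order_on_empty)
  moreover have "Partial_order {(a, a)}"
    unfolding F partial_order_on_def preorder_on_def
    by (auto simp: refl_on_def trans_def antisym_def)
  ultimately show "order_tree {(a, a)}" unfolding order_tree_def F by auto
  have "\<not> tree_ray {(a, a)} P" for P
  proof
    assume P: "tree_ray {(a, a)} P"
    obtain x where x: "x \<in> P" using tree_pathD(1)[OF rayD(1)[OF P]] by blast
    obtain y where "(x, y) \<in> {(a, a)}" "y \<noteq> x" using rayD(2)[OF P x] by blast
    then show False by simp
  qed
  then have "rays {(a, a)} = {}" by blast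
  then show "topspace (ray_space {(a, a)}) = {}"
    unfolding ray_space_def by (simp only: image_empty topspace_subtopology Int_empty_right)
qed

lemma completely_ultrametrizable_imp_bases:
  assumes "completely_ultrametrizable_space X"
  obtains \<B> where "base_for X \<B>" "nested_family \<B>" "noetherian_family \<B>" "complete_family \<B>"
    "sigma_discrete_family X \<B>" "ultraparacompact_space X" "Hausdorff_space X"
proof -
  obtain c where c: "ultra_scale X c" "complete_scale X c" "Hausdorff_space X"
    by (rule completely_ultrametrizable_imp_complete_scale[OF assms]) (rule that)
  show thesis
    by (rule that[OF cells_base[OF c(1)] cells_nested[OF c(1)] cells_noetherian[OF c(1)]
          cells_complete[OF c(1,2)] cells_sigma_discrete[OF c(1)] scale_imp_ultraparacompact[OF c(1)] c(3)])
qed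

lemma homeomorphic_to_completely_ultrametrizable_imp_metrizable:
  assumes "completely_ultrametrizable_space X" "X homeomorphic_space Y"
  shows "metrizable_space Y"
  using completely_ultrametrizable_imp_metrizable[OF assms(1)] homeomorphic_metrizable_space[OF assms(2)] by blast

lemma graph_theoretic_tree_iff_completely_ultrametrizable:
  fixes X :: "'a topology"
  assumes "infinite (UNIV :: 'n set)" "topspace X \<lesssim> (UNIV :: 'n set)" "topspace X \<noteq> {}"
  shows "(\<exists>r :: 'n rel. graph_theoretic_tree r \<and> pruned_tree r \<and>
           X homeomorphic_space end_space (Field r) (tree_edges r) \<and>
           X homeomorphic_space ray_space r \<and>
           X homeomorphic_space branch_space r) \<longleftrightarrow> completely_ultrametrizable_space X"
proof
  assume "\<exists>r :: 'n rel. graph_theoretic_tree r \<and> pruned_tree r \<and>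
           X homeomorphic_space end_space (Field r) (tree_edges r) \<and>
           X homeomorphic_space ray_space r \<and>
           X homeomorphic_space branch_space r"
  then obtain r :: "'n rel" where r: "graph_theoretic_tree r" "pruned_tree r" "X homeomorphic_space branch_space r"
    by (elim exE conjE) (rule that)
  show "completely_ultrametrizable_space X"
    by (rule homeomorphic_completely_ultrametrizable[OF r(3) graph_theoretic_tree_completely_ultrametrizable[OF r(1,2)]])
next
  assume X: "completely_ultrametrizable_space X"
  show "\<exists>r :: 'n rel. graph_theoretic_tree r \<and> pruned_tree r \<and>
           X homeomorphic_space end_space (Field r) (tree_edges r) \<and>
           X homeomorphic_space ray_space r \<and>
           X homeomorphic_space branch_space r"
    by (rule completely_ultrametrizable_imp_tree[OF X assms(3,1,2)]) (intro exI conjI)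
qed

lemma end_space_iff_completely_ultrametrizable:
  fixes X :: "'a topology"
  assumes "infinite (UNIV :: 'n set)" "topspace X \<lesssim> (UNIV :: 'n set)"
  shows "(\<exists>(V :: 'n set) E. simple_graph V E \<and> metrizable_space (end_space V E) \<and>
      X homeomorphic_space end_space V E) \<longleftrightarrow> completely_ultrametrizable_space X"
proof
  assume "\<exists>(V :: 'n set) E. simple_graph V E \<and> metrizable_space (end_space V E) \<and>
      X homeomorphic_space end_space V E"
  then show "completely_ultrametrizable_space X"
    by (elim exE conjE) (rule homeomorphic_completely_ultrametrizable, assumption, rule metrizable_end_space_imp_completely_ultrametrizable, assumption)
next
  assume X: "completely_ultrametrizable_space X"
  have "\<exists>(V :: 'n set) E. simple_graph V E \<and> X homeomorphic_space end_space V E"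
  proof (cases "topspace X = {}")
    case True
    have "simple_graph ({} :: 'n set) {}" unfolding simple_graph_def by simp
    moreover have "X homeomorphic_space end_space ({} :: 'n set) {}"
      by (rule homeomorphic_empty_spaces[OF True empty_end_space])
    ultimately show ?thesis by (intro exI conjI)
  next
    case False
    obtain r :: "'n rel" where "X homeomorphic_space end_space (Field r) (tree_edges r)"
      by (rule completely_ultrametrizable_imp_tree[OF X False assms]) (rule that)
    then show ?thesis using simple_graph_tree_edges by (intro exI conjI)
  qed
  then show "\<exists>(V :: 'n set) E. simple_graph V E \<and> metrizable_space (end_space V E) \<and>
      X homeomorphic_space end_space V E"
    using homeomorphic_to_completely_ultrametrizable_imp_metrizable[OF X] by blast
qed

lemma ray_space_iff_completely_ultrametrizable:
  fixes X :: "'a topology"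
  assumes "infinite (UNIV :: 'n set)" "topspace X \<lesssim> (UNIV :: 'n set)"
  shows "(\<exists>r :: 'n rel. order_tree r \<and> metrizable_space (ray_space r) \<and> X homeomorphic_space ray_space r)
    \<longleftrightarrow> completely_ultrametrizable_space X"
proof
  assume "\<exists>r :: 'n rel. order_tree r \<and> metrizable_space (ray_space r) \<and> X homeomorphic_space ray_space r"
  then show "completely_ultrametrizable_space X"
    by (elim exE conjE) (rule homeomorphic_completely_ultrametrizable, assumption, rule metrizable_ray_space_imp_completely_ultrametrizable, assumption+)
next
  assume X: "completely_ultrametrizable_space X"
  have "\<exists>r :: 'n rel. order_tree r \<and> X homeomorphic_space ray_space r"
  proof (cases "topspace X = {}")
    case True
    show ?thesis
      using homeomorphic_empty_spaces[OF True singleton_tree(2)] singleton_tree(1) by (intro exI conjI)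
  next
    case False
    obtain r :: "'n rel" where r: "graph_theoretic_tree r" "X homeomorphic_space ray_space r"
      by (rule completely_ultrametrizable_imp_tree[OF X False assms]) (rule that)
    then show ?thesis unfolding graph_theoretic_tree_def by blast
  qed
  then show "\<exists>r :: 'n rel. order_tree r \<and> metrizable_space (ray_space r) \<and> X homeomorphic_space ray_space r"
    using homeomorphic_to_completely_ultrametrizable_imp_metrizable[OF X] by blast
qed

lemma branch_space_iff_completely_ultrametrizable:
  fixes X :: "'a topology"
  assumes "infinite (UNIV :: 'n set)" "topspace X \<lesssim> (UNIV :: 'n set)" "topspace X \<noteq> {}"
  shows "(\<exists>r :: 'n rel. order_tree r \<and> metrizable_space (branch_space r) \<and> X homeomorphic_space branch_space r)
    \<longleftrightarrow> completely_ultrametrizable_space X"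
proof
  assume "\<exists>r :: 'n rel. order_tree r \<and> metrizable_space (branch_space r) \<and> X homeomorphic_space branch_space r"
  then show "completely_ultrametrizable_space X"
    by (elim exE conjE) (rule homeomorphic_completely_ultrametrizable, assumption, rule metrizable_branch_space_imp_completely_ultrametrizable, assumption+)
next
  assume X: "completely_ultrametrizable_space X"
  obtain r :: "'n rel" where r: "graph_theoretic_tree r" "X homeomorphic_space branch_space r"
    by (rule completely_ultrametrizable_imp_tree[OF X assms(3,1,2)]) (rule that)
  then show "\<exists>r :: 'n rel. order_tree r \<and> metrizable_space (branch_space r) \<and> X homeomorphic_space branch_space r"
    using homeomorphic_to_completely_ultrametrizable_imp_metrizable[OF X r(2)] unfolding graph_theoretic_tree_def by blast
qed

lemma subcompact_iff_completely_ultrametrizable: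
  "(ultraparacompact_space X \<and> subcompact_space X \<and> metrizable_space X) \<longleftrightarrow> completely_ultrametrizable_space X"
proof
  assume "ultraparacompact_space X \<and> subcompact_space X \<and> metrizable_space X"
  then show "completely_ultrametrizable_space X" by (elim conjE) (rule subcompact_imp_completely_ultrametrizable)
next
  assume X: "completely_ultrametrizable_space X"
  obtain \<B> where "base_for X \<B>" "complete_family \<B>" "ultraparacompact_space X"
    by (rule completely_ultrametrizable_imp_bases[OF X]) (rule that)
  then show "ultraparacompact_space X \<and> subcompact_space X \<and> metrizable_space X"
    using complete_base_imp_subcompact completely_ultrametrizable_imp_metrizable[OF X] by blast
qed

lemma nested_noetherian_base_iff_completely_ultrametrizable:
  assumes "Hausdorff_space X"
  shows "(\<exists>\<B>. base_for X \<B> \<and> nested_family \<B> \<and> noetherian_family \<B> \<and>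
         complete_family \<B> \<and> sigma_discrete_family X \<B>)
        \<longleftrightarrow> completely_ultrametrizable_space X"
proof
  assume "\<exists>\<B>. base_for X \<B> \<and> nested_family \<B> \<and> noetherian_family \<B> \<and>
         complete_family \<B> \<and> sigma_discrete_family X \<B>"
  then show "completely_ultrametrizable_space X" using nested_complete_imp_completely_ultrametrizable[OF assms] by blast
next
  assume X: "completely_ultrametrizable_space X"
  show "\<exists>\<B>. base_for X \<B> \<and> nested_family \<B> \<and> noetherian_family \<B> \<and>
         complete_family \<B> \<and> sigma_discrete_family X \<B>"
    by (rule completely_ultrametrizable_imp_bases[OF X]) (intro exI conjI)
qed

lemma nested_base_iff_completely_ultrametrizable:
  assumes "Hausdorff_space X"
  shows "(\<exists>\<B>. base_for X \<B> \<and> nested_family \<B> \<and>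
         complete_family \<B> \<and> sigma_discrete_family X \<B>)
        \<longleftrightarrow> completely_ultrametrizable_space X"
  using nested_complete_imp_completely_ultrametrizable[OF assms] nested_noetherian_base_iff_completely_ultrametrizable[OF assms] by blast

lemma clopen_base_iff_completely_ultrametrizable:
  assumes "Hausdorff_space X"
  shows "(\<exists>\<B>. clopen_base_for X \<B> \<and> complete_family \<B> \<and> sigma_locally_finite_family X \<B>)
        \<longleftrightarrow> completely_ultrametrizable_space X"
proof
  assume "\<exists>\<B>. clopen_base_for X \<B> \<and> complete_family \<B> \<and> sigma_locally_finite_family X \<B>"
  then show "completely_ultrametrizable_space X" using sigma_locally_finite_imp_completely_ultrametrizable[OF assms] by blast
next
  assume X: "completely_ultrametrizable_space X"
  obtain \<B> where B: "base_for X \<B>" "nested_family \<B>" "complete_family \<B>" "sigma_discrete_family X \<B>"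
    by (rule completely_ultrametrizable_imp_bases[OF X]) (rule that)
  have "clopen_base_for X \<B>"
    unfolding clopen_base_for_def using B(1) nested_base_closed[OF assms B(1,2)] by blast
  then show "\<exists>\<B>. clopen_base_for X \<B> \<and> complete_family \<B> \<and> sigma_locally_finite_family X \<B>"
    using B(3) sigma_discrete_imp_sigma_locally_finite[OF B(1,4)] by blast
qed

theorem theorem3p1:
  fixes X :: "'a topology"
  assumes "Hausdorff_space X"
    and "infinite (UNIV :: 'n set)"
    and "topspace X \<lesssim> (UNIV :: 'n set)"
  shows
    "(topspace X \<noteq> {} \<longrightarrow>
       ((\<exists>r :: 'n rel. graph_theoretic_tree r \<and> pruned_tree r \<and>
           X homeomorphic_space end_space (Field r) (tree_edges r) \<and>
           X homeomorphic_space ray_space r \<and>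
           X homeomorphic_space branch_space r)
        \<longleftrightarrow> completely_ultrametrizable_space X)) \<and>
     ((\<exists>(V :: 'n set) E. simple_graph V E \<and> metrizable_space (end_space V E) \<and>
         X homeomorphic_space end_space V E)
        \<longleftrightarrow> completely_ultrametrizable_space X) \<and>
     ((\<exists>r :: 'n rel. order_tree r \<and> metrizable_space (ray_space r) \<and>
         X homeomorphic_space ray_space r)
        \<longleftrightarrow> completely_ultrametrizable_space X) \<and>
     (topspace X \<noteq> {} \<longrightarrow>
       ((\<exists>r :: 'n rel. order_tree r \<and> metrizable_space (branch_space r) \<and>
           X homeomorphic_space branch_space r)
        \<longleftrightarrow> completely_ultrametrizable_space X)) \<and>
     ((ultraparacompact_space X \<and> subcompact_space X \<and> metrizable_space X)
        \<longleftrightarrow> completely_ultrametrizable_space X) \<and>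
     ((\<exists>\<B>. base_for X \<B> \<and> nested_family \<B> \<and> noetherian_family \<B> \<and>
         complete_family \<B> \<and> sigma_discrete_family X \<B>)
        \<longleftrightarrow> completely_ultrametrizable_space X) \<and>
     ((\<exists>\<B>. base_for X \<B> \<and> nested_family \<B> \<and>
         complete_family \<B> \<and> sigma_discrete_family X \<B>)
        \<longleftrightarrow> completely_ultrametrizable_space X) \<and>
     ((\<exists>\<B>. clopen_base_for X \<B> \<and>
         complete_family \<B> \<and> sigma_locally_finite_family X \<B>)
        \<longleftrightarrow> completely_ultrametrizable_space X)"
  by (intro conjI impI graph_theoretic_tree_iff_completely_ultrametrizable[OF assms(2,3)] end_space_iff_completely_ultrametrizable[OF assms(2,3)]
      ray_space_iff_completely_ultrametrizable[OF assms(2,3)] branch_space_iff_completely_ultrametrizable[OF assms(2,3)] subcompact_iff_completely_ultrametrizable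
      nested_noetherian_base_iff_completely_ultrametrizable[OF assms(1)] nested_base_iff_completely_ultrametrizable[OF assms(1)] clopen_base_iff_completely_ultrametrizable[OF assms(1)])

end
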